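(* Let $\varepsilon\in(0,1)$. In the distributed monitoring model with $k$ servers over a universe of size $n$ and a stream of length $m=\mathrm{poly}(n)$, there exist adversarially robust distributed monitoring protocols that achieve: (1) a $(1+\varepsilon)$-approximation to the number of distinct elements $F_0$ at all times, using $\frac{k}{\varepsilon^2}\cdot\mathrm{polylog}(n)$ bits of communication; (2) a $(1+\varepsilon)$-approximation to the count $F_1$ at all times, using $\left(k+\frac{\sqrt{k}}{\varepsilon}\right)\cdot\mathrm{polylog}(n)$ bits of communication; (3) a solution to the $L_2$-heavy-hitters problem with parameter $\varepsilon$ at all times, using $\frac{k}{\varepsilon^2}\cdot\mathrm{polylog}(n)$ bits of communication.
   Context: Distributed monitoring (coordinator) model: $k$ servers and a coordinator with private two-way channels; at each time $t\in[m]$ an update increments one coordinate of $[n]$ at one server (seen only by that server); $f^{(t)}\in\mathbb{Z}_{\ge0}^n$ is the global frequency vector after $t$ updates (summed over servers). Communication cost is total bits sent. $F_0(f)=|\{i:f_i\neq 0\}|$, $F_1(f)=\sum_i f_i$ (the total number of updates). $(1+\varepsilon)$-approximation of $F$ means a value in $[(1-\varepsilon)F,(1+\varepsilon)F]$. $L_2$-heavy-hitters problem: output a list $\mathcal{L}$ containing every $i\in[n]$ with $f_i\ge\varepsilon\|f\|_2$ and no $j$ with $f_j\le\frac{\varepsilon}{2}\|f\|_2$, together with, for each $i\in\mathcal{L}$, an estimate of $f_i$ with additive error $\frac{\varepsilon}{4}\|f\|_2$. Adversarial robustness: updates are chosen by an adaptive adversary who, after each update, observes the protocol's current output and may choose the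 next update based on all previous outputs; the protocol must be correct at all times simultaneously with high probability. *)

theory Defs
  imports "HOL-Probability.Probability"
begin

type_synonym bits = "bool list"

text \<open>
  A party acts only when something happens to it: a server when it receives an update or a message,
  the coordinator when it receives a message.  In particular no party has access to the global
  time (otherwise monitoring \<open>F\<^sub>1\<close> would be free).  All parties flip private coins, given by the
  local transition distributions; there is no shared randomness.  The empty bit string stands for
  ``no message''.
\<close>

record ('s, 'c, 'o) protocol =
  server_init :: "nat \<Rightarrow> 's"
  server_update :: "nat \<Rightarrow> 's \<Rightarrow> nat \<Rightarrow> ('s \<times> bits) pmf"
  server_receive :: "nat \<Rightarrow> 's \<Rightarrow> bits \<Rightarrow> ('s \<times> bits) pmf"
  coord_init :: 'c
  coord_receive :: "'c \<Rightarrow> nat \<Rightarrow> bits \<Rightarrow> ('c \<times> (nat \<Rightarrow> bits)) pmf"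
  coord_output :: "'c \<Rightarrow> 'o"

datatype message = To_Coord nat (payload: bits) | To_Server nat (payload: bits)

text \<open>\<open>channel\<close> holds the messages in transit, \<open>cost\<close> the number of bits sent so far.\<close>

record ('s, 'c) config =
  servers :: "nat \<Rightarrow> 's"
  coord :: 'c
  channel :: "message list"
  cost :: nat

definition init_config :: "('s, 'c, 'o) protocol \<Rightarrow> ('s, 'c) config" where
  "init_config P =
     \<lparr>servers = server_init P, coord = coord_init P, channel = [], cost = 0\<rparr>"

definition send :: "message list \<Rightarrow> ('s, 'c) config \<Rightarrow> ('s, 'c) config" where
  "send ms C =
     (let ms' = filter (\<lambda>msg. payload msg \<noteq> []) ms
      in C\<lparr>channel := channel C @ ms',
           cost := cost C + (\<Sum>msg\<leftarrow>ms'. length (payload msg))\<rparr>)"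

definition server_act :: "nat \<Rightarrow> ('s \<times> bits) pmf \<Rightarrow> ('s, 'c) config \<Rightarrow> ('s, 'c) config pmf" where
  "server_act j p C =
     map_pmf (\<lambda>(s, w). send [To_Coord j w] (C\<lparr>servers := (servers C)(j := s)\<rparr>)) p"

definition coord_act :: "nat \<Rightarrow> ('c \<times> (nat \<Rightarrow> bits)) pmf \<Rightarrow> ('s, 'c) config \<Rightarrow> ('s, 'c) config pmf"
  where
  "coord_act k p C =
     map_pmf (\<lambda>(s, w). send (map (\<lambda>j. To_Server j (w j)) [0..<k]) (C\<lparr>coord := s\<rparr>)) p"

definition deliver ::
  "('s, 'c, 'o) protocol \<Rightarrow> nat \<Rightarrow> ('s, 'c) config \<Rightarrow> ('s, 'c) config pmf" where
  "deliver P k C =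
     (case channel C of
        [] \<Rightarrow> return_pmf C
      | To_Coord j w # q \<Rightarrow> coord_act k (coord_receive P (coord C) j w) (C\<lparr>channel := q\<rparr>)
      | To_Server j w # q \<Rightarrow> server_act j (server_receive P j (servers C j) w) (C\<lparr>channel := q\<rparr>))"

text \<open>
  Communication takes place until no message is in transit; the number of rounds is not bounded
  a priori, and missing probability mass corresponds to an exchange that never ends.
\<close>

partial_function (spmf) settle ::
  "('s, 'c, 'o) protocol \<Rightarrow> nat \<Rightarrow> ('s, 'c) config \<Rightarrow> ('s, 'c) config spmf" where
  "settle P k C =
     (if channel C = [] then return_spmf C
      else bind_spmf (spmf_of_pmf (deliver P k C)) (\<lambda>C'. settle P k C'))"

definition process_update ::
  "('s, 'c, 'o) protocol \<Rightarrow> nat \<Rightarrow> nat \<times> nat \<Rightarrow> ('s, 'c) config \<Rightarrow> ('s, 'c) config spmf" where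
  "process_update P k u C =
     (case u of (j, i) \<Rightarrow>
        bind_spmf (spmf_of_pmf (server_act j (server_update P j (servers C j) i) C)) (settle P k))"

text \<open>
  An update \<open>(j, i)\<close> increments coordinate \<open>i\<close> at server \<open>j\<close>.  A history lists, in chronological
  order, each update together with the output of the coordinator after processing it.
\<close>

type_synonym 'o history = "((nat \<times> nat) \<times> 'o) list"

type_synonym 'o adversary = "'o history \<Rightarrow> (nat \<times> nat) pmf"

definition valid_adversary :: "nat \<Rightarrow> nat \<Rightarrow> 'o adversary \<Rightarrow> bool" where
  "valid_adversary k n A \<longleftrightarrow> (\<forall>h. set_pmf (A h) \<subseteq> {..<k} \<times> {..<n})"

primrec run ::
  "('s, 'c, 'o) protocol \<Rightarrow> nat \<Rightarrow> 'o adversary \<Rightarrow> nat \<Rightarrow> (('s, 'c) config \<times> 'o history) spmf" where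
  "run P k A 0 = return_spmf (init_config P, [])"
| "run P k A (Suc t) =
     bind_spmf (run P k A t) (\<lambda>(C, h).
       bind_spmf (spmf_of_pmf (A h)) (\<lambda>u.
         map_spmf (\<lambda>C'. (C', h @ [(u, coord_output P (coord C'))])) (process_update P k u C)))"

definition freq :: "'o history \<Rightarrow> nat \<Rightarrow> nat" where
  "freq h i = length (filter (\<lambda>((_, i'), _). i' = i) h)"

definition always_correct :: "((nat \<Rightarrow> nat) \<Rightarrow> 'o \<Rightarrow> bool) \<Rightarrow> 'o history \<Rightarrow> bool" where
  "always_correct correct h \<longleftrightarrow>
     (\<forall>t\<in>{1..length h}. correct (freq (take t h)) (snd (h ! (t - 1))))"

text \<open>
  Correctness at all times holds with probability at least \<open>1 - \<delta>\<close>; the communication bound \<open>B\<close>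
  holds in every execution.
\<close>

definition robustly_monitors ::
  "('s, 'c, 'o) protocol \<Rightarrow> nat \<Rightarrow> nat \<Rightarrow> nat \<Rightarrow> ((nat \<Rightarrow> nat) \<Rightarrow> 'o \<Rightarrow> bool) \<Rightarrow> real \<Rightarrow> real \<Rightarrow> bool"
  where
  "robustly_monitors P k n m correct \<delta> B \<longleftrightarrow>
     (\<forall>A. valid_adversary k n A \<longrightarrow>
        lossless_spmf (run P k A m) \<and>
        (\<forall>(C, h) \<in> set_spmf (run P k A m). real (cost C) \<le> B) \<and>
        measure (measure_spmf (run P k A m)) {(C, h). always_correct correct h} \<ge> 1 - \<delta>)"

definition F0 :: "nat \<Rightarrow> (nat \<Rightarrow> nat) \<Rightarrow> nat" where
  "F0 n f = card {i. i < n \<and> f i \<noteq> 0}"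

definition F1 :: "nat \<Rightarrow> (nat \<Rightarrow> nat) \<Rightarrow> nat" where
  "F1 n f = (\<Sum>i<n. f i)"

definition norm2 :: "nat \<Rightarrow> (nat \<Rightarrow> nat) \<Rightarrow> real" where
  "norm2 n f = L2_set (\<lambda>i. real (f i)) {..<n}"

definition approximates :: "real \<Rightarrow> ((nat \<Rightarrow> nat) \<Rightarrow> nat) \<Rightarrow> (nat \<Rightarrow> nat) \<Rightarrow> real \<Rightarrow> bool" where
  "approximates \<epsilon> F f x \<longleftrightarrow> x \<in> {(1 - \<epsilon>) * real (F f)..(1 + \<epsilon>) * real (F f)}"

text \<open>The domain of \<open>L\<close> is the output list, its values are the estimates.\<close>

definition heavy_hitters :: "real \<Rightarrow> nat \<Rightarrow> (nat \<Rightarrow> nat) \<Rightarrow> (nat \<rightharpoonup> real) \<Rightarrow> bool" where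
  "heavy_hitters \<epsilon> n f L \<longleftrightarrow>
     dom L \<subseteq> {..<n} \<and>
     (\<forall>i<n. real (f i) \<ge> \<epsilon> * norm2 n f \<longrightarrow> i \<in> dom L) \<and>
     (\<forall>j<n. real (f j) \<le> \<epsilon> / 2 * norm2 n f \<longrightarrow> j \<notin> dom L) \<and>
     (\<forall>i v. L i = Some v \<longrightarrow> \<bar>v - real (f i)\<bar> \<le> \<epsilon> / 4 * norm2 n f)"

text \<open>
  Since all transitions are discrete distributions, only countably many local states are
  reachable, so protocols with natural numbers as states are fully general.
\<close>

type_synonym 'o nat_protocol = "(nat, nat, 'o) protocol"

end

theory Submission imports Defs begin

text \<open>
  All three protocols use fresh private coins only: whether an update is reported is decided by a
  coin that is tossed when the update arrives, with a probability that depends on the public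
  parameter of the current phase and on local counts.  The estimates are therefore sums of
  increments whose conditional expectation is right whatever the adversary has seen, so
  adaptivity is harmless, and correctness follows from exponential supermartingales
  (Freedman's inequality) together with a union bound over the steps.

  \<^item> \<open>F\<^sub>0\<close>: a server reports a locally new item with probability \<open>p\<close>.  To decide whether the item
    is globally new, the coordinator asks servers in random order until one of them has the item.
    When \<open>r\<close> servers have it, this takes about \<open>k / r\<close> questions, and \<open>\<Sum>r. k / r\<close> is \<open>k\<close> up to a
    logarithm.

  \<^item> \<open>F\<^sub>1\<close>: updates are sampled with probability about \<open>\<surd>k / (\<epsilon> F\<^sub>1)\<close>, and all local counts are
    collected exactly each time \<open>F\<^sub>1\<close> has grown by a factor \<open>1 + \<surd>k \<epsilon>\<close>, so sampling errors
    only accumulate between two synchronizations.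

  \<^item> Heavy hitters: an update that raises a local count to \<open>x\<close> is reported with probability
    proportional to \<open>k x / (\<epsilon>\<^sup>2 F\<^sub>2)\<close>.  The variance of the resulting estimate of \<open>f\<^sub>i\<close> is at most
    \<open>\<epsilon>\<^sup>2 F\<^sub>2\<close> up to a logarithm, and the expected number of reports is about
    \<open>\<Sum>i j. k (f\<^sub>i\<^sub>j)\<^sup>2 / (\<epsilon>\<^sup>2 F\<^sub>2) \<le> k / \<epsilon>\<^sup>2\<close>.  To track \<open>F\<^sub>2\<close> itself, the coordinator asks a random server
    for its count \<open>y\<close> of the reported item and collects all counts with probability \<open>min 1 (y / x)\<close>;
    the increment of \<open>F\<^sub>2\<close> is weighted by the inverse of the (then known) probability of this event.
\<close>

section \<open>Protocols with sequential queries\<close>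

text \<open>Two requirements shape the development. Communication must respect the bound in every
  execution, so a protocol shuts down after a fixed number of events; correctness then includes that
  the shutdown does not happen, and the cost gets an exponential potential of its own beside those
  of the estimates. Moreover, the lengths of phases are random and influenced by the adversary,
  which would normally call for stopping times. For distinct elements and heavy hitters there is
  instead one potential per possible phase: it is followed from the beginning, is controlled because
  earlier phases sample at least as often, and becomes 0 once its phase is over. Only the drift in a
  single step from a good state is ever needed, and a good state stays good as long as all
  potentials are below \<open>exp L\<close>.

  Apart from the coin of the server, all randomness of one update is a single draw of the
  coordinator, made before any question is asked. One update is therefore one random step on an
  abstract state, and the message exchange is eliminated before any probability is
  estimated.\<close>

fun nbits :: "nat \<Rightarrow> bool list" where
  "nbits n = (if n = 0 then [] else odd n # nbits (n div 2))"

declare nbits.simps [simp del]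

primrec val :: "bool list \<Rightarrow> nat" where
  "val [] = 0"
| "val (b # bs) = of_bool b + 2 * val bs"

lemma val_nbits [simp]: "val (nbits n) = n"
proof (induction n rule: nbits.induct)
  case (1 n)
  then show ?case by (subst nbits.simps) auto
qed

lemma length_nbits: "v < 2 ^ l \<Longrightarrow> length (nbits v) \<le> l"
proof (induction l arbitrary: v)
  case 0
  then show ?case by (simp add: nbits.simps)
next
  case (Suc l)
  have "v div 2 < 2 ^ l" using Suc.prems by auto
  then show ?case using Suc.IH[of "v div 2"] by (subst nbits.simps) auto
qed

section \<open>Local views of a history\<close>

definition items :: "nat \<Rightarrow> 'o history \<Rightarrow> nat list" where
  "items j h = rev (map (\<lambda>e. snd (fst e)) (filter (\<lambda>e. fst (fst e) = j) h))"

lemma items_Nil [simp]: "items j [] = []"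
  by (simp add: items_def)

lemma items_snoc: "items j (h @ [((j', i), x)]) = (if j' = j then i # items j h else items j h)"
  by (simp add: items_def)

lemma length_items: "length (items j h) \<le> length h"
  by (simp add: items_def)

text \<open>The lists right after an update has arrived. A history can be extended only together
  with an output, which is not yet known at this moment.\<close>

definition arrival :: "'o history \<Rightarrow> nat \<times> nat \<Rightarrow> nat \<Rightarrow> nat list" where
  "arrival h u l = (if l = fst u then snd u # items l h else items l h)"

lemma arrival_snoc: "items l (h @ [(u, x)]) = arrival h u l"
  by (cases u) (auto simp: arrival_def items_snoc)

definition valid_history :: "nat \<Rightarrow> nat \<Rightarrow> 'o history \<Rightarrow> bool" where
  "valid_history k n h \<longleftrightarrow> (\<forall>e\<in>set h. fst e \<in> {..<k} \<times> {..<n})"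

lemma valid_history_snoc:
  "valid_history k n (h @ [(u, x)]) \<longleftrightarrow> valid_history k n h \<and> u \<in> {..<k} \<times> {..<n}"
  by (auto simp: valid_history_def)

lemma set_items: "valid_history k n h \<Longrightarrow> set (items j h) \<subseteq> {..<n}"
  by (force simp: items_def valid_history_def)

primrec ask :: "(nat list \<Rightarrow> bool) \<Rightarrow> (nat \<Rightarrow> nat) \<Rightarrow> nat list \<Rightarrow> nat list \<Rightarrow> nat list" where
  "ask st f as [] = as"
| "ask st f as (l # ls) = (if st as then as else ask st f (as @ [f l]) ls)"

lemma length_ask: "length (ask st f as ls) \<le> length as + length ls"
proof (induction ls arbitrary: as)
  case (Cons l ls)
  then show ?case using Cons[of "as @ [f l]"] by simp
qed simp

text \<open>The state between two updates, when no message is in transit. Local states of servers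
  are not stored, since the history and the current parameter determine them.\<close>

record ('q, 'o) abstract_state =
  hist :: "'o history"
  knowledge :: 'q
  events :: nat
  bits_sent :: nat

text \<open>
  A server whose updates so far, latest first, are \<open>xs\<close> reports the number \<open>rep xs\<close> with
  probability \<open>rate \<theta> xs\<close>.  On a report \<open>v\<close>, the coordinator in state \<open>q\<close> draws \<open>x\<close> and puts
  the question \<open>qry v\<close> to the servers listed in \<open>plan q j v x\<close>, one after the other, until \<open>stop\<close>
  holds of the answers \<open>as\<close>.  The new state is \<open>upd q c j v x as\<close>, where \<open>c\<close> counts reports, questions
  and broadcasts, and its parameter \<open>par\<close> is broadcast if it has changed.  After \<open>BUD\<close> such events the
  protocol is shut down, so that the communication bound holds in every execution.
\<close>

locale query_protocol =
  fixes k n m LEN BUD PL :: nat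
    and rate :: "nat \<Rightarrow> nat list \<Rightarrow> real"
    and rep :: "nat list \<Rightarrow> nat"
    and ans :: "nat \<Rightarrow> nat list \<Rightarrow> nat"
    and qry :: "nat \<Rightarrow> nat"
    and draw :: "'q::countable \<Rightarrow> nat \<Rightarrow> nat \<Rightarrow> 'x::countable pmf"
    and plan :: "'q \<Rightarrow> nat \<Rightarrow> nat \<Rightarrow> 'x \<Rightarrow> nat list"
    and stop :: "'q \<Rightarrow> nat \<Rightarrow> nat \<Rightarrow> 'x \<Rightarrow> nat list \<Rightarrow> bool"
    and upd :: "'q \<Rightarrow> nat \<Rightarrow> nat \<Rightarrow> nat \<Rightarrow> 'x \<Rightarrow> nat list \<Rightarrow> 'q"
    and par :: "'q \<Rightarrow> nat"
    and q0 :: 'q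
    and out :: "'q \<Rightarrow> 'o"
  assumes plan_less: "set (plan q j v x) \<subseteq> {..<k}"
    and plan_length: "length (plan q j v x) \<le> PL"
    and rep_small: "\<lbrakk>set xs \<subseteq> {..<n}; length xs \<le> m; xs \<noteq> []\<rbrakk> \<Longrightarrow> rep xs < 2 ^ LEN"
    and ans_small: "\<lbrakk>set xs \<subseteq> {..<n}; length xs \<le> m\<rbrakk> \<Longrightarrow> ans z xs < 2 ^ LEN"
    and qry_small: "v < 2 ^ LEN \<Longrightarrow> qry v < 2 ^ LEN"
    and par_small: "Suc (par q) < 2 ^ LEN"
    and draw_finite: "finite (set_pmf (draw q j v))"
begin

text \<open>
  The value \<open>0\<close> tells the servers to stop reporting, hence the shift by one.
\<close>

definition param :: "'q \<Rightarrow> nat \<Rightarrow> nat" where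
  "param q c = (if c \<ge> BUD then 0 else Suc (par q))"

text \<open>Every event is charged here except a broadcast caused by the shutdown alone. That one
  happens at most once and accounts for the extra summand \<open>k\<close> in the bound on the
  bits.\<close>

definition after :: "'q \<Rightarrow> nat \<Rightarrow> nat \<Rightarrow> nat \<Rightarrow> 'x \<Rightarrow> nat list \<Rightarrow> 'q \<times> nat" where
  "after q c j v x as =
     (let q' = upd q c j v x as
      in (q', c + 1 + length as + (if par q' \<noteq> par q then k else 0)))"

text \<open>Each payload has a leading tag. Sent to a server, \<open>True\<close> marks a question
  and \<open>False\<close> a new parameter. The tag also keeps a payload nonempty when the number is
  0, whose encoding is empty; an empty string would be no message.\<close>

definition finish :: "'q \<Rightarrow> nat \<Rightarrow> nat \<Rightarrow> nat \<Rightarrow> 'x \<Rightarrow> nat list \<Rightarrow> nat \<times> (nat \<Rightarrow> bits)" where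
  "finish q c j v x as =
     (case after q c j v x as of (q', c') \<Rightarrow>
       (to_nat (q', c', None :: (nat \<times> nat \<times> 'x \<times> nat list \<times> nat list) option),
        \<lambda>l. if param q' c' \<noteq> param q c then False # nbits (param q' c') else []))"

definition proceed ::
  "'q \<Rightarrow> nat \<Rightarrow> nat \<Rightarrow> nat \<Rightarrow> 'x \<Rightarrow> nat list \<Rightarrow> nat list \<Rightarrow> nat \<times> (nat \<Rightarrow> bits)" where
  "proceed q c j v x ls as =
     (if ls = [] \<or> stop q j v x as then finish q c j v x as
      else (to_nat (q, c, Some (j, v, x, tl ls, as)),
            \<lambda>l. if l = hd ls then True # nbits (qry v) else []))"

definition prot :: "(nat, nat, 'o) protocol" where
  "prot =
     \<lparr>server_init = (\<lambda>j. to_nat ([] :: nat list, param q0 0)),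
      server_update = (\<lambda>j s i.
        case from_nat s of (xs :: nat list, \<theta> :: nat) \<Rightarrow>
          map_pmf (\<lambda>b. (to_nat (i # xs, \<theta>), if b then True # nbits (rep (i # xs)) else []))
            (bernoulli_pmf (if \<theta> = 0 then 0 else rate (\<theta> - 1) (i # xs)))),
      server_receive = (\<lambda>j s w.
        case from_nat s of (xs :: nat list, \<theta> :: nat) \<Rightarrow>
          return_pmf (if hd w then (s, True # nbits (ans (val (tl w)) xs))
                      else (to_nat (xs, val (tl w)), []))),
      coord_init = to_nat (q0, 0 :: nat, None :: (nat \<times> nat \<times> 'x \<times> nat list \<times> nat list) option),
      coord_receive = (\<lambda>cs l w.
        case from_nat cs of (q, c :: nat, pend) \<Rightarrow>
          (case pend of
             None \<Rightarrow>
               map_pmf (\<lambda>x. proceed q c l (val (tl w)) x (plan q l (val (tl w)) x) [])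
                 (draw q l (val (tl w)))
           | Some (j, v, x, ls, as) \<Rightarrow> return_pmf (proceed q c j v x ls (as @ [val (tl w)])))),
      coord_output = (\<lambda>cs.
        case from_nat cs of
          (q, c :: nat, pend :: (nat \<times> nat \<times> 'x \<times> nat list \<times> nat list) option) \<Rightarrow> out q)\<rparr>"

lemma prot_simps:
  "server_init prot = (\<lambda>j. to_nat ([] :: nat list, param q0 0))"
  "server_update prot j s i = (case from_nat s of (xs :: nat list, \<theta> :: nat) \<Rightarrow>
     map_pmf (\<lambda>b. (to_nat (i # xs, \<theta>), if b then True # nbits (rep (i # xs)) else []))
       (bernoulli_pmf (if \<theta> = 0 then 0 else rate (\<theta> - 1) (i # xs))))"
  "server_receive prot j s w = (case from_nat s of (xs :: nat list, \<theta> :: nat) \<Rightarrow>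
     return_pmf (if hd w then (s, True # nbits (ans (val (tl w)) xs)) else (to_nat (xs, val (tl w)), [])))"
  "coord_init prot = to_nat (q0, 0 :: nat, None :: (nat \<times> nat \<times> 'x \<times> nat list \<times> nat list) option)"
  "coord_receive prot (to_nat (q, c, None :: (nat \<times> nat \<times> 'x \<times> nat list \<times> nat list) option)) j w =
     map_pmf (\<lambda>x. proceed q c j (val (tl w)) x (plan q j (val (tl w)) x) []) (draw q j (val (tl w)))"
  "coord_receive prot (to_nat (q, c, Some (j, v, x, ls, as))) l w =
     return_pmf (proceed q c j v x ls (as @ [val (tl w)]))"
  "coord_output prot (to_nat (q, c, None :: (nat \<times> nat \<times> 'x \<times> nat list \<times> nat list) option)) = out q"
  by (simp_all add: prot_def)

text \<open>A configuration has a local state for every natural number, but broadcasts reach only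
  the servers below \<open>k\<close>; all others keep the initial parameter.\<close>

definition server_state :: "(nat \<Rightarrow> nat list) \<Rightarrow> nat \<Rightarrow> nat \<Rightarrow> nat" where
  "server_state S \<theta> l = to_nat (S l, if l < k then \<theta> else param q0 0)"

definition concrete :: "('q, 'o) abstract_state \<Rightarrow> (nat, nat) config" where
  "concrete s =
     \<lparr>servers = server_state (\<lambda>l. items l (hist s)) (param (knowledge s) (events s)),
      coord = to_nat (knowledge s, events s, None :: (nat \<times> nat \<times> 'x \<times> nat list \<times> nat list) option),
      channel = [], cost = bits_sent s\<rparr>"

definition answers :: "('q, 'o) abstract_state \<Rightarrow> nat \<times> nat \<Rightarrow> 'x \<Rightarrow> nat list" where
  "answers s u x =
     (let v = rep (arrival (hist s) u (fst u)); q = knowledge s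
      in ask (stop q (fst u) v x) (\<lambda>l. ans (qry v) (arrival (hist s) u l)) []
           (plan q (fst u) v x))"

definition reported :: "('q, 'o) abstract_state \<Rightarrow> nat \<times> nat \<Rightarrow> 'x \<Rightarrow> ('q, 'o) abstract_state" where
  "reported s u x =
     (let v = rep (arrival (hist s) u (fst u)); q = knowledge s; c = events s;
          as = answers s u x; (q', c') = after q c (fst u) v x as
      in \<lparr>hist = hist s @ [(u, out q')], knowledge = q', events = c',
          bits_sent = bits_sent s + Suc (length (nbits v))
            + (\<Sum>a\<leftarrow>as. Suc (length (nbits (qry v))) + Suc (length (nbits a)))
            + (if param q' c' \<noteq> param q c then k * Suc (length (nbits (param q' c'))) else 0)\<rparr>)"

definition silent :: "('q, 'o) abstract_state \<Rightarrow> nat \<times> nat \<Rightarrow> ('q, 'o) abstract_state" where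
  "silent s u = s\<lparr>hist := hist s @ [(u, out (knowledge s))]\<rparr>"

definition report_prob :: "('q, 'o) abstract_state \<Rightarrow> nat \<times> nat \<Rightarrow> real" where
  "report_prob s u =
     (if events s \<ge> BUD then 0
      else rate (par (knowledge s)) (arrival (hist s) u (fst u)))"

definition astep :: "('q, 'o) abstract_state \<Rightarrow> nat \<times> nat \<Rightarrow> ('q, 'o) abstract_state pmf" where
  "astep s u =
     bind_pmf (bernoulli_pmf (report_prob s u)) (\<lambda>b.
       if b then map_pmf (reported s u)
         (draw (knowledge s) (fst u) (rep (arrival (hist s) u (fst u))))
       else return_pmf (silent s u))"

definition ainit :: "('q, 'o) abstract_state" where
  "ainit = \<lparr>hist = [], knowledge = q0, events = 0, bits_sent = 0\<rparr>"

section \<open>Exact simulation of the message exchange by abstract steps\<close>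

lemma concrete_init: "init_config prot = concrete ainit"
  by (auto simp: init_config_def concrete_def prot_simps ainit_def server_state_def)

lemma server_state_upd:
  "l < k \<Longrightarrow> (\<lambda>l'. if l' \<in> A then server_state S \<theta>' l' else server_state S \<theta> l')(l := to_nat (S l, \<theta>'))
    = (\<lambda>l'. if l' \<in> insert l A then server_state S \<theta>' l' else server_state S \<theta> l')"
  by (auto simp: server_state_def)

text \<open>Induction over the pending messages, where \<open>A\<close> is the set of servers that
  already hold the new parameter.\<close>

lemma settle_broadcast:
  assumes "set ls \<subseteq> {..<k}"
  shows "settle prot k \<lparr>servers = (\<lambda>l. if l \<in> A then server_state S \<theta>' l else server_state S \<theta> l),
      coord = cs, channel = map (\<lambda>l. To_Server l (False # nbits \<theta>')) ls, cost = b\<rparr>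
    = return_spmf \<lparr>servers = (\<lambda>l. if l \<in> A \<union> set ls then server_state S \<theta>' l else server_state S \<theta> l),
      coord = cs, channel = [], cost = b\<rparr>"
  using assms
proof (induction ls arbitrary: A)
  case Nil
  then show ?case by (simp add: settle.simps)
next
  case (Cons l ls)
  have "l < k" using Cons.prems by simp
  note upd = server_state_upd[OF this]
  have s: "from_nat (if l \<in> A then server_state S \<theta>' l else server_state S \<theta> l)
      = (S l, if l \<in> A then \<theta>' else \<theta>)"
    using \<open>l < k\<close> by (simp add: server_state_def)
  show ?case
    using Cons.IH[of "insert l A"] Cons.prems
    by (subst settle.simps)
      (simp add: deliver_def server_act_def send_def prot_simps s upd[simplified] spmf_of_pmf_return_pmf)
qed

definition act_result :: "nat \<times> (nat \<Rightarrow> bits) \<Rightarrow> (nat \<Rightarrow> nat) \<Rightarrow> nat \<Rightarrow> (nat, nat) config" where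
  "act_result r sv b =
     send (map (\<lambda>l. To_Server l (snd r l)) [0..<k])
       \<lparr>servers = sv, coord = fst r, channel = [], cost = b\<rparr>"

lemma filter_single_upt:
  "l < k \<Longrightarrow> filter (\<lambda>msg. payload msg \<noteq> []) (map (\<lambda>l'. To_Server l' (if l' = l then w else [])) [0..<k])
    = (if w = [] then [] else [To_Server l w])"
proof -
  assume "l < k"
  then have *: "[0..<k] = [0..<l] @ l # [Suc l..<k]"
    by (metis le_add_same_cancel1 less_imp_add_positive upt_add_eq_append upt_conv_Cons zero_le)
  show ?thesis unfolding * by (auto simp: filter_empty_conv)
qed

lemma settle_finish:
  assumes "after q c j v x as = (q', c')"
  shows "settle prot k (act_result (finish q c j v x as) (server_state S (param q c)) b)
    = return_spmf \<lparr>servers = server_state S (param q' c'),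
        coord = to_nat (q', c', None :: (nat \<times> nat \<times> 'x \<times> nat list \<times> nat list) option), channel = [],
        cost = b + (if param q' c' \<noteq> param q c then k * Suc (length (nbits (param q' c'))) else 0)\<rparr>"
proof (cases "param q' c' = param q c")
  case True
  then show ?thesis
    by (subst settle.simps) (simp add: assms act_result_def finish_def send_def filter_empty_conv)
next
  case False
  have e: "(\<lambda>l. if l < k then server_state S (param q' c') l else server_state S (param q c) l)
      = server_state S (param q' c')"
    by (auto simp: server_state_def)
  show ?thesis
    using settle_broadcast[of "[0..<k]" "{}" S "param q' c'" "param q c"] False
    by (simp add: assms act_result_def finish_def send_def o_def filter_map e sum_list_triv
        lessThan_atLeast0 cong: map_cong)
qed

text \<open>A question is one round trip: after two deliveries the configuration has the form
  \<open>act_result (proceed ...)\<close> again, with one more answer. Only answers beyond the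
  initial list \<open>as\<close> are charged, hence the \<open>drop\<close>.\<close>

lemma settle_proceed:
  assumes "set ls \<subseteq> {..<k}"
    and "after q c j v x (ask (stop q j v x) (\<lambda>l. ans (qry v) (S l)) as ls) = (q', c')"
  shows "settle prot k (act_result (proceed q c j v x ls as) (server_state S (param q c)) b)
    = return_spmf \<lparr>servers = server_state S (param q' c'),
        coord = to_nat (q', c', None :: (nat \<times> nat \<times> 'x \<times> nat list \<times> nat list) option), channel = [],
        cost = b
          + (\<Sum>a\<leftarrow>drop (length as) (ask (stop q j v x) (\<lambda>l. ans (qry v) (S l)) as ls).
               Suc (length (nbits (qry v))) + Suc (length (nbits a)))
          + (if param q' c' \<noteq> param q c then k * Suc (length (nbits (param q' c'))) else 0)\<rparr>"
  using assms
proof (induction ls arbitrary: as b)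
  case Nil
  then show ?case by (simp add: proceed_def settle_finish)
next
  case (Cons l ls)
  show ?case
  proof (cases "stop q j v x as")
    case True
    then show ?thesis using Cons.prems by (simp add: proceed_def settle_finish)
  next
    case False
    let ?f = "\<lambda>l. ans (qry v) (S l)"
    let ?r = "ask (stop q j v x) ?f (as @ [?f l]) ls"
    have l: "l < k" and ls: "set ls \<subseteq> {..<k}" using Cons.prems by auto
    have af: "after q c j v x ?r = (q', c')" using Cons.prems False by simp
    \<comment> \<open>\<open>ask\<close> only appends to its accumulator, so the new answer comes
      right after \<open>as\<close>.\<close>
    have dr: "drop (length as) ?r = ?f l # drop (Suc (length as)) ?r"
    proof -
      have "\<exists>zs. ask st f bs ms = bs @ zs" for st f bs ms
        by (induction ms arbitrary: bs) (auto, metis append.assoc)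
      then obtain zs where "?r = (as @ [?f l]) @ zs" by blast
      then show ?thesis by simp
    qed
    have fl: "from_nat (server_state S (param q c) l) = (S l, param q c)"
      and upd: "(server_state S (param q c))(l := server_state S (param q c) l) = server_state S (param q c)"
      using l by (auto simp: server_state_def)
    let ?cs = "to_nat (q, c, Some (j, v, x, ls, as))"
    let ?w = "True # nbits (qry v)"
    have "act_result (proceed q c j v x (l # ls) as) (server_state S (param q c)) b
        = \<lparr>servers = server_state S (param q c), coord = ?cs, channel = [To_Server l ?w],
            cost = b + length ?w\<rparr>"
      using False l by (simp add: proceed_def act_result_def send_def filter_single_upt[of l, simplified])
    moreover have "settle prot k \<lparr>servers = server_state S (param q c), coord = ?cs,
          channel = [To_Server l ?w], cost = b + length ?w\<rparr>
      = settle prot k \<lparr>servers = server_state S (param q c), coord = ?cs,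
          channel = [To_Coord l (True # nbits (?f l))],
          cost = b + length ?w + Suc (length (nbits (?f l)))\<rparr>"
      by (subst settle.simps)
        (simp add: deliver_def server_act_def send_def prot_simps fl upd)
    moreover have "settle prot k \<lparr>servers = server_state S (param q c), coord = ?cs,
          channel = [To_Coord l (True # nbits (?f l))],
          cost = b + length ?w + Suc (length (nbits (?f l)))\<rparr>
      = settle prot k (act_result (proceed q c j v x ls (as @ [?f l])) (server_state S (param q c))
          (b + length ?w + Suc (length (nbits (?f l)))))"
    proof -
      have "deliver prot k \<lparr>servers = server_state S (param q c), coord = ?cs,
          channel = [To_Coord l (True # nbits (?f l))],
          cost = b + length ?w + Suc (length (nbits (?f l)))\<rparr>
        = return_pmf (act_result (proceed q c j v x ls (as @ [?f l])) (server_state S (param q c))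
          (b + length ?w + Suc (length (nbits (?f l)))))"
        by (simp add: deliver_def coord_act_def prot_simps act_result_def case_prod_beta)
      then show ?thesis
        by (subst settle.simps) (simp only: config.simps list.simps if_False bind_spmf_of_pmf bind_return_pmf)
    qed
    ultimately show ?thesis
      using Cons.IH[OF ls af] False dr by simp
  qed
qed

lemma hist_reported [simp]: "hist (reported s u x) = hist s @ [(u, out (knowledge (reported s u x)))]"
  by (simp add: reported_def Let_def split: prod.splits)

lemma hist_silent [simp]: "hist (silent s u) = hist s @ [(u, out (knowledge (silent s u)))]"
  and knowledge_silent [simp]: "knowledge (silent s u) = knowledge s"
  and events_silent [simp]: "events (silent s u) = events s"
  and bits_silent [simp]: "bits_sent (silent s u) = bits_sent s"
  by (simp_all add: silent_def)

lemma hist_astep: "s' \<in> set_pmf (astep s u) \<Longrightarrow> hist s' = hist s @ [(u, out (knowledge s'))]"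
  by (auto simp: astep_def split: if_splits)

lemma output_concrete: "coord_output prot (coord (concrete s)) = out (knowledge s)"
  by (simp add: prot_simps concrete_def)

lemma settle_silent:
  assumes "j < k"
  shows "settle prot k \<lparr>servers = server_state (arrival (hist s) (j, i)) (param (knowledge s) (events s)),
      coord = coord (concrete s), channel = [], cost = bits_sent s\<rparr>
    = return_spmf (concrete (silent s (j, i)))"
  by (subst settle.simps) (simp add: concrete_def arrival_snoc[abs_def])

lemma settle_reported:
  assumes "j < k"
  shows "settle prot k \<lparr>servers = server_state (arrival (hist s) (j, i)) (param (knowledge s) (events s)),
      coord = coord (concrete s),
      channel = [To_Coord j (True # nbits (rep (arrival (hist s) (j, i) j)))],
      cost = bits_sent s + Suc (length (nbits (rep (arrival (hist s) (j, i) j))))\<rparr>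
    = map_spmf concrete (spmf_of_pmf (map_pmf (reported s (j, i))
        (draw (knowledge s) j (rep (arrival (hist s) (j, i) j)))))"
proof -
  let ?S = "arrival (hist s) (j, i)"
  let ?q = "knowledge s" and ?c = "events s"
  let ?v = "rep (?S j)"
  let ?b = "bits_sent s + Suc (length (nbits ?v))"
  have *: "settle prot k (act_result (proceed ?q ?c j ?v x (plan ?q j ?v x) [])
      (server_state ?S (param ?q ?c)) ?b) = return_spmf (concrete (reported s (j, i) x))" for x
  proof -
    obtain q' c' where a: "after ?q ?c j ?v x (ask (stop ?q j ?v x) (\<lambda>l. ans (qry ?v) (?S l)) []
        (plan ?q j ?v x)) = (q', c')" by (metis surj_pair)
    show ?thesis
      by (subst settle_proceed[OF plan_less a])
        (use a in \<open>simp add: concrete_def reported_def answers_def Let_def arrival_snoc[abs_def]\<close>)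
  qed
  let ?C = "\<lparr>servers = server_state ?S (param ?q ?c), coord = coord (concrete s),
      channel = [To_Coord j (True # nbits ?v)], cost = ?b\<rparr>"
  have "deliver prot k ?C = map_pmf (\<lambda>x. act_result (proceed ?q ?c j ?v x (plan ?q j ?v x) [])
      (server_state ?S (param ?q ?c)) ?b) (draw ?q j ?v)"
    by (simp add: deliver_def coord_act_def prot_simps concrete_def act_result_def case_prod_beta
        pmf.map_comp o_def)
  then have "settle prot k ?C = bind_pmf (draw ?q j ?v) (\<lambda>x. return_spmf (concrete (reported s (j, i) x)))"
    by (subst settle.simps) (simp only: config.simps list.simps if_False bind_spmf_of_pmf bind_map_pmf *)
  then show ?thesis
    by (simp add: bind_pmf_return_spmf pmf.map_comp o_def)
qed

text \<open>The plan is finite, so every exchange ends; the a priori partial \<open>settle\<close>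
  is the image of a proper distribution. This is where losslessness comes from.\<close>

lemma process_update_astep:
  assumes "j < k"
  shows "process_update prot k (j, i) (concrete s) = map_spmf concrete (spmf_of_pmf (astep s (j, i)))"
proof -
  let ?S = "arrival (hist s) (j, i)" and ?p = "param (knowledge s) (events s)"
  let ?w = "True # nbits (rep (?S j))"
  have Sj: "?S j = i # items j (hist s)"
    by (simp add: arrival_def)
  have sv: "(server_state (\<lambda>l. items l (hist s)) ?p)(j := to_nat (i # items j (hist s), ?p))
      = server_state ?S ?p"
    using assms by (auto simp: server_state_def arrival_def)
  have p: "(if ?p = 0 then 0 else rate (?p - 1) (i # items j (hist s))) = report_prob s (j, i)"
    by (simp add: param_def report_prob_def Sj)
  have upd: "server_update prot j (servers (concrete s) j) i =
      map_pmf (\<lambda>b. (to_nat (i # items j (hist s), ?p), if b then ?w else []))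
        (bernoulli_pmf (report_prob s (j, i)))"
    unfolding p[symmetric] Sj using assms by (simp add: prot_simps concrete_def server_state_def)
  let ?C = "\<lambda>b. send [To_Coord j (if b then ?w else [])]
      ((concrete s)\<lparr>servers := server_state ?S ?p\<rparr>)"
  have act: "server_act j (server_update prot j (servers (concrete s) j) i) (concrete s) =
      map_pmf ?C (bernoulli_pmf (report_prob s (j, i)))"
    unfolding upd server_act_def pmf.map_comp o_def
    using sv by (simp add: concrete_def)
  have st: "settle prot k (?C b) = map_spmf concrete (spmf_of_pmf
      (if b then map_pmf (reported s (j, i)) (draw (knowledge s) j (rep (?S j)))
       else return_pmf (silent s (j, i))))" for b
    using settle_silent[OF assms, of s i] settle_reported[OF assms, of s i]
    by (cases b) (simp_all add: send_def concrete_def[of s])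
  have "process_update prot k (j, i) (concrete s) =
      bind_pmf (bernoulli_pmf (report_prob s (j, i))) (\<lambda>b. settle prot k (?C b))"
    unfolding process_update_def by (simp only: prod.case act bind_spmf_of_pmf bind_map_pmf)
  also have "\<dots> = map_spmf concrete (spmf_of_pmf (astep s (j, i)))"
    unfolding st astep_def by (simp only: map_spmf_of_pmf spmf_of_pmf_bind map_bind_pmf fst_conv)
  finally show ?thesis .
qed

primrec arun :: "'o adversary \<Rightarrow> nat \<Rightarrow> ('q, 'o) abstract_state pmf" where
  "arun A 0 = return_pmf ainit"
| "arun A (Suc t) = bind_pmf (arun A t) (\<lambda>s. bind_pmf (A (hist s)) (astep s))"

lemma run_eq_arun:
  assumes "valid_adversary k n A"
  shows "run prot k A t = spmf_of_pmf (map_pmf (\<lambda>s. (concrete s, hist s)) (arun A t))"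
proof (induction t)
  case 0
  then show ?case by (simp add: concrete_init) (simp add: ainit_def)
next
  case (Suc t)
  have *: "map_spmf (\<lambda>C'. (C', hist s @ [(u, coord_output prot (coord C'))])) (process_update prot k u (concrete s))
      = spmf_of_pmf (map_pmf (\<lambda>s. (concrete s, hist s)) (astep s u))"
    if u: "u \<in> set_pmf (A (hist s))" for s u
  proof -
    obtain j i where ui: "u = (j, i)" "j < k"
      using u assms by (cases u) (auto simp: valid_adversary_def)
    show ?thesis
      by (auto simp: ui process_update_astep pmf.map_comp o_def output_concrete hist_astep
          intro!: arg_cong[of _ _ spmf_of_pmf] map_pmf_cong)
  qed
  show ?case
    by (auto simp: Suc bind_map_pmf * map_bind_pmf spmf_of_pmf_bind cong: bind_pmf_cong)
qed

text \<open>An event is worth at most two messages of at most \<open>LEN + 1\<close> bits, because a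
  question is counted once but also triggers an answer. The counter exceeds \<open>BUD\<close> only
  through a single report made below it, which adds at most \<open>1 + PL + k\<close>.\<close>

lemma bits_invariant:
  assumes "valid_adversary k n A" "t \<le> m" "s \<in> set_pmf (arun A t)"
  shows "valid_history k n (hist s) \<and> length (hist s) = t \<and>
    bits_sent s \<le> (LEN + 1) * (2 * events s + (if BUD \<le> events s then k else 0)) \<and>
    events s \<le> BUD + 1 + PL + k"
  using assms(2,3)
proof (induction t arbitrary: s)
  case 0
  then show ?case by (simp add: ainit_def valid_history_def)
next
  case (Suc t)
  from Suc.prems obtain s0 u where s0: "s0 \<in> set_pmf (arun A t)" and u: "u \<in> set_pmf (A (hist s0))"
    and s: "s \<in> set_pmf (astep s0 u)" by auto
  have IH: "valid_history k n (hist s0)" "length (hist s0) = t"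
    "bits_sent s0 \<le> (LEN + 1) * (2 * events s0 + (if BUD \<le> events s0 then k else 0))"
    "events s0 \<le> BUD + 1 + PL + k"
    using Suc.IH[OF _ s0] Suc.prems by auto
  have ur: "u \<in> {..<k} \<times> {..<n}" using u assms(1) by (auto simp: valid_adversary_def)
  have vh: "valid_history k n (hist s)" "length (hist s) = Suc t"
    using hist_astep[OF s] ur IH by (auto simp: valid_history_snoc)
  from s consider "s = silent s0 u" | x where "events s0 < BUD" "s = reported s0 u x"
    by (auto simp: astep_def report_prob_def set_pmf_iff[of _ "bernoulli_pmf _"] split: if_splits)
  then show ?case
  proof cases
    case 1
    then show ?thesis using IH vh by simp
  next
    case 2
    let ?S = "arrival (hist s0) u" and ?q = "knowledge s0"
    let ?v = "rep (?S (fst u))" and ?as = "answers s0 u x"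
    let ?N = "LEN + 1"
    have S: "set (?S l) \<subseteq> {..<n}" "length (?S l) \<le> m" "?S (fst u) \<noteq> []" for l
      using set_items[of k n "hist s" l] length_items[of l "hist s"] vh hist_astep[OF s]
        arrival_snoc[of l "hist s0" u "out (knowledge s)"] Suc.prems
      by (auto simp: arrival_def)
    have v: "?v < 2 ^ LEN" using S by (intro rep_small) auto
    have an: "a < 2 ^ LEN" if "a \<in> set ?as" for a
    proof -
      have "set (ask st f as ls) \<subseteq> set as \<union> range f" for st f as ls
        by (induction ls arbitrary: as) (auto, force)
      then have "a \<in> range (\<lambda>l. ans (qry ?v) (?S l))"
        using that unfolding answers_def Let_def by fastforce
      then show ?thesis using ans_small[OF S(1) S(2)] by auto
    qed
    have len: "length ?as \<le> PL"
      using length_ask[of _ _ "[]"] plan_length unfolding answers_def Let_def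
      by (metis add_0 le_trans list.size(3))
    obtain q' c' where a: "after ?q (events s0) (fst u) ?v x ?as = (q', c')" by fastforce
    have c': "c' = events s0 + 1 + length ?as + (if par q' \<noteq> par ?q then k else 0)"
      using a by (auto simp: after_def Let_def)
    have sums: "(\<Sum>a\<leftarrow>?as. Suc (length (nbits (qry ?v))) + Suc (length (nbits a))) \<le> ?N * (2 * length ?as)"
    proof -
      have "(\<Sum>a\<leftarrow>?as. Suc (length (nbits (qry ?v))) + Suc (length (nbits a))) \<le> (\<Sum>a\<leftarrow>?as. 2 * ?N)"
        using length_nbits[OF qry_small[OF v]] length_nbits[OF an] by (intro sum_list_mono) fastforce
      then show ?thesis by (simp add: sum_list_triv algebra_simps)
    qed
    have bc: "(if param q' c' \<noteq> param ?q (events s0) then k * Suc (length (nbits (param q' c'))) else 0)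
        \<le> ?N * ((if par q' \<noteq> par ?q then k else 0) + (if BUD \<le> c' then k else 0))"
    proof -
      have "length (nbits (param q' c')) \<le> LEN"
        using par_small[of q'] by (intro length_nbits) (auto simp: param_def)
      then have le: "k * Suc (length (nbits (param q' c'))) \<le> ?N * k" by (simp add: mult.commute)
      have "param q' c' \<noteq> param ?q (events s0) \<Longrightarrow> par q' \<noteq> par ?q \<or> BUD \<le> c'"
        using \<open>events s0 < BUD\<close> by (auto simp: param_def split: if_splits)
      then have "param q' c' \<noteq> param ?q (events s0) \<Longrightarrow>
          k \<le> (if par q' \<noteq> par ?q then k else 0) + (if BUD \<le> c' then k else 0)" by auto
      then show ?thesis using order.trans[OF le mult_le_mono2] by simp
    qed
    have "bits_sent s \<le> ?N * (2 * events s0) + ?N + ?N * (2 * length ?as) +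
        ?N * ((if par q' \<noteq> par ?q then k else 0) + (if BUD \<le> c' then k else 0))"
      using sums bc IH(3) 2 a length_nbits[OF v]
      by (simp add: reported_def Let_def)
    also have "\<dots> \<le> ?N * (2 * c' + (if BUD \<le> c' then k else 0))"
    proof -
      have "2 * events s0 + 1 + 2 * length ?as + ((if par q' \<noteq> par ?q then k else 0) + (if BUD \<le> c' then k else 0))
        \<le> 2 * c' + (if BUD \<le> c' then k else 0)" unfolding c' by simp
      from mult_le_mono2[OF this, of ?N] show ?thesis by (simp only: distrib_left mult_1_right)
    qed
    finally have "bits_sent s \<le> ?N * (2 * events s + (if BUD \<le> events s then k else 0))"
      using 2 a by (simp add: reported_def Let_def)
    moreover have "events s \<le> BUD + 1 + PL + k"
      using 2 a c' len by (simp add: reported_def Let_def)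
    ultimately show ?thesis using vh by blast
  qed
qed

section \<open>From one-step drift to correctness at all times\<close>

lemma finite_astep: "finite (set_pmf (astep s u))"
  by (auto simp: astep_def draw_finite intro: finite_subset[OF subset_UNIV])

text \<open>The flag records whether \<open>G\<close> has held so far. Potentials are multiplied by
  it, so drift is required only in states that satisfy \<open>G\<close>, without introducing a
  stopped process.\<close>

primrec flagged ::
  "(('q, 'o) abstract_state \<Rightarrow> bool) \<Rightarrow> 'o adversary \<Rightarrow> nat \<Rightarrow> (('q, 'o) abstract_state \<times> bool) pmf" where
  "flagged G A 0 = return_pmf (ainit, True)"
| "flagged G A (Suc t) = bind_pmf (flagged G A t) (\<lambda>(s, ok).
     bind_pmf (A (hist s)) (\<lambda>u. map_pmf (\<lambda>s'. (s', ok \<and> G s')) (astep s u)))"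

lemma map_fst_flagged: "map_pmf fst (flagged G A t) = arun A t"
proof (induction t)
  case (Suc t)
  show ?case
    by (simp add: Suc[symmetric] map_bind_pmf pmf.map_comp o_def bind_map_pmf case_prod_beta)
qed simp

lemma always_correct_snoc:
  "always_correct correct h \<Longrightarrow> correct (freq (h @ [(u, x)])) x \<Longrightarrow> always_correct correct (h @ [(u, x)])"
  unfolding always_correct_def
  by (auto simp: nth_append le_Suc_eq)

text \<open>
  The slack \<open>+ 1\<close> in the drift condition allows a potential to be reset to a value at most \<open>1\<close>, for
  instance when a new phase starts.  It costs only a factor polynomial in \<open>m\<close>.
\<close>

lemma adaptive_potential:
  fixes G :: "('q, 'o) abstract_state \<Rightarrow> bool" and \<Phi> :: "'i \<Rightarrow> ('q, 'o) abstract_state \<Rightarrow> real"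
  assumes adv: "valid_adversary k n A"
    and fin: "finite I"
    and G0: "G ainit"
    and \<Phi>0: "\<And>i. i \<in> I \<Longrightarrow> \<Phi> i ainit \<le> 1"
    and nonneg: "\<And>i s. i \<in> I \<Longrightarrow> 0 \<le> \<Phi> i s"
    and drift: "\<And>i s u. \<lbrakk>i \<in> I; G s; valid_history k n (hist s); length (hist s) < m; u \<in> {..<k} \<times> {..<n}\<rbrakk>
      \<Longrightarrow> measure_pmf.expectation (astep s u) (\<Phi> i) \<le> \<Phi> i s + 1"
    and pres: "\<And>s s' u. \<lbrakk>G s; valid_history k n (hist s); length (hist s) < m; u \<in> {..<k} \<times> {..<n};
      s' \<in> set_pmf (astep s u); \<And>i. i \<in> I \<Longrightarrow> \<Phi> i s' < exp L\<rbrakk> \<Longrightarrow> G s'"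
    and corr: "\<And>s. \<lbrakk>G s; valid_history k n (hist s); length (hist s) \<le> m; hist s \<noteq> []\<rbrakk>
      \<Longrightarrow> correct (freq (hist s)) (out (knowledge s))"
  shows "measure (arun A m) {s. always_correct correct (hist s)} \<ge> 1 - real m * (real (card I) * ((real m + 2) * exp (-L)))"
proof -
  let ?F = "flagged G A"
  have inv: "length (hist s) = t \<and> valid_history k n (hist s) \<and> (ok \<longrightarrow> G s \<and> always_correct correct (hist s))"
    if "t \<le> m" "(s, ok) \<in> set_pmf (?F t)" for t s ok
    using that
  proof (induction t arbitrary: s ok)
    case 0
    then show ?case using G0 by (simp add: ainit_def valid_history_def always_correct_def)
  next
    case (Suc t)
    from Suc.prems obtain s0 ok0 u where s0: "(s0, ok0) \<in> set_pmf (?F t)" and u: "u \<in> set_pmf (A (hist s0))"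
      and s: "s \<in> set_pmf (astep s0 u)" and ok: "ok = (ok0 \<and> G s)" by clarsimp
    have ur: "u \<in> {..<k} \<times> {..<n}" using u adv by (auto simp: valid_adversary_def)
    have h: "hist s = hist s0 @ [(u, out (knowledge s))]" by (rule hist_astep[OF s])
    have IH: "length (hist s0) = t" "valid_history k n (hist s0)"
      "ok0 \<Longrightarrow> always_correct correct (hist s0)"
      using Suc.IH[OF _ s0] Suc.prems by auto
    have v: "valid_history k n (hist s)" "length (hist s) = Suc t"
      unfolding h using IH ur by (auto simp: valid_history_snoc)
    have "ok \<Longrightarrow> always_correct correct (hist s)"
      using corr[of s] always_correct_snoc[OF IH(3), of u "out (knowledge s)"] v ok Suc.prems h by auto
    then show ?case using v ok by auto
  qed
  \<comment> \<open>Nonnegative integrals avoid integrability side conditions for the mixture over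
    the choices of the adversary.\<close>
  define pot where "pot i t = (\<integral>\<^sup>+(s, ok). ennreal (\<Phi> i s) * of_bool ok \<partial>?F t)" for i t
  define bad where "bad t = (\<integral>\<^sup>+(s, ok). of_bool (\<not> ok) \<partial>?F t)" for t
  have drift': "(\<integral>\<^sup>+s'. ennreal (\<Phi> i s') \<partial>astep s u) \<le> ennreal (\<Phi> i s) + 1"
    if "t < m" "(s, True) \<in> set_pmf (?F t)" "u \<in> set_pmf (A (hist s))" "i \<in> I" for t s u i
  proof -
    have "(\<integral>\<^sup>+s'. ennreal (\<Phi> i s') \<partial>astep s u) = ennreal (measure_pmf.expectation (astep s u) (\<Phi> i))"
      by (intro nn_integral_eq_integral integrable_measure_pmf_finite finite_astep) (simp add: nonneg that)
    also have "\<dots> \<le> ennreal (\<Phi> i s + 1)"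
      using inv[OF _ that(2)] that adv by (intro ennreal_leI drift) (auto simp: valid_adversary_def)
    also have "\<dots> = ennreal (\<Phi> i s) + 1"
      using nonneg that by simp
    finally show ?thesis .
  qed
  have pot: "pot i t \<le> of_nat t + 1" if "t \<le> m" "i \<in> I" for i t
    using that(1)
  proof (induction t)
    case 0
    then show ?case using \<Phi>0[OF \<open>i \<in> I\<close>] nonneg by (simp add: pot_def)
  next
    case (Suc t)
    have "pot i (Suc t) = (\<integral>\<^sup>+(s, ok). \<integral>\<^sup>+u. \<integral>\<^sup>+s'. ennreal (\<Phi> i s') * of_bool (ok \<and> G s') \<partial>astep s u \<partial>A (hist s) \<partial>?F t)"
      unfolding pot_def by (simp add: nn_integral_bind_pmf split_beta')
    also have "\<dots> \<le> (\<integral>\<^sup>+(s, ok). ennreal (\<Phi> i s) * of_bool ok + 1 \<partial>?F t)"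
    proof (intro nn_integral_mono_AE, unfold AE_measure_pmf_iff, safe)
      fix s ok assume so: "(s, ok) \<in> set_pmf (?F t)"
      have "(\<integral>\<^sup>+u. \<integral>\<^sup>+s'. ennreal (\<Phi> i s') * of_bool (ok \<and> G s') \<partial>astep s u \<partial>A (hist s))
          \<le> (\<integral>\<^sup>+u. ennreal (\<Phi> i s) * of_bool ok + 1 \<partial>A (hist s))"
      proof (intro nn_integral_mono_AE, unfold AE_measure_pmf_iff, safe)
        fix a b assume u: "(a, b) \<in> set_pmf (A (hist s))"
        have "(\<integral>\<^sup>+s'. ennreal (\<Phi> i s') * of_bool (ok \<and> G s') \<partial>astep s (a, b))
            \<le> (\<integral>\<^sup>+s'. ennreal (\<Phi> i s') * of_bool ok \<partial>astep s (a, b))"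
          by (intro nn_integral_mono) (auto simp: nonneg that)
        also have "\<dots> \<le> ennreal (\<Phi> i s) * of_bool ok + 1"
          using drift'[OF _ _ u \<open>i \<in> I\<close>, of t] so Suc.prems by (cases ok) auto
        finally show "(\<integral>\<^sup>+s'. ennreal (\<Phi> i s') * of_bool (ok \<and> G s') \<partial>astep s (a, b))
            \<le> ennreal (\<Phi> i s) * of_bool ok + 1" .
      qed
      then show "(\<integral>\<^sup>+u. \<integral>\<^sup>+s'. ennreal (\<Phi> i s') * of_bool (ok \<and> G s') \<partial>astep s u \<partial>A (hist s))
          \<le> ennreal (\<Phi> i s) * of_bool ok + 1" by simp
    qed
    also have "\<dots> = pot i t + 1"
      unfolding pot_def by (simp add: nn_integral_add split_beta')
    also have "\<dots> \<le> of_nat (Suc t) + 1"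
      using Suc by (simp add: add.commute add_mono)
    finally show ?case .
  qed
  have bad: "bad t \<le> ennreal (real t * (real (card I) * ((real m + 2) * exp (-L))))" if "t \<le> m" for t
    using that
  proof (induction t)
    case 0
    then show ?case by (simp add: bad_def)
  next
    case (Suc t)
    have "bad (Suc t) = (\<integral>\<^sup>+(s, ok). \<integral>\<^sup>+u. \<integral>\<^sup>+s'. of_bool (\<not> (ok \<and> G s')) \<partial>astep s u \<partial>A (hist s) \<partial>?F t)"
      unfolding bad_def by (simp add: nn_integral_bind_pmf split_beta')
    \<comment> \<open>Markov's inequality and a union bound: the flag can drop only if some
      potential reaches \<open>exp L\<close>, and the conditional expectation of each potential is
      at most its present value plus 1.\<close>
    also have "\<dots> \<le> (\<integral>\<^sup>+(s, ok). of_bool (\<not> ok) +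
        (\<Sum>i\<in>I. ennreal (exp (-L)) * (ennreal (\<Phi> i s) * of_bool ok + 1)) \<partial>?F t)"
    proof (intro nn_integral_mono_AE, unfold AE_measure_pmf_iff, safe)
      fix s ok assume so: "(s, ok) \<in> set_pmf (?F t)"
      let ?R = "of_bool (\<not> ok) + (\<Sum>i\<in>I. ennreal (exp (-L)) * (ennreal (\<Phi> i s) * of_bool ok + 1))"
      have "(\<integral>\<^sup>+u. \<integral>\<^sup>+s'. of_bool (\<not> (ok \<and> G s')) \<partial>astep s u \<partial>A (hist s)) \<le> (\<integral>\<^sup>+u. ?R \<partial>A (hist s))"
      proof (intro nn_integral_mono_AE, unfold AE_measure_pmf_iff, rule ballI)
        fix u assume u: "u \<in> set_pmf (A (hist s))"
        show "(\<integral>\<^sup>+s'. of_bool (\<not> (ok \<and> G s')) \<partial>astep s u) \<le> ?R"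
        proof (cases ok)
          case False
          then show ?thesis by simp
        next
          case True
          have "(\<integral>\<^sup>+s'. of_bool (\<not> (ok \<and> G s')) \<partial>astep s u)
              \<le> (\<integral>\<^sup>+s'. (\<Sum>i\<in>I. ennreal (exp (-L)) * ennreal (\<Phi> i s')) \<partial>astep s u)"
          proof (intro nn_integral_mono_AE, unfold AE_measure_pmf_iff, rule ballI)
            fix s' assume s': "s' \<in> set_pmf (astep s u)"
            show "of_bool (\<not> (ok \<and> G s')) \<le> (\<Sum>i\<in>I. ennreal (exp (-L)) * ennreal (\<Phi> i s'))"
            proof (cases "G s'")
              case False
              then obtain i where i: "i \<in> I" "exp L \<le> \<Phi> i s'"
                using pres[of s u s'] inv[OF _ so] so True u s' adv Suc.prems
                by (fastforce simp: valid_adversary_def not_less)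
              have "1 \<le> exp (-L) * \<Phi> i s'" using i(2) by (simp add: exp_minus field_simps)
              then have "1 \<le> ennreal (exp (-L)) * ennreal (\<Phi> i s')"
                using nonneg[OF i(1)] by (simp flip: ennreal_mult)
              also have "\<dots> \<le> (\<Sum>i\<in>I. ennreal (exp (-L)) * ennreal (\<Phi> i s'))"
                using fin i(1) by (intro member_le_sum) auto
              finally show ?thesis by (auto simp: of_bool_def)
            qed (use True in simp)
          qed
          also have "\<dots> = (\<Sum>i\<in>I. ennreal (exp (-L)) * (\<integral>\<^sup>+s'. ennreal (\<Phi> i s') \<partial>astep s u))"
            by (simp add: nn_integral_sum nn_integral_cmult)
          also have "\<dots> \<le> (\<Sum>i\<in>I. ennreal (exp (-L)) * (ennreal (\<Phi> i s) + 1))"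
            using drift'[of t s u] so True u Suc.prems by (intro sum_mono mult_left_mono) auto
          finally show ?thesis using True by simp
        qed
      qed
      then show "(\<integral>\<^sup>+u. \<integral>\<^sup>+s'. of_bool (\<not> (ok \<and> G s')) \<partial>astep s u \<partial>A (hist s)) \<le> ?R" by simp
    qed
    also have "\<dots> = bad t + (\<Sum>i\<in>I. ennreal (exp (-L)) * (pot i t + 1))"
      unfolding pot_def bad_def
      by (simp add: split_beta' nn_integral_add nn_integral_sum nn_integral_cmult)
    also have "\<dots> \<le> ennreal (real t * (real (card I) * ((real m + 2) * exp (-L))))
        + (\<Sum>i\<in>I. ennreal (exp (-L)) * ennreal (real m + 2))"
    proof (intro add_mono sum_mono mult_left_mono)
      fix i assume "i \<in> I"
      have "pot i t + 1 \<le> of_nat t + 1 + 1"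
        using pot[of t i] \<open>i \<in> I\<close> Suc.prems by (intro add_mono) auto
      also have "\<dots> = ennreal (real t + 2)" by (simp add: ennreal_of_nat_eq_real_of_nat add.assoc)
      also have "\<dots> \<le> ennreal (real m + 2)" using Suc.prems by (intro ennreal_leI) auto
      finally show "pot i t + 1 \<le> ennreal (real m + 2)" .
    qed (use Suc in auto)
    also have "\<dots> = ennreal (real (Suc t) * (real (card I) * ((real m + 2) * exp (-L))))"
      by (simp add: ennreal_mult'' ennreal_plus[symmetric] ennreal_of_nat_eq_real_of_nat
          algebra_simps del: ennreal_plus flip: ennreal_mult')
    finally show ?case .
  qed
  have "emeasure (?F m) {x. \<not> snd x} = (\<integral>\<^sup>+x. indicator {x. \<not> snd x} x \<partial>?F m)"
    by simp
  also have "\<dots> = bad m"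
    unfolding bad_def by (intro nn_integral_cong) (auto simp: indicator_def)
  finally have "emeasure (?F m) {x. \<not> snd x} = bad m" .
  then have "ennreal (measure (?F m) {x. \<not> snd x}) \<le> ennreal (real m * (real (card I) * ((real m + 2) * exp (-L))))"
    using bad[of m] by (simp add: measure_pmf.emeasure_eq_measure)
  then have "measure (?F m) {x. \<not> snd x} \<le> real m * (real (card I) * ((real m + 2) * exp (-L)))"
    by (subst (asm) ennreal_le_iff) auto
  moreover have "measure (?F m) {x. snd x} = 1 - measure (?F m) {x. \<not> snd x}"
    using measure_pmf.prob_compl[of "{x. \<not> snd x}" "?F m"] by (simp add: Collect_neg_eq[symmetric] Compl_eq_Diff_UNIV[symmetric])
  moreover have "measure (?F m) {x. snd x} \<le> measure (?F m) {x. always_correct correct (hist (fst x))}"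
    using inv[of m] by (intro measure_pmf.finite_measure_mono_AE) (auto simp: AE_measure_pmf_iff)
  moreover have "measure (arun A m) {s. always_correct correct (hist s)}
      = measure (?F m) {x. always_correct correct (hist (fst x))}"
    unfolding map_fst_flagged[of G A m, symmetric] by (simp add: vimage_def)
  ultimately show ?thesis by linarith
qed

text \<open>The interface for all three protocols: each has to supply an invariant \<open>G\<close>,
  a finite family of potentials, their drift in one step, and arithmetic for \<open>\<delta>\<close>
  and \<open>B\<close>.\<close>

theorem robustly_monitors_prot:
  fixes G :: "('q, 'o) abstract_state \<Rightarrow> bool" and \<Phi> :: "'i \<Rightarrow> ('q, 'o) abstract_state \<Rightarrow> real"
  assumes fin: "finite I"
    and G0: "G ainit"
    and \<Phi>0: "\<And>i. i \<in> I \<Longrightarrow> \<Phi> i ainit \<le> 1"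
    and nonneg: "\<And>i s. i \<in> I \<Longrightarrow> 0 \<le> \<Phi> i s"
    and drift: "\<And>i s u. \<lbrakk>i \<in> I; G s; valid_history k n (hist s); length (hist s) < m; u \<in> {..<k} \<times> {..<n}\<rbrakk>
      \<Longrightarrow> measure_pmf.expectation (astep s u) (\<Phi> i) \<le> \<Phi> i s + 1"
    and pres: "\<And>s s' u. \<lbrakk>G s; valid_history k n (hist s); length (hist s) < m; u \<in> {..<k} \<times> {..<n};
      s' \<in> set_pmf (astep s u); \<And>i. i \<in> I \<Longrightarrow> \<Phi> i s' < exp L\<rbrakk> \<Longrightarrow> G s'"
    and corr: "\<And>s. \<lbrakk>G s; valid_history k n (hist s); length (hist s) \<le> m; hist s \<noteq> []\<rbrakk>
      \<Longrightarrow> correct (freq (hist s)) (out (knowledge s))"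
    and \<delta>: "real m * (real (card I) * ((real m + 2) * exp (-L))) \<le> \<delta>"
    and B: "real ((LEN + 1) * (2 * (BUD + 1 + PL + k) + k)) \<le> B"
  shows "robustly_monitors prot k n m correct \<delta> B"
  unfolding robustly_monitors_def
proof (intro allI impI conjI)
  fix A :: "'o adversary" assume adv: "valid_adversary k n A"
  note run = run_eq_arun[OF adv, of m]
  show "lossless_spmf (run prot k A m)" unfolding run by simp
  show "\<forall>(C, h)\<in>set_spmf (run prot k A m). real (cost C) \<le> B"
  proof clarify
    fix C h assume "(C, h) \<in> set_spmf (run prot k A m)"
    then obtain s where s: "s \<in> set_pmf (arun A m)" "C = concrete s" unfolding run by auto
    have i: "bits_sent s \<le> (LEN + 1) * (2 * events s + (if BUD \<le> events s then k else 0))"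
      "events s \<le> BUD + 1 + PL + k"
      using bits_invariant[OF adv order.refl s(1)] by auto
    have "bits_sent s \<le> (LEN + 1) * (2 * (BUD + 1 + PL + k) + k)"
      using i(1) by (rule order.trans) (intro mult_le_mono2 add_mono; use i(2) in simp)
    then have "real (bits_sent s) \<le> real ((LEN + 1) * (2 * (BUD + 1 + PL + k) + k))" by (simp only: of_nat_le_iff)
    then show "real (cost C) \<le> B" using B s(2) by (simp add: concrete_def)
  qed
  have "1 - \<delta> \<le> measure (arun A m) {s. always_correct correct (hist s)}"
    using adaptive_potential[where G = G and \<Phi> = \<Phi> and I = I and L = L and correct = correct,
        OF adv fin G0 \<Phi>0 nonneg drift pres corr] \<delta> by fastforce
  then show "1 - \<delta> \<le> measure (measure_spmf (run prot k A m)) {(C, h). always_correct correct h}"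
    unfolding run by (simp add: vimage_def case_prod_beta)
qed

end

section \<open>Concentration and counting\<close>

text \<open>For a negative argument put \<open>y = - z\<close> and multiply by \<open>exp z\<close>:
  replacing \<open>exp z\<close> by its quadratic Taylor polynomial already makes the product with
  \<open>1 - z + z\<^sup>2\<close> at least 1.\<close>

lemma exp_le_quadratic:
  fixes y :: real
  assumes "\<bar>y\<bar> \<le> 1"
  shows "exp y \<le> 1 + y + y\<^sup>2"
proof (cases "y \<ge> 0")
  case True
  then show ?thesis using exp_bound[of y] assms by auto
next
  case False
  define z where "z = - y"
  have z: "0 < z" using False by (simp add: z_def)
  have "1 \<le> (1 - z + z\<^sup>2) * (1 + z + z\<^sup>2 / 2)"
  proof -
    have "(1 - z + z\<^sup>2) * (1 + z + z\<^sup>2 / 2) = 1 + z\<^sup>2 / 2 + z ^ 3 / 2 + z ^ 4 / 2"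
      by (simp add: field_simps power2_eq_square power3_eq_cube power4_eq_xxxx)
    then show ?thesis using z by simp
  qed
  also have "\<dots> \<le> (1 - z + z\<^sup>2) * exp z"
  proof (rule mult_left_mono)
    show "1 + z + z\<^sup>2 / 2 \<le> exp z"
      using exp_lower_Taylor_quadratic[of z] z by simp
    have "0 \<le> (1 - z / 2)\<^sup>2 + 3 * z\<^sup>2 / 4" by simp
    then show "0 \<le> 1 - z + z\<^sup>2" by (simp add: power2_eq_square algebra_simps)
  qed
  finally show ?thesis by (simp add: z_def exp_minus field_simps)
qed

lemma exp_le_linear:
  fixes y :: real
  assumes "0 \<le> y" "y \<le> 1"
  shows "exp y \<le> 1 + 2 * y"
proof -
  have "y\<^sup>2 \<le> y" using assms by (simp add: power2_eq_square mult_left_le)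
  then show ?thesis using exp_bound[OF assms] by linarith
qed

text \<open>An update that counts \<open>1 / p\<close> when sampled has error of mean 0 and variance
  \<open>1 / p - 1\<close>. The condition on \<open>t\<close> keeps both exponents in the range of
  the quadratic bound; this is why the tilting parameters below must not exceed the sampling
  probability.\<close>

lemma bernoulli_mgf:
  fixes p t :: real
  assumes "0 < p" "p \<le> 1" "\<bar>t\<bar> \<le> p"
  shows "p * exp (t * (1 / p - 1)) + (1 - p) * exp (- t) \<le> exp (t\<^sup>2 * (1 / p - 1))"
proof -
  have a: "\<bar>t * (1 / p - 1)\<bar> \<le> 1"
  proof -
    have "\<bar>t * (1 / p - 1)\<bar> = \<bar>t\<bar> * (1 / p - 1)" using assms by (simp add: abs_mult)
    also have "\<dots> \<le> p * (1 / p - 1)" using assms by (intro mult_right_mono) auto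
    also have "\<dots> \<le> 1" using assms by (simp add: field_simps)
    finally show ?thesis .
  qed
  have "p * exp (t * (1 / p - 1)) + (1 - p) * exp (- t)
      \<le> p * (1 + t * (1 / p - 1) + (t * (1 / p - 1))\<^sup>2) + (1 - p) * (1 + (- t) + (- t)\<^sup>2)"
    using assms a exp_le_quadratic[OF a] exp_le_quadratic[of "- t"]
    by (intro add_mono mult_left_mono) auto
  also have "\<dots> = 1 + t\<^sup>2 * (1 / p - 1)"
    using assms by (simp add: field_simps power2_eq_square)
  also have "\<dots> \<le> exp (t\<^sup>2 * (1 / p - 1))" by (rule exp_ge_add_one_self)
  finally show ?thesis .
qed

lemma ask_never: "ask (\<lambda>_. False) f as ls = as @ map f ls"
  by (induction ls arbitrary: as) auto

lemma expectation_mono_finite: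
  fixes f g :: "'a \<Rightarrow> real"
  assumes "finite (set_pmf p)" "\<And>x. x \<in> set_pmf p \<Longrightarrow> f x \<le> g x"
  shows "measure_pmf.expectation p f \<le> measure_pmf.expectation p g"
  using assms by (intro integral_mono_AE integrable_measure_pmf_finite) (auto simp: AE_measure_pmf_iff)

lemma finite_replicate_pmf: "finite (set_pmf p) \<Longrightarrow> finite (set_pmf (replicate_pmf T p))"
  using finite_lists_length_eq[of "set_pmf p" T]
  by (simp add: set_replicate_pmf lists_eq_set Collect_conj_eq Int_commute)

lemma expectation_replicate_Suc:
  fixes f :: "'a list \<Rightarrow> real"
  assumes "finite (set_pmf p)"
  shows "measure_pmf.expectation (replicate_pmf (Suc T) p) f =
    measure_pmf.expectation p (\<lambda>x. measure_pmf.expectation (replicate_pmf T p) (\<lambda>xs. f (x # xs)))"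
proof -
  have "replicate_pmf (Suc T) p = bind_pmf p (\<lambda>x. map_pmf ((#) x) (replicate_pmf T p))"
    by (simp add: map_pmf_def)
  moreover have "finite (set_pmf (replicate_pmf T p))"
    using assms by (rule finite_replicate_pmf)
  ultimately show ?thesis
    using assms by (simp add: pmf_expectation_bind[where A = "set_pmf p"] integral_measure_pmf[where A = "set_pmf p"])
qed

context query_protocol
begin

lemma expectation_astep:
  fixes f :: "('q, 'o) abstract_state \<Rightarrow> real"
  assumes "0 \<le> report_prob s u" "report_prob s u \<le> 1"
  shows "measure_pmf.expectation (astep s u) f =
    report_prob s u * measure_pmf.expectation
      (draw (knowledge s) (fst u) (rep (arrival (hist s) u (fst u)))) (\<lambda>x. f (reported s u x))
    + (1 - report_prob s u) * f (silent s u)"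
proof -
  let ?A = "\<lambda>b. if b then map_pmf (reported s u)
         (draw (knowledge s) (fst u) (rep (arrival (hist s) u (fst u))))
       else return_pmf (silent s u)"
  have fin: "finite (set_pmf (?A b))" for b by (simp add: draw_finite)
  have "measure_pmf.expectation (astep s u) f =
      measure_pmf.expectation (bernoulli_pmf (report_prob s u)) (\<lambda>b. measure_pmf.expectation (?A b) f)"
    unfolding astep_def using fin by (intro pmf_expectation_bind[where A = UNIV, THEN trans]) 
      (auto simp: integral_measure_pmf[of UNIV])
  then show ?thesis using assms by simp
qed

text \<open>The side condition of the silent case excludes silence when the report probability is 1.
  This keeps counts exact as long as everything is reported.\<close>

lemma astep_cases [consumes 3, case_names silent reported]:
  assumes "s' \<in> set_pmf (astep s u)" "0 \<le> report_prob s u" "report_prob s u \<le> 1"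
  obtains "s' = silent s u" "report_prob s u \<noteq> 1"
  | x where "s' = reported s u x" "report_prob s u > 0"
      "x \<in> set_pmf (draw (knowledge s) (fst u) (rep (arrival (hist s) u (fst u))))"
proof -
  from assms(1) obtain b where b: "b \<in> set_pmf (bernoulli_pmf (report_prob s u))"
    and s': "s' \<in> set_pmf (if b then map_pmf (reported s u)
         (draw (knowledge s) (fst u) (rep (arrival (hist s) u (fst u))))
       else return_pmf (silent s u))"
    by (auto simp: astep_def)
  have "if b then report_prob s u > 0 else report_prob s u \<noteq> 1"
    using b assms(2,3) by (cases b) (auto simp: set_pmf_iff[of _ "bernoulli_pmf _"])
  then show ?thesis using s' that by (cases b) auto
qed

end

section \<open>Frequencies as sums over the servers\<close>

lemma count_list_arrival:
  "count_list (arrival h u l) i = count_list (items l h) i + of_bool (u = (l, i))"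
  by (cases u) (auto simp: arrival_def)

lemma freq_snoc: "freq (h @ [(u, x)]) i = freq h i + of_bool (snd u = i)"
  by (cases u) (auto simp: freq_def)

lemma freq_eq_sum:
  "valid_history k n h \<Longrightarrow> freq h i = (\<Sum>j<k. count_list (items j h) i)"
proof (induction h rule: rev_induct)
  case Nil
  then show ?case by (simp add: freq_def)
next
  case (snoc e h)
  obtain j i' x where e: "e = ((j, i'), x)" by (metis surj_pair)
  have v: "valid_history k n h" "j < k" using snoc.prems by (auto simp: e valid_history_def)
  have "(\<Sum>l<k. of_bool (j = l \<and> i' = i)) = (of_bool (i' = i) :: nat)"
    using v(2) by (cases "i' = i") (simp_all add: of_bool_def)
  then show ?case using snoc.IH[OF v(1)]
    by (simp add: e freq_snoc arrival_snoc count_list_arrival sum.distrib)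
qed

lemma length_eq_sum:
  "valid_history k n h \<Longrightarrow> length h = (\<Sum>j<k. length (items j h))"
proof (induction h rule: rev_induct)
  case Nil
  then show ?case by simp
next
  case (snoc e h)
  obtain j i' x where e: "e = ((j, i'), x)" by (metis surj_pair)
  have v: "valid_history k n h" "j < k" using snoc.prems by (auto simp: e valid_history_def)
  have *: "length (arrival h (j, i') l) = length (items l h) + of_bool (j = l)" for l
    by (auto simp: arrival_def)
  have "(\<Sum>l<k. of_bool (j = l)) = (1 :: nat)"
    using v(2) by (simp add: of_bool_def)
  then show ?case using snoc.IH[OF v(1)]
    by (simp add: e arrival_snoc * sum.distrib)
qed

lemma F1_freq: "valid_history k n h \<Longrightarrow> F1 n (freq h) = length h"
proof (induction h rule: rev_induct)
  case Nil
  then show ?case by (simp add: F1_def freq_def)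
next
  case (snoc e h)
  obtain j i' x where e: "e = ((j, i'), x)" by (metis surj_pair)
  have v: "valid_history k n h" "i' < n" using snoc.prems by (auto simp: e valid_history_def)
  have "(\<Sum>l<n. of_bool (i' = l)) = (1 :: nat)"
    using v(2) by (simp add: of_bool_def)
  then show ?case using snoc.IH[OF v(1)]
    by (simp add: e F1_def freq_snoc sum.distrib)
qed

section \<open>Counting updates\<close>

locale f1_tracking =
  fixes k n m LEN :: nat and \<epsilon> L \<Lambda> :: real
  assumes k: "k \<ge> 1" and eps: "0 < \<epsilon>" "\<epsilon> < 1" and L: "L \<ge> 1" and m: "real m \<le> exp \<Lambda>"
    and \<Lambda>: "\<Lambda> \<ge> 0" and LEN: "Suc m < 2 ^ LEN"
begin

text \<open>Up to a constant, the relative growth between two synchronizations. About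
  \<open>\<Lambda> / \<beta>\<close> of them occur, each with \<open>2 * k\<close> events for
  questions and broadcast and about \<open>L * \<beta>\<^sup>2 / \<epsilon>\<^sup>2\<close> samples;
  the value \<open>sqrt k * \<epsilon>\<close> balances the two up to \<open>L\<close>.\<close>

definition \<beta> :: real where "\<beta> = min 1 (sqrt k * \<epsilon>)"
text \<open>While \<open>F \<le> P\<close>, every update is reported. Up to rounding,
  \<open>S\<close> equals \<open>P * \<beta> / 4\<close>, so \<open>S\<close> samples taken at rate
  \<open>P / F\<close> stand for a growth of about \<open>\<beta> * F / 4\<close>.\<close>

definition P :: real where "P = 64 * L * \<beta> / \<epsilon>\<^sup>2"
definition S :: nat where "S = nat \<lceil>16 * L * \<beta>\<^sup>2 / \<epsilon>\<^sup>2\<rceil>"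
definition pr :: "nat \<Rightarrow> real" where "pr F = (if real F \<le> P then 1 else P / real F)"
definition budget :: nat where "budget = nat \<lceil>2 + 32 * \<Lambda> / \<beta>\<rceil> * (S + 2 * k) + 1"

text \<open>
  State \<open>(F, c, R)\<close>: the number of updates at the last synchronization, the number of samples since
  then, and the number of synchronizations.
\<close>

fun sync_plan :: "nat \<times> nat \<times> nat \<Rightarrow> nat \<Rightarrow> nat \<Rightarrow> unit \<Rightarrow> nat list" where
  "sync_plan (F, c, R) j v x = (if S \<le> c + 1 then [0..<k] else [])"

fun sync_upd :: "nat \<times> nat \<times> nat \<Rightarrow> nat \<Rightarrow> nat \<Rightarrow> nat \<Rightarrow> unit \<Rightarrow> nat list \<Rightarrow> nat \<times> nat \<times> nat" where
  "sync_upd (F, c, R) e j v x as =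
     (if S \<le> c + 1 then (min m (sum_list as), 0, R + 1) else (F, c + 1, R))"

fun sync_out :: "nat \<times> nat \<times> nat \<Rightarrow> real" where
  "sync_out (F, c, R) = F + c / pr F"

lemma beta: "0 < \<beta>" "\<beta> \<le> 1" "\<epsilon> \<le> \<beta>"
  using k eps by (auto simp: \<beta>_def)

lemma P_pos: "0 < P"
  using beta L eps by (simp add: P_def)

lemma pr: "0 < pr F" "pr F \<le> 1"
  using P_pos by (auto simp: pr_def)

sublocale query_protocol k n m LEN budget k "\<lambda>F xs. pr F" "\<lambda>xs. 0" "\<lambda>z xs. length xs" "\<lambda>v. 0"
  "\<lambda>q j v. return_pmf ()" sync_plan "\<lambda>q j v x as. False" sync_upd "\<lambda>q. min m (fst q)" "(0, 0, 0)" sync_out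
proof unfold_locales
  fix q j v x
  show "set (sync_plan q j v x) \<subseteq> {..<k}" "length (sync_plan q j v x) \<le> k"
    by (cases q; auto)+
  show "Suc (min m (fst q)) < 2 ^ LEN" using LEN by (cases q) (auto simp: min_def)
qed (use LEN in auto)

text \<open>The first error term comes from the tail bound \<open>L\<close>, the second from the
  accumulated variance, after division by \<open>lam F\<close>.\<close>

definition close :: "nat \<Rightarrow> nat \<Rightarrow> nat \<Rightarrow> bool" where
  "close F c N \<longleftrightarrow>
     (if real F \<le> P then real c = real N - real F
      else \<bar>c / pr F - (real N - F)\<bar> \<le> \<epsilon> * F / 8 + \<epsilon> / (8 * \<beta>) * (real N - F))"

lemma S_bounds: "16 * L * \<beta>\<^sup>2 / \<epsilon>\<^sup>2 \<le> S" "real S - 1 < 16 * L * \<beta>\<^sup>2 / \<epsilon>\<^sup>2" "1 \<le> S"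
proof -
  have "0 < 16 * L * \<beta>\<^sup>2 / \<epsilon>\<^sup>2" using L beta eps by simp
  then show "16 * L * \<beta>\<^sup>2 / \<epsilon>\<^sup>2 \<le> S" "real S - 1 < 16 * L * \<beta>\<^sup>2 / \<epsilon>\<^sup>2" "1 \<le> S"
    unfolding S_def by linarith+
qed

lemma S_P: "16 * L * \<beta>\<^sup>2 / \<epsilon>\<^sup>2 = P * \<beta> / 4"
  by (simp add: P_def power2_eq_square)

lemma eps_ratio: "0 \<le> D \<Longrightarrow> \<epsilon> / (8 * \<beta>) * D \<le> D / 8"
  using beta eps mult_right_mono[of "\<epsilon> / (8 * \<beta>)" "1 / 8" D] by (simp add: field_simps)

text \<open>Fewer than \<open>S\<close> samples limit the growth since the last synchronization to
  \<open>\<beta> * F / 2\<close>, which makes the variance term of \<open>close\<close> at most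
  \<open>\<epsilon> * F / 16\<close>.\<close>

lemma close_imp_approx:
  assumes "close F c N" "F \<le> N" "c < S"
  shows "\<bar>sync_out (F, c, R) - real N\<bar> \<le> \<epsilon> * real N"
proof (cases "real F \<le> P")
  case True
  then show ?thesis using assms eps by (simp add: close_def pr_def)
next
  case False
  define D where "D = real N - F"
  have D: "D \<ge> 0" using assms by (simp add: D_def)
  have F: "real F > 0" using False P_pos by linarith
  have "real c \<le> real S - 1" using assms by linarith
  then have "real c < P * \<beta> / 4" using S_bounds(2) unfolding S_P by linarith
  then have "c / pr F < (P * \<beta> / 4) / pr F" using pr by (intro divide_strict_right_mono)
  also have "\<dots> = \<beta> * F / 4" using False P_pos F by (simp add: pr_def)
  finally have c: "c / pr F < \<beta> * F / 4" .
  have cl: "\<bar>c / pr F - D\<bar> \<le> \<epsilon> * F / 8 + \<epsilon> / (8 * \<beta>) * D"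
    using assms False by (simp add: close_def D_def)
  have eF: "\<epsilon> * F \<le> \<beta> * F" using beta F by simp
  have "D \<le> \<beta> * F / 2"
    using abs_le_D2[OF cl] c eps_ratio[OF D] eF mult_pos_pos[OF beta(1) F] by linarith
  then have "\<epsilon> / (8 * \<beta>) * D \<le> \<epsilon> / (8 * \<beta>) * (\<beta> * F / 2)"
    using eps beta by (intro mult_left_mono) auto
  also have "\<dots> = \<epsilon> * F / 16" using beta by simp
  finally have "\<bar>c / pr F - D\<bar> \<le> \<epsilon> * F" using mult_pos_pos[OF eps(1) F] cl by linarith
  also have "\<dots> \<le> \<epsilon> * N" using assms eps by simp
  finally show ?thesis by (simp add: D_def)
qed

text \<open>The \<open>S\<close>-th sample triggers a synchronization, so \<open>S - 1\<close>
  samples are present just before it. By \<open>close\<close> they force a growth of at least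
  \<open>\<beta> * F / 16\<close>, including the current update. This limits the number of
  synchronizations.\<close>

lemma sync_growth:
  assumes "close F (S - 1) N" "F \<le> N"
  shows "F * exp (\<beta> / 32) \<le> real (N + 1)"
proof -
  define D where "D = real N - F"
  have D: "D \<ge> 0" using assms by (simp add: D_def)
  have "F * \<beta> / 16 \<le> D + 1"
  proof (cases "real F \<le> P")
    case True
    then have "D + 1 = S" using assms S_bounds by (simp add: close_def D_def of_nat_diff)
    moreover have "F * \<beta> / 16 \<le> P * \<beta> / 4" using True beta P_pos
      using mult_right_mono[of F P \<beta>] mult_nonneg_nonneg[of P \<beta>] by linarith
    ultimately show ?thesis using S_bounds unfolding S_P by linarith
  next
    case False
    have F: "real F > 0" using False P_pos by linarith
    have "P * \<beta> / 4 - 1 \<le> real (S - 1)" using S_bounds unfolding S_P by (simp add: of_nat_diff)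
    then have "(P * \<beta> / 4 - 1) / pr F \<le> (S - 1) / pr F" using pr[of F] by (intro divide_right_mono) auto
    moreover have "(P * \<beta> / 4 - 1) / pr F = \<beta> * F / 4 - F / P"
      using False P_pos F by (simp add: pr_def field_simps)
    \<comment> \<open>The sample missing in \<open>S - 1\<close> would have had weight
      \<open>F / P\<close>.\<close>
    moreover have "F / P \<le> \<beta> * F / 64"
    proof -
      have "\<epsilon>\<^sup>2 \<le> 1 * \<beta>\<^sup>2" using beta eps by (simp add: power_mono)
      also have "\<dots> \<le> L * \<beta>\<^sup>2" using L by (intro mult_right_mono) auto
      finally have "\<epsilon>\<^sup>2 \<le> L * \<beta>\<^sup>2" .
      then have "1 / P \<le> \<beta> / 64"
        using beta L eps by (simp add: P_def field_simps power2_eq_square)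
      then have "1 / P * F \<le> \<beta> / 64 * F" using F by (intro mult_right_mono) auto
      then show ?thesis by simp
    qed
    moreover have "\<bar>(S - 1) / pr F - D\<bar> \<le> \<epsilon> * F / 8 + \<epsilon> / (8 * \<beta>) * D"
      using assms False by (simp add: close_def D_def)
    moreover have "\<epsilon> * F \<le> \<beta> * F" using beta F by simp
    moreover have "0 < \<beta> * F" using beta F by simp
    ultimately have "\<beta> * F / 16 \<le> D"
      using eps_ratio[OF D] unfolding abs_le_iff by linarith
    then show ?thesis by (simp add: mult.commute)
  qed
  moreover have "exp (\<beta> / 32) \<le> 1 + \<beta> / 16"
    using exp_le_linear[of "\<beta> / 32"] beta by simp
  then have "F * exp (\<beta> / 32) \<le> F * (1 + \<beta> / 16)" by (intro mult_left_mono) auto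
  ultimately show ?thesis by (simp add: D_def algebra_simps)
qed

text \<open>The exponent has \<open>R - 1\<close> because the first synchronization only shows that
  \<open>F\<close> is at least 1.\<close>

definition good :: "(nat \<times> nat \<times> nat, real) abstract_state \<Rightarrow> bool" where
  "good s \<longleftrightarrow> (case knowledge s of (F, c, R) \<Rightarrow>
     F \<le> length (hist s) \<and> c < S \<and> (R > 0 \<longrightarrow> exp ((real R - 1) * \<beta> / 32) \<le> F) \<and>
     events s \<le> R * (S + 2 * k) + c \<and> close F c (length (hist s)))"

lemma good_alive:
  assumes "good s" "length (hist s) \<le> m"
  shows "events s < budget"
proof -
  obtain F c R where q: "knowledge s = (F, c, R)" by (metis surj_pair)
  have g: "F \<le> length (hist s)" "c < S" "R > 0 \<Longrightarrow> exp ((real R - 1) * \<beta> / 32) \<le> F"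
    "events s \<le> R * (S + 2 * k) + c" using assms(1) by (auto simp: good_def q)
  have "real R \<le> 1 + 32 * \<Lambda> / \<beta>"
  proof (cases "R > 0")
    case True
    have "exp ((real R - 1) * \<beta> / 32) \<le> exp \<Lambda>" using g(1) g(3)[OF True] assms(2) m by linarith
    then have "(real R - 1) * \<beta> / 32 \<le> \<Lambda>" by simp
    then show ?thesis using beta by (simp add: field_simps)
  qed (use beta \<Lambda> in simp)
  then have "R + 1 \<le> nat \<lceil>2 + 32 * \<Lambda> / \<beta>\<rceil>" by linarith
  from mult_le_mono1[OF this, of "S + 2 * k"] show ?thesis
    using g(2,4) by (simp add: budget_def algebra_simps)
qed

section \<open>Sampling error between synchronizations\<close>

definition lam :: "nat \<Rightarrow> real" where "lam F = 8 * L / (\<epsilon> * F)"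

text \<open>Exponential supermartingale for the error in direction \<open>b\<close>, with a
  compensator for the variance. The choice of \<open>lam\<close> makes \<open>L / lam F\<close>
  equal to \<open>\<epsilon> * F / 8\<close>. A synchronization resets the value to 1, which the
  slack in the drift condition permits.\<close>

definition pot :: "real \<Rightarrow> (nat \<times> nat \<times> nat, real) abstract_state \<Rightarrow> real" where
  "pot b s = (case knowledge s of (F, c, R) \<Rightarrow>
     if real F \<le> P then 1
     else exp (b * lam F * (c / pr F - (real (length (hist s)) - F))
       - (lam F)\<^sup>2 * (real (length (hist s)) - F) / pr F))"

lemma lam_le: "\<not> real F \<le> P \<Longrightarrow> 0 < lam F \<and> lam F \<le> pr F"
proof -
  assume F: "\<not> real F \<le> P"
  then have F0: "real F > 0" using P_pos by linarith
  have "8 * L / \<epsilon> \<le> P"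
    using beta L eps by (simp add: P_def field_simps power2_eq_square)
  then have "8 * L / \<epsilon> / F \<le> P / F" using F0 by (intro divide_right_mono) auto
  then show ?thesis using F F0 L eps by (simp add: lam_def pr_def)
qed

lemma pot_close:
  assumes q: "knowledge s = (F, c, R)" and F: "\<not> real F \<le> P" and N: "F \<le> length (hist s)"
    and small: "pot 1 s < exp L" "pot (-1) s < exp L"
  shows "close F c (length (hist s))"
proof -
  define D where "D = real (length (hist s)) - F"
  define E where "E = c / pr F - D"
  have F0: "real F > 0" using F P_pos by linarith
  have l: "0 < lam F" using lam_le[OF F] by simp
  have "lam F * \<bar>E\<bar> \<le> L + (lam F)\<^sup>2 * D / pr F"
    using small F l by (auto simp: pot_def q D_def[symmetric] E_def[symmetric] abs_if)
  then have "lam F * \<bar>E\<bar> / lam F \<le> (L + (lam F)\<^sup>2 * D / pr F) / lam F"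
    using l by (intro divide_right_mono) auto
  then have "\<bar>E\<bar> \<le> L / lam F + lam F * D / pr F"
    using l by (simp add: add_divide_distrib power2_eq_square)
  also have "L / lam F = \<epsilon> * F / 8" using L eps F0 by (simp add: lam_def)
  also have "lam F * D / pr F = \<epsilon> / (8 * \<beta>) * D"
    using L eps F0 F beta by (simp add: lam_def pr_def P_def field_simps power2_eq_square)
  finally show ?thesis using F by (simp add: close_def D_def E_def)
qed

lemma report_prob_good:
  assumes "good s" "length (hist s) \<le> m"
  shows "report_prob s u = pr (fst (knowledge s))"
proof -
  have "fst (knowledge s) \<le> m" using assms by (auto simp: good_def split: prod.splits)
  then show ?thesis using good_alive[OF assms] by (simp add: report_prob_def min_absorb2)
qed

lemma knowledge_reported:
  assumes "knowledge s = (F, c, R)" "valid_history k n (hist s)" "length (hist s) < m" "u \<in> {..<k} \<times> {..<n}"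
  shows "knowledge (reported s u x) =
      (if S \<le> c + 1 then (length (hist s) + 1, 0, R + 1) else (F, c + 1, R))"
    and "events (reported s u x) \<le> events s + 1 + (if S \<le> c + 1 then 2 * k else 0)"
proof -
  \<comment> \<open>The output 0 is a dummy that turns the lists after the arrival into the lists of
    a history.\<close>
  let ?h = "hist s @ [(u, 0 :: real)]"
  have v: "valid_history k n ?h" using assms by (simp add: valid_history_snoc)
  have "(\<Sum>l\<leftarrow>[0..<k]. length (arrival (hist s) u l)) = length (hist s) + 1"
    using length_eq_sum[OF v] by (simp add: arrival_snoc sum_list_distinct_conv_sum_set lessThan_atLeast0)
  then show "knowledge (reported s u x) =
      (if S \<le> c + 1 then (length (hist s) + 1, 0, R + 1) else (F, c + 1, R))"
    and "events (reported s u x) \<le> events s + 1 + (if S \<le> c + 1 then 2 * k else 0)"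
    using assms(1,3) by (auto simp: reported_def after_def answers_def Let_def ask_never)
qed

lemma pot_drift:
  assumes g: "good s" and v: "valid_history k n (hist s)" "length (hist s) < m" and u: "u \<in> {..<k} \<times> {..<n}"
    and b: "b = 1 \<or> b = -1"
  shows "measure_pmf.expectation (astep s u) (pot b) \<le> pot b s + 1"
proof -
  obtain F c R where q: "knowledge s = (F, c, R)" by (metis surj_pair)
  let ?N = "length (hist s)"
  have rp: "report_prob s u = pr F" using report_prob_good[OF g] v q by simp
  have ex: "measure_pmf.expectation (astep s u) (pot b)
      = pr F * pot b (reported s u ()) + (1 - pr F) * pot b (silent s u)"
    by (subst expectation_astep) (use pr[of F] in \<open>simp_all add: rp\<close>)
  note kr = knowledge_reported[OF q v u]
  show ?thesis
  proof (cases "real F \<le> P")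
    case True
    have "pot b (reported s u ()) = 1"
      using True by (auto simp: pot_def kr)
    then show ?thesis unfolding ex using True by (simp add: pot_def q pr_def)
  next
    case False
    note l = lam_le[OF False]
    define p where "p = pr F"
    have p: "0 < p" "p \<le> 1" using pr by (auto simp: p_def)
    define e0 where "e0 = b * lam F * (c / p - (real ?N - F)) - (lam F)\<^sup>2 * (real ?N - F) / p"
    have s0: "pot b s = exp e0"
      using False by (simp add: pot_def q e0_def p_def)
    have s1: "pot b (silent s u) = exp e0 * exp (- (lam F)\<^sup>2 / p) * exp (- (b * lam F))"
      using False by (simp add: pot_def q e0_def p_def exp_add[symmetric] algebra_simps diff_divide_distrib add_divide_distrib)
    have s2: "pot b (reported s u ()) \<le> exp e0 * exp (- (lam F)\<^sup>2 / p) * exp (b * lam F * (1 / p - 1)) + 1"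
    proof (cases "S \<le> c + 1")
      case True
      then show ?thesis by (auto simp: pot_def kr intro: add_increasing)
    next
      case c: False
      then have "pot b (reported s u ()) = exp e0 * exp (- (lam F)\<^sup>2 / p) * exp (b * lam F * (1 / p - 1))"
        using False by (simp add: pot_def kr e0_def p_def exp_add[symmetric] algebra_simps diff_divide_distrib add_divide_distrib)
      then show ?thesis by simp
    qed
    have "pr F * pot b (reported s u ()) + (1 - pr F) * pot b (silent s u)
      \<le> p * (exp e0 * exp (- (lam F)\<^sup>2 / p) * exp (b * lam F * (1 / p - 1)) + 1)
        + (1 - p) * (exp e0 * exp (- (lam F)\<^sup>2 / p) * exp (- (b * lam F)))"
      unfolding p_def[symmetric] s1 using p s2 by (intro add_mono mult_left_mono) auto
    also have "\<dots> = exp e0 * exp (- (lam F)\<^sup>2 / p) *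
        (p * exp (b * lam F * (1 / p - 1)) + (1 - p) * exp (- (b * lam F))) + p"
      by (simp add: algebra_simps)
    also have "\<dots> \<le> exp e0 * exp (- (lam F)\<^sup>2 / p) * exp ((b * lam F)\<^sup>2 * (1 / p - 1)) + 1"
      using p l b by (intro add_mono mult_left_mono bernoulli_mgf) (auto simp: p_def)
    \<comment> \<open>The compensator pays for variance \<open>1 / p\<close> per update, more than
      the actual \<open>1 / p - 1\<close>.\<close>
    also have "exp e0 * exp (- (lam F)\<^sup>2 / p) * exp ((b * lam F)\<^sup>2 * (1 / p - 1)) \<le> exp e0"
      using b by (auto simp: exp_add[symmetric] power_mult_distrib algebra_simps)
    finally show ?thesis unfolding ex s0 by simp
  qed
qed

lemma good_preserved:
  assumes g: "good s" and v: "valid_history k n (hist s)" "length (hist s) < m" and u: "u \<in> {..<k} \<times> {..<n}"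
    and s': "s' \<in> set_pmf (astep s u)" and small: "pot 1 s' < exp L" "pot (-1) s' < exp L"
  shows "good s'"
proof -
  obtain F c R where q: "knowledge s = (F, c, R)" by (metis surj_pair)
  let ?N = "length (hist s)"
  have rp: "report_prob s u = pr F" using report_prob_good[OF g] v q by simp
  have gs: "F \<le> ?N" "c < S" "R > 0 \<Longrightarrow> exp ((real R - 1) * \<beta> / 32) \<le> F"
    "events s \<le> R * (S + 2 * k) + c" "close F c ?N" using g by (auto simp: good_def q)
  have len: "length (hist s') = ?N + 1" using hist_astep[OF s'] by simp
  note kr = knowledge_reported[OF q v u]
  have rpb: "0 \<le> report_prob s u" "report_prob s u \<le> 1" using pr[of F] by (simp_all add: rp)
  from s' rpb show ?thesis
  proof (cases rule: astep_cases)
    case silent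
    \<comment> \<open>Silence excludes report probability 1, hence the range of exact
      counting.\<close>
    then have F: "\<not> real F \<le> P" using silent unfolding rp by (auto simp: pr_def)
    have q': "knowledge s' = (F, c, R)" using silent q by simp
    have "close F c (length (hist s'))"
      using pot_close[OF q' F _ small] gs len by simp
    then show ?thesis using gs silent unfolding good_def q' len by simp
  next
    case (reported x)
    show ?thesis
    proof (cases "S \<le> c + 1")
      case False
      have q': "knowledge s' = (F, c + 1, R)" using reported kr False by simp
      have "close F (c + 1) (length (hist s'))"
      proof (cases "real F \<le> P")
        case True
        then show ?thesis using gs(5) len by (simp add: close_def)
      next
        case F: False
        show ?thesis using pot_close[OF q' F _ small] gs len by simp
      qed
      then show ?thesis
        using gs kr(2)[of x] False reported unfolding good_def q' len by simp
    next
      case True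
      then have c: "c = S - 1" using gs(2) by simp
      have q': "knowledge s' = (?N + 1, 0, R + 1)" using reported kr True by simp
      have ev: "events s' \<le> (R + 1) * (S + 2 * k)"
        using kr(2)[of x] True reported gs(2,4) by simp
      have "close (?N + 1) 0 (?N + 1)" using eps beta by (simp add: close_def)
      moreover have "exp (real R * \<beta> / 32) \<le> real (?N + 1)"
      proof (cases "R > 0")
        case R: True
        have "exp (real R * \<beta> / 32) = exp ((real R - 1) * \<beta> / 32) * exp (\<beta> / 32)"
          by (simp add: exp_add[symmetric] field_simps)
        also have "\<dots> \<le> F * exp (\<beta> / 32)" using gs(3)[OF R] by simp
        also have "\<dots> \<le> real (?N + 1)" using sync_growth gs(1,5) c by simp
        finally show ?thesis .
      qed simp
      ultimately show ?thesis using S_bounds ev unfolding good_def q' len by simp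
    qed
  qed
qed

theorem f1_robust:
  assumes "real m * (2 * ((real m + 2) * exp (-L))) \<le> \<delta>"
    and "real ((LEN + 1) * (2 * (budget + 1 + k + k) + k)) \<le> B"
  shows "robustly_monitors prot k n m (approximates \<epsilon> (F1 n)) \<delta> B"
proof (rule robustly_monitors_prot[where G = good and \<Phi> = pot and I = "{1, -1}" and L = L])
  have "close 0 0 0" using P_pos by (simp add: close_def)
  then show "good ainit" using S_bounds by (simp add: good_def ainit_def)
  show "pot i ainit \<le> 1" for i using P_pos by (simp add: pot_def ainit_def)
  show "0 \<le> pot i s" for i s by (simp add: pot_def split: prod.splits)
  show "approximates \<epsilon> (F1 n) (freq (hist s)) (sync_out (knowledge s))"
    if "good s" "valid_history k n (hist s)" for s
  proof -
    obtain F c R where q: "knowledge s = (F, c, R)" by (metis surj_pair)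
    show ?thesis
      using that close_imp_approx[of F c "length (hist s)" R]
      by (auto simp: good_def q approximates_def F1_freq abs_le_iff algebra_simps)
  qed
qed (use assms pot_drift good_preserved in \<open>auto simp: numeral_eq_Suc\<close>)

end

section \<open>Distinct elements\<close>

definition holders :: "nat \<Rightarrow> 'o history \<Rightarrow> nat \<Rightarrow> nat set" where
  "holders k h i = {j. j < k \<and> i \<in> set (items j h)}"

lemma finite_holders [simp]: "finite (holders k h i)"
  by (simp add: holders_def)

lemma holders_snoc:
  "fst u < k \<Longrightarrow> holders k (h @ [(u, x)]) i = (if i = snd u then insert (fst u) (holders k h i) else holders k h i)"
  by (auto simp: holders_def arrival_snoc arrival_def split: if_splits)

lemma F0_eq_holders:
  assumes "valid_history k n h"
  shows "F0 n (freq h) = card {i. i < n \<and> holders k h i \<noteq> {}}"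
proof -
  have "freq h i \<noteq> 0 \<longleftrightarrow> holders k h i \<noteq> {}" for i
    by (auto simp: freq_eq_sum[OF assms] holders_def count_list_0_iff)
  then show ?thesis by (simp add: F0_def)
qed

text \<open>
  The \<open>r\<close>-th server to receive an item raises this potential by \<open>1 / r\<close>, which is proportional to
  the expected number of questions that are asked if it reports the item.
\<close>

definition harm_sum :: "nat \<Rightarrow> nat \<Rightarrow> 'o history \<Rightarrow> real" where
  "harm_sum k n h = (\<Sum>i<n. harm (card (holders k h i)))"

lemma harm_sum_snoc:
  assumes "fst u < k" "snd u < n"
  shows "harm_sum k n (h @ [(u, x)]) = harm_sum k n h +
    (if fst u \<in> holders k h (snd u) then 0 else 1 / real (Suc (card (holders k h (snd u)))))"
proof -
  let ?i = "snd u"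
  let ?d = "if fst u \<in> holders k h ?i then 0 else 1 / real (Suc (card (holders k h ?i)))"
  have "harm (card (holders k (h @ [(u, x)]) i)) = harm (card (holders k h i)) + (if i = ?i then ?d else 0)" for i
    using assms by (simp add: holders_snoc insert_absorb harm_Suc inverse_eq_divide)
  then show ?thesis using assms by (simp add: harm_sum_def sum.distrib)
qed

lemma F0_snoc:
  assumes "valid_history k n h" "u \<in> {..<k} \<times> {..<n}"
  shows "F0 n (freq (h @ [(u, x)])) = F0 n (freq h) + of_bool (holders k h (snd u) = {})"
proof -
  have v: "valid_history k n (h @ [(u, x)])" using assms by (simp add: valid_history_snoc)
  have u: "fst u < k" "snd u < n" using assms(2) by auto
  let ?A = "{i. i < n \<and> holders k h i \<noteq> {}}"
  have "{i. i < n \<and> holders k (h @ [(u, x)]) i \<noteq> {}} = insert (snd u) ?A"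
    using u by (auto simp: holders_snoc)
  then show ?thesis
    using u unfolding F0_eq_holders[OF v] F0_eq_holders[OF assms(1)] by (simp add: card_insert_if)
qed

lemma card_holders_le:
  assumes "valid_history k n h"
  shows "card (holders k h i) \<le> length h"
proof -
  have "card (holders k h i) = (\<Sum>j<k. of_bool (i \<in> set (items j h)))"
    by (simp add: holders_def Int_def)
  also have "\<dots> \<le> (\<Sum>j<k. length (items j h))"
    by (intro sum_mono) (auto simp: Suc_le_eq length_pos_if_in_set)
  finally show ?thesis using length_eq_sum[OF assms] by simp
qed

lemma harm_sum_le:
  assumes "valid_history k n h" "length h \<le> m"
  shows "harm_sum k n h \<le> harm m * F0 n (freq h)"
proof -
  have "harm_sum k n h \<le> (\<Sum>i<n. if holders k h i \<noteq> {} then harm m else 0)"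
    unfolding harm_sum_def
  proof (intro sum_mono)
    fix i
    have "card (holders k h i) \<le> m" using card_holders_le[OF assms(1), of i] assms(2) by linarith
    then show "harm (card (holders k h i)) \<le> (if holders k h i \<noteq> {} then harm m else (0 :: real))"
      by (auto intro: harm_mono simp: harm_expand(1))
  qed
  also have "\<dots> = (\<Sum>i\<in>{i. i < n \<and> holders k h i \<noteq> {}}. harm m)"
    by (intro sum.mono_neutral_cong_right) auto
  finally show ?thesis using F0_eq_holders[OF assms(1)] by (simp add: mult.commute)
qed

text \<open>
  An upper bound for the number of questions asked when the random servers \<open>xs\<close> are tried before
  all \<open>k\<close> servers and \<open>R\<close> is the set of servers that have the item.
\<close>

fun scan :: "nat set \<Rightarrow> nat \<Rightarrow> nat list \<Rightarrow> nat" where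
  "scan R k [] = k"
| "scan R k (x # xs) = (if x \<in> R then 1 else Suc (scan R k xs))"

text \<open>With \<open>r = card R\<close>, one random question gives the recursion
  \<open>e' = 1 + (1 - r / k) * e\<close>. Its fixed point is \<open>k / r\<close>; the start value
  \<open>k\<close> of the exhaustive search contributes the second term.\<close>

lemma expectation_scan:
  assumes "R \<subseteq> {..<k}" "R \<noteq> {}"
  shows "measure_pmf.expectation (replicate_pmf T (pmf_of_set {..<k})) (\<lambda>xs. real (scan R k xs))
    \<le> k / card R + k * (1 - card R / k) ^ T"
proof (induction T)
  case 0
  then show ?case by simp
next
  case (Suc T)
  have k: "k > 0" using assms by auto
  have fR: "finite R" using assms(1) finite_subset by blast
  have cR: "0 < card R" "card R \<le> k" using assms fR card_mono[OF _ assms(1)] by (auto simp: card_gt_0_iff)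
  let ?U = "pmf_of_set {..<k}"
  have fU: "finite (set_pmf ?U)" using k by (subst set_pmf_of_set) auto
  define e where "e = measure_pmf.expectation (replicate_pmf T ?U) (\<lambda>xs. real (scan R k xs))"
  have int: "integrable (measure_pmf (replicate_pmf T ?U)) (\<lambda>xs. real (scan R k xs))"
    using fU by (intro integrable_measure_pmf_finite finite_replicate_pmf)
  have "measure_pmf.expectation (replicate_pmf (Suc T) ?U) (\<lambda>xs. real (scan R k xs))
      = measure_pmf.expectation ?U (\<lambda>x. if x \<in> R then 1 else 1 + e)"
    unfolding expectation_replicate_Suc[OF fU]
  proof (intro arg_cong2[of _ _ _ _ lebesgue_integral] ext refl)
    fix x
    show "measure_pmf.expectation (replicate_pmf T ?U) (\<lambda>xs. real (scan R k (x # xs))) = (if x \<in> R then 1 else 1 + e)"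
      using int by (simp add: e_def)
  qed
  also have "\<dots> = (\<Sum>x<k. if x \<in> R then 1 else 1 + e) / k"
    using k by (subst integral_pmf_of_set) auto
  also have "(\<Sum>x<k. if x \<in> R then 1 else 1 + e) = (\<Sum>x<k. 1 + e) - (\<Sum>x<k. if x \<in> R then e else 0)"
    by (subst sum_subtractf[symmetric]) (intro sum.cong, auto)
  also have "(\<Sum>x<k. if x \<in> R then e else 0) = card R * e"
    using assms(1) by (simp add: sum.If_cases Int_absorb1)
  also have "((\<Sum>x<k. 1 + e) - card R * e) / k = 1 + (1 - card R / k) * e"
    using k by (simp add: field_simps)
  also have "\<dots> \<le> 1 + (1 - card R / k) * (k / card R + k * (1 - card R / k) ^ T)"
    using Suc cR k by (intro add_left_mono mult_left_mono) (auto simp: e_def)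
  also have "\<dots> = k / card R + k * (1 - card R / k) ^ Suc T"
    using cR k by (simp add: field_simps)
  finally show ?case .
qed

text \<open>With \<open>k\<close> random attempts the exhaustive search no longer matters, since
  \<open>(1 - r / k) ^ k \<le> exp (- r) \<le> 1 / r\<close>.\<close>

lemma expectation_scan':
  assumes "R \<subseteq> {..<k}" "R \<noteq> {}"
  shows "measure_pmf.expectation (replicate_pmf k (pmf_of_set {..<k})) (\<lambda>xs. real (scan R k xs)) \<le> 2 * k / card R"
proof -
  have k: "k > 0" using assms by auto
  have fR: "finite R" using assms(1) finite_subset by blast
  have cR: "0 < card R" "card R \<le> k" using assms fR card_mono[OF _ assms(1)] by (auto simp: card_gt_0_iff)
  have "(1 - card R / k) ^ k \<le> exp (- (card R / k)) ^ k"
    using cR k exp_ge_add_one_self[of "- (card R / k)"] by (intro power_mono) auto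
  also have "\<dots> = exp (- real (card R))" using k by (simp flip: exp_of_nat_mult)
  also have "\<dots> \<le> 1 / card R"
  proof -
    have "real (card R) \<le> exp (real (card R))"
      using exp_ge_add_one_self[of "card R"] by linarith
    then show ?thesis using cR by (simp add: exp_minus field_simps)
  qed
  finally have "k * (1 - card R / k) ^ k \<le> k * (1 / card R)" by (intro mult_left_mono) auto
  then show ?thesis using expectation_scan[OF assms, of k] by simp
qed

definition hit :: "nat list \<Rightarrow> bool" where
  "hit as \<longleftrightarrow> (\<exists>a\<in>set as. a \<noteq> 0)"

text \<open>The search stops early only after a nonzero answer, so stopping does not affect the
  verdict. The random order influences the cost but not the estimate.\<close>

lemma ask_any:
  "\<forall>a\<in>set as. a = 0 \<Longrightarrow> (\<forall>a\<in>set (ask hit f as ls). a = 0) \<longleftrightarrow> (\<forall>l\<in>set ls. f l = 0)"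
proof (induction ls arbitrary: as)
  case (Cons l ls)
  show ?case
  proof (cases "f l = 0")
    case True
    then show ?thesis using Cons.IH[of "as @ [f l]"] Cons.prems by (auto simp: hit_def)
  next
    case False
    have "ask hit f (as @ [f l]) ls = as @ [f l]"
      using False by (cases ls) (auto simp: hit_def)
    moreover have "\<not> hit as" using Cons.prems by (auto simp: hit_def)
    ultimately show ?thesis using False by simp
  qed
qed simp

text \<open>Leaving out the reporting server and invalid indices only shortens the search, because
  none of them lies in \<open>R\<close>.\<close>

lemma length_ask_scan:
  assumes "\<forall>a\<in>set as. a = 0" "j \<notin> R" "R \<subseteq> {..<k}" "\<And>l. l \<in> R \<Longrightarrow> f l \<noteq> 0"
  shows "length (ask hit f as (filter (\<lambda>l. l \<noteq> j \<and> l < k) (xs @ [0..<k]))) \<le> length as + scan R k xs"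
  using assms(1)
proof (induction xs arbitrary: as)
  case Nil
  have "length (filter (\<lambda>l. l \<noteq> j \<and> l < k) [0..<k]) \<le> k"
    by (rule order.trans[OF length_filter_le]) simp
  then show ?case
    unfolding append_Nil scan.simps by (intro order.trans[OF length_ask]) simp
next
  case (Cons x xs)
  let ?st = hit
  have stop: "?st bs \<Longrightarrow> ask ?st f bs ls = bs" for bs ls by (cases ls) auto
  show ?case
  proof (cases "x \<noteq> j \<and> x < k")
    case False
    then show ?thesis using Cons.IH[OF Cons.prems] assms(2,3) by auto
  next
    case True
    have ns: "\<not> ?st as" using Cons.prems by (auto simp: hit_def)
    show ?thesis
    proof (cases "f x = 0")
      case f0: True
      then have "x \<notin> R" using assms(4)[of x] by auto
      then show ?thesis using Cons.IH[of "as @ [f x]"] Cons.prems f0 True ns by simp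
    next
      case False
      then have "hit (as @ [f x])" by (simp add: hit_def)
      then show ?thesis using True ns stop by simp
    qed
  qed
qed

section \<open>The distinct elements protocol\<close>

locale f0_tracking =
  fixes k n m LEN smax A :: nat and \<epsilon> L :: real
  assumes k: "k \<ge> 1" and eps: "0 < \<epsilon>" "\<epsilon> < 1" and L: "L \<ge> 1" and A: "16 * L / \<epsilon>\<^sup>2 \<le> A"
    and smax: "2 * n < 2 ^ smax" and n_pos: "n \<ge> 1" and n: "n < 2 ^ LEN" and LEN: "smax + 1 < LEN"
begin

text \<open>What \<open>cpot < exp L\<close> yields when \<open>harm_sum\<close> is at most
  \<open>8 * A * 2 ^ s * harm m\<close>, as it is in phase \<open>s\<close>.\<close>

definition phase_budget :: nat where
  "phase_budget = nat \<lceil>3 * k * (L + 32 * A * harm m)\<rceil>"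

text \<open>The report that ends a phase adds at most \<open>1 + 2 * k + k \<le> 4 * k\<close>
  events to the phase budget.\<close>

definition budget :: nat where
  "budget = (smax + 1) * (phase_budget + 4 * k) + 1"

text \<open>The final pass over all servers makes the verdict certain, the random prefix makes it
  cheap on average.\<close>

definition ask_plan :: "nat \<Rightarrow> nat list \<Rightarrow> nat list" where
  "ask_plan j x = filter (\<lambda>l. l \<noteq> j \<and> l < k) (take k x @ [0..<k])"

text \<open>
  State \<open>(E, s, c0)\<close>: the estimate, the phase (items are reported with probability \<open>2\<^sup>-\<^sup>s\<close>), and the
  number of events before the phase.
\<close>

fun count_upd :: "nat \<times> nat \<times> nat \<Rightarrow> nat \<Rightarrow> nat \<Rightarrow> nat \<Rightarrow> nat list \<Rightarrow> nat list \<Rightarrow> nat \<times> nat \<times> nat" where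
  "count_upd (E, s, c0) e j v x as =
     (let E' = if \<forall>a\<in>set as. a = 0 then E + 2 ^ s else E
      in if s < smax \<and> A * 2 ^ (s + 1) \<le> E' then (E', s + 1, e + 1 + length as + k) else (E', s, c0))"

text \<open>Only the first local arrival of an item may be reported. Whether the item is counted
  thus depends on a single coin, tossed at its globally first arrival: when a later holder reports
  it, the search finds an earlier one and nothing is added.\<close>

definition new_prob :: "nat \<Rightarrow> nat list \<Rightarrow> real" where
  "new_prob s xs = (if hd xs \<in> set (tl xs) then 0 else (1 / 2) ^ s)"

definition phase :: "nat \<times> nat \<times> nat \<Rightarrow> nat" where
  "phase q = min smax (fst (snd q))"

lemma finite_draw: "finite (set_pmf (replicate_pmf k (pmf_of_set {..<k})))"
proof -
  have "{..<k} \<noteq> {}" using k by (auto simp: lessThan_empty_iff)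
  then show ?thesis by (intro finite_replicate_pmf) simp
qed

sublocale query_protocol k n m LEN budget "2 * k" new_prob hd "\<lambda>z xs. of_bool (z \<in> set xs)" "\<lambda>v. v"
  "\<lambda>q j v. replicate_pmf k (pmf_of_set {..<k})" "\<lambda>q j v x. ask_plan j x"
  "\<lambda>q j v x. hit" count_upd phase "(0, 0, 0)" "\<lambda>q. real (fst q)"
proof unfold_locales
  fix x :: "nat list" and q :: "nat \<times> nat \<times> nat" and j v :: nat
  show "set (ask_plan j x) \<subseteq> {..<k}" by (auto simp: ask_plan_def)
  show "length (ask_plan j x) \<le> 2 * k"
    unfolding ask_plan_def by (rule order.trans[OF length_filter_le]) simp
  have "Suc (phase q) \<le> smax + 1" by (simp add: phase_def)
  also have "\<dots> < LEN" by (rule LEN)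
  also have "\<dots> < 2 ^ LEN" by (rule less_exp)
  finally show "Suc (phase q) < 2 ^ LEN" .
  show "finite (set_pmf (replicate_pmf k (pmf_of_set {..<k})))" by (rule finite_draw)
  show "hd x < 2 ^ LEN" if "set x \<subseteq> {..<n}" "x \<noteq> []"
  proof -
    have "hd x \<in> set x" using that by simp
    then have "hd x < n" using that by blast
    then show ?thesis using n by simp
  qed
  show "of_bool (v \<in> set x) < (2 :: nat) ^ LEN"
  proof -
    have "1 < (2 :: nat) ^ LEN" using LEN by (intro one_less_power) auto
    then show ?thesis by auto
  qed
qed auto

definition good :: "(nat \<times> nat \<times> nat, real) abstract_state \<Rightarrow> bool" where
  "good z \<longleftrightarrow> (case knowledge z of (E, s, c0) \<Rightarrow>
     let N = F0 n (freq (hist z)) in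
     s < smax \<and> (s = 0 \<longrightarrow> E = N) \<and> (s > 0 \<longrightarrow> A * 2 ^ s \<le> E) \<and> E < A * 2 ^ (s + 1) \<and>
     \<bar>real E - N\<bar> \<le> \<epsilon> * N \<and> events z \<le> c0 + phase_budget \<and> c0 \<le> s * (phase_budget + 4 * k))"

text \<open>In a phase \<open>s > 0\<close>, the bound on \<open>A\<close> makes
  \<open>L / lam s\<close> at most \<open>\<epsilon> * E / 8\<close>, and the variance term
  contributes \<open>\<epsilon> * N / 2\<close>.\<close>

definition lam :: "nat \<Rightarrow> real" where "lam s = \<epsilon> / (2 * 2 ^ s)"

text \<open>Controls phase \<open>s0\<close> but is followed from the beginning: in each phase
  \<open>s \<le> s0\<close> the variance caused by a new item is at most \<open>2 ^ s0\<close>, and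
  afterwards the potential is 0. This works because phases never decrease.\<close>

definition pot :: "nat \<Rightarrow> real \<Rightarrow> (nat \<times> nat \<times> nat, real) abstract_state \<Rightarrow> real" where
  "pot s0 b z = (case knowledge z of (E, s, c0) \<Rightarrow>
     let N = real (F0 n (freq (hist z))) in
     if s \<le> s0 then exp (b * lam s0 * (real E - N) - (lam s0)\<^sup>2 * 2 ^ s0 * N) else 0)"

text \<open>Starts each phase at a value of at most 1. Division by \<open>3 * k\<close> keeps the
  exponent contributed by one report, which takes at most \<open>1 + 2 * k\<close> events, at most
  1.\<close>

definition cpot :: "(nat \<times> nat \<times> nat, real) abstract_state \<Rightarrow> real" where
  "cpot z = (case knowledge z of (E, s, c0) \<Rightarrow>
     exp ((real (events z) - c0) / (3 * k) - 4 * harm_sum k n (hist z) / 2 ^ s))"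

lemma good_alive: "good z \<Longrightarrow> events z < budget"
proof -
  assume "good z"
  obtain E s c0 where q: "knowledge z = (E, s, c0)" by (metis surj_pair)
  have g: "s < smax" "events z \<le> c0 + phase_budget" "c0 \<le> s * (phase_budget + 4 * k)"
    using \<open>good z\<close> by (auto simp: good_def q Let_def)
  have "(s + 1) * (phase_budget + 4 * k) \<le> (smax + 1) * (phase_budget + 4 * k)"
    using g(1) by (intro mult_le_mono1) simp
  then show ?thesis
    using g(2,3) unfolding budget_def distrib_right mult_1 by linarith
qed

lemma new_prob_arrival:
  "fst u < k \<Longrightarrow> new_prob s (arrival h u (fst u)) = (if fst u \<in> holders k h (snd u) then 0 else (1 / 2) ^ s)"
  by (simp add: new_prob_def arrival_def holders_def)

lemma report_prob_good:
  assumes "good z" "fst u < k" "knowledge z = (E, s, c0)"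
  shows "report_prob z u = (if fst u \<in> holders k (hist z) (snd u) then 0 else (1 / 2) ^ s)"
proof -
  have "s < smax" using assms(1,3) by (auto simp: good_def Let_def)
  then show ?thesis
    using good_alive[OF assms(1)] assms(2,3) by (simp add: report_prob_def new_prob_arrival phase_def min_def)
qed

lemma answers_zero:
  assumes "fst u < k" "fst u \<notin> holders k (hist z) (snd u)"
  shows "(\<forall>a\<in>set (answers z u x). a = 0) \<longleftrightarrow> holders k (hist z) (snd u) = {}"
proof -
  have "(\<forall>a\<in>set (answers z u x). a = 0) \<longleftrightarrow>
      (\<forall>l\<in>set (ask_plan (fst u) x). snd u \<notin> set (arrival (hist z) u l))"
    unfolding answers_def Let_def using assms(1)
    by (subst ask_any) (auto simp: arrival_def)
  also have "\<dots> \<longleftrightarrow> (\<forall>l\<in>{..<k} - {fst u}. snd u \<notin> set (items l (hist z)))"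
    by (auto simp: ask_plan_def arrival_def dest: in_set_takeD)
  also have "\<dots> \<longleftrightarrow> holders k (hist z) (snd u) = {}"
    using assms by (auto simp: holders_def)
  finally show ?thesis .
qed

lemma length_answers_le: "length (answers z u x) \<le> 2 * k"
  unfolding answers_def Let_def
  by (rule order.trans[OF length_ask]) (use plan_length in simp)

lemma length_answers_scan:
  assumes "fst u < k" "fst u \<notin> holders k (hist z) (snd u)" "length x = k"
  shows "length (answers z u x) \<le> scan (holders k (hist z) (snd u)) k x"
  unfolding answers_def Let_def unfolding ask_plan_def[of "fst u" x]
  using assms by (intro order.trans[OF length_ask_scan[where R = "holders k (hist z) (snd u)"]])
    (auto simp: holders_def arrival_def)

lemma knowledge_reported:
  assumes "knowledge z = (E, s, c0)" "fst u < k" "fst u \<notin> holders k (hist z) (snd u)"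
    and "E' = (if holders k (hist z) (snd u) = {} then E + 2 ^ s else E)"
  shows "s < smax \<and> A * 2 ^ (s + 1) \<le> E' \<Longrightarrow>
      knowledge (reported z u x) = (E', s + 1, events z + 1 + length (answers z u x) + k) \<and>
      events (reported z u x) \<le> events z + 1 + length (answers z u x) + k"
    and "\<not> (s < smax \<and> A * 2 ^ (s + 1) \<le> E') \<Longrightarrow>
      knowledge (reported z u x) = (E', s, c0) \<and>
      events (reported z u x) = events z + 1 + length (answers z u x)"
proof -
  define as where "as = answers z u x"
  have z: "(if \<forall>a\<in>set as. a = 0 then E + 2 ^ s else E) = E'"
    using answers_zero[OF assms(2,3), of x] assms(4) unfolding as_def[symmetric] by auto
  note * = reported_def Let_def as_def[symmetric] after_def assms(1) count_upd.simps z
  show "knowledge (reported z u x) = (E', s + 1, events z + 1 + length (answers z u x) + k) \<and>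
      events (reported z u x) \<le> events z + 1 + length (answers z u x) + k"
    if "s < smax \<and> A * 2 ^ (s + 1) \<le> E'"
    unfolding * using that by simp
  show "knowledge (reported z u x) = (E', s, c0) \<and>
      events (reported z u x) = events z + 1 + length (answers z u x)"
    if "\<not> (s < smax \<and> A * 2 ^ (s + 1) \<le> E')"
    unfolding * using that by (simp add: phase_def)
qed

text \<open>With \<open>r > 0\<close> earlier holders the search takes at most
  \<open>2 * k / r\<close> questions on average. The form with \<open>r + 1\<close> covers
  \<open>r = 0\<close> as well and matches the increment of \<open>harm_sum\<close>.\<close>

lemma expectation_cost:
  assumes "fst u < k" "fst u \<notin> holders k (hist z) (snd u)"
  shows "measure_pmf.expectation (replicate_pmf k (pmf_of_set {..<k}))
      (\<lambda>x. 1 + real (length (answers z u x))) \<le> 5 * k / Suc (card (holders k (hist z) (snd u)))"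
proof -
  let ?R = "holders k (hist z) (snd u)" and ?D = "replicate_pmf k (pmf_of_set {..<k})"
  note fin = finite_draw
  have int: "integrable (measure_pmf ?D) f" for f :: "nat list \<Rightarrow> real"
    by (rule integrable_measure_pmf_finite[OF fin])
  show ?thesis
  proof (cases "?R = {}")
    case True
    have "measure_pmf.expectation ?D (\<lambda>x. 1 + real (length (answers z u x)))
        \<le> measure_pmf.expectation ?D (\<lambda>x. 1 + 2 * real k)"
      using length_answers_le[of z u] by (intro expectation_mono_finite[OF fin]) (simp add: of_nat_le_iff[symmetric, where 'a = real] del: of_nat_le_iff)
    then show ?thesis using True k by simp
  next
    case False
    have sub: "insert (fst u) ?R \<subseteq> {..<k}" using assms by (auto simp: holders_def)
    have r: "1 \<le> card ?R" "Suc (card ?R) \<le> k"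
      using False assms card_mono[OF _ sub] by (auto simp: Suc_le_eq card_gt_0_iff)
    have "measure_pmf.expectation ?D (\<lambda>x. 1 + real (length (answers z u x)))
        \<le> measure_pmf.expectation ?D (\<lambda>x. 1 + real (scan ?R k x))"
      using length_answers_scan[OF assms]
      by (intro expectation_mono_finite[OF fin]) (auto simp: set_replicate_pmf)
    also have "\<dots> = 1 + measure_pmf.expectation ?D (\<lambda>x. real (scan ?R k x))"
      using int by simp
    also have "\<dots> \<le> 1 + 2 * k / card ?R"
      using expectation_scan'[of ?R k] sub False by simp
    also have "\<dots> \<le> k / Suc (card ?R) + 4 * k / Suc (card ?R)"
    proof (intro add_mono, goal_cases)
      case 1
      then show ?case using r by (simp add: field_simps)
    next
      case 2
      have "2 * real k * Suc (card ?R) \<le> 2 * real k * (2 * card ?R)"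
        using r by (intro mult_left_mono) auto
      then show ?case using r by (simp add: divide_simps)
    qed
    finally show ?thesis by (simp add: add_divide_distrib[symmetric])
  qed
qed

lemma pot_drift:
  assumes g: "good z" and v: "valid_history k n (hist z)" and u: "u \<in> {..<k} \<times> {..<n}"
    and b: "b = 1 \<or> b = -1"
  shows "measure_pmf.expectation (astep z u) (pot s0 b) \<le> pot s0 b z"
proof -
  obtain E s c0 where q: "knowledge z = (E, s, c0)" by (metis surj_pair)
  have uk: "fst u < k" using u by auto
  let ?R = "holders k (hist z) (snd u)"
  let ?D = "replicate_pmf k (pmf_of_set {..<k})"
  define N where "N = real (F0 n (freq (hist z)))"
  note rp = report_prob_good[OF g uk q]
  note F0s = F0_snoc[OF v u]
  show ?thesis
  proof (cases "fst u \<in> ?R")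
    case True
    have "pot s0 b (silent z u) = pot s0 b z"
      using True by (auto simp: pot_def q F0s Let_def)
    then show ?thesis by (subst expectation_astep) (use True in \<open>simp_all add: rp\<close>)
  next
    case new: False
    define p :: real where "p = (1 / 2) ^ s"
    have p: "0 < p" "p \<le> 1" "1 / p = 2 ^ s" by (auto simp: p_def power_le_one power_one_over)
    have ex: "measure_pmf.expectation (astep z u) (pot s0 b) =
        p * measure_pmf.expectation ?D (\<lambda>x. pot s0 b (reported z u x)) + (1 - p) * pot s0 b (silent z u)"
      by (subst expectation_astep) (use new p in \<open>simp_all add: rp p_def\<close>)
    define E' where "E' = (if ?R = {} then E + 2 ^ s else E)"
    define N' where "N' = N + of_bool (?R = {})"
    define t where "t = (if s \<le> s0 then exp (b * lam s0 * (real E' - N') - (lam s0)\<^sup>2 * 2 ^ s0 * N') else 0)"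
    have rep: "pot s0 b (reported z u x) \<le> t" for x
      using knowledge_reported[OF q uk new E'_def, of x]
      by (cases "s < smax \<and> A * 2 ^ (s + 1) \<le> E'")
        (auto simp: pot_def Let_def F0s N_def N'_def t_def)
    have "measure_pmf.expectation ?D (\<lambda>x. pot s0 b (reported z u x)) \<le> measure_pmf.expectation ?D (\<lambda>x. t)"
      by (intro expectation_mono_finite finite_draw rep)
    then have "measure_pmf.expectation ?D (\<lambda>x. pot s0 b (reported z u x)) \<le> t" by simp
    then have "measure_pmf.expectation (astep z u) (pot s0 b) \<le> p * t + (1 - p) * pot s0 b (silent z u)"
      unfolding ex using p by (intro add_right_mono mult_left_mono) auto
    also have "\<dots> \<le> pot s0 b z"
    proof (cases "s \<le> s0")
      case False
      then show ?thesis by (simp add: t_def pot_def q)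
    next
      case s: True
      have l: "0 < lam s0" "lam s0 \<le> p"
      proof -
        have "lam s0 \<le> (1 / 2) ^ s0" using eps by (simp add: lam_def power_one_over field_simps)
        also have "\<dots> \<le> p" unfolding p_def using s by (intro power_decreasing) auto
        finally show "lam s0 \<le> p" .
        show "0 < lam s0" using eps by (simp add: lam_def)
      qed
      have z: "pot s0 b z = exp (b * lam s0 * (real E - N) - (lam s0)\<^sup>2 * 2 ^ s0 * N)"
        using s by (simp add: pot_def q N_def Let_def)
      have si: "pot s0 b (silent z u) = exp (b * lam s0 * (real E - N') - (lam s0)\<^sup>2 * 2 ^ s0 * N')"
        using s by (simp add: pot_def q N_def N'_def F0s Let_def)
      show ?thesis
      proof (cases "?R = {}")
        case False
        then show ?thesis unfolding z si t_def using s by (simp add: E'_def N'_def algebra_simps)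
      next
        case True
        let ?l = "b * lam s0" and ?w = "exp (- (lam s0)\<^sup>2 * 2 ^ s0)"
        have t: "t = pot s0 b z * ?w * exp (?l * (1 / p - 1))"
          using s True by (simp add: t_def z E'_def N'_def p(3) exp_add[symmetric] algebra_simps)
        have si': "pot s0 b (silent z u) = pot s0 b z * ?w * exp (- ?l)"
          using s True by (simp add: si z N'_def exp_add[symmetric] algebra_simps)
        have "p * t + (1 - p) * pot s0 b (silent z u)
            = pot s0 b z * ?w * (p * exp (?l * (1 / p - 1)) + (1 - p) * exp (- ?l))"
          unfolding t si' by (simp add: algebra_simps)
        also have "\<dots> \<le> pot s0 b z * ?w * exp (?l\<^sup>2 * (1 / p - 1))"
          using p l b by (intro mult_left_mono bernoulli_mgf) (auto simp: z)
        \<comment> \<open>All phases up to \<open>s0\<close> share the compensator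
          \<open>2 ^ s0\<close>, which dominates \<open>1 / p - 1 = 2 ^ s - 1\<close>.\<close>
        also have "?w * exp (?l\<^sup>2 * (1 / p - 1)) \<le> 1"
        proof -
          have "(2 :: real) ^ s - 1 \<le> 2 ^ s0" using power_increasing[OF s, of "2 :: real"] by linarith
          then have "(lam s0)\<^sup>2 * (2 ^ s - 1) \<le> (lam s0)\<^sup>2 * 2 ^ s0" by (intro mult_left_mono) auto
          moreover have "?l\<^sup>2 = (lam s0)\<^sup>2" using b by (auto simp: power_mult_distrib)
          ultimately have "- (lam s0)\<^sup>2 * 2 ^ s0 + ?l\<^sup>2 * (1 / p - 1) \<le> 0" by (simp only: p(3))
          then show ?thesis by (simp only: exp_add[symmetric] exp_le_one_iff)
        qed
        then have "pot s0 b z * ?w * exp (?l\<^sup>2 * (1 / p - 1)) \<le> pot s0 b z"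
          by (simp add: z mult.assoc)
        finally show ?thesis .
      qed
    qed
    finally show ?thesis .
  qed
qed

lemma cpot_drift:
  assumes g: "good z" and u: "u \<in> {..<k} \<times> {..<n}"
  shows "measure_pmf.expectation (astep z u) cpot \<le> cpot z + 1"
proof -
  obtain E s c0 where q: "knowledge z = (E, s, c0)" by (metis surj_pair)
  have uk: "fst u < k" and un: "snd u < n" using u by auto
  let ?R = "holders k (hist z) (snd u)"
  let ?D = "replicate_pmf k (pmf_of_set {..<k})"
  note rp = report_prob_good[OF g uk q]
  note hs = harm_sum_snoc[OF uk un, of "hist z"]
  show ?thesis
  proof (cases "fst u \<in> ?R")
    case True
    have "cpot (silent z u) = cpot z"
      using True by (simp add: cpot_def q hs)
    then show ?thesis by (subst expectation_astep) (use True in \<open>simp_all add: rp\<close>)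
  next
    case new: False
    define p :: real where "p = (1 / 2) ^ s"
    have p: "0 < p" "p \<le> 1" by (auto simp: p_def power_le_one)
    have ex: "measure_pmf.expectation (astep z u) cpot =
        p * measure_pmf.expectation ?D (\<lambda>x. cpot (reported z u x)) + (1 - p) * cpot (silent z u)"
      by (subst expectation_astep) (use new p in \<open>simp_all add: rp p_def\<close>)
    define r where "r = 1 / real (Suc (card ?R))"
    define w where "w = exp (- (4 * r * p))"
    have si: "cpot (silent z u) = cpot z * w"
      using new by (simp add: cpot_def q hs w_def r_def p_def exp_add[symmetric] add_divide_distrib algebra_simps power_one_over)
    define y where "y x = (1 + real (length (answers z u x))) / (3 * k)" for x
    have y: "0 \<le> y x" "y x \<le> 1" for x
    proof -
      have "1 + real (length (answers z u x)) \<le> 3 * real k"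
        using length_answers_le[of z u x] k by linarith
      then show "y x \<le> 1" using k by (simp add: y_def divide_le_eq)
    qed (simp add: y_def)
    have rep: "cpot (reported z u x) \<le> cpot z * w * (1 + 2 * y x) + 1" for x
    proof -
      define E' where "E' = (if ?R = {} then E + 2 ^ s else E)"
      note kr = knowledge_reported[OF q uk new E'_def, of x]
      show ?thesis
      proof (cases "s < smax \<and> A * 2 ^ (s + 1) \<le> E'")
        case True
        have "0 \<le> harm_sum k n (hist (reported z u x))"
          unfolding harm_sum_def by (intro sum_nonneg) (simp add: harm_nonneg)
        moreover have "(real (events (reported z u x)) - real (events z + 1 + length (answers z u x) + k)) / (3 * k) \<le> 0"
        proof -
          have "real (events (reported z u x)) \<le> real (events z + 1 + length (answers z u x) + k)"
            using kr(1)[OF True] by (simp only: of_nat_le_iff)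
          then show ?thesis by (intro divide_nonpos_nonneg) auto
        qed
        ultimately have "cpot (reported z u x) \<le> 1"
          using kr(1)[OF True] by (simp add: cpot_def del: hist_reported of_nat_add)
            (smt (verit) divide_nonneg_pos zero_less_power)
        moreover have "0 \<le> cpot z * w * (1 + 2 * y x)"
          using y(1)[of x] by (simp add: cpot_def q w_def)
        ultimately show ?thesis by linarith
      next
        case False
        have "cpot (reported z u x) = cpot z * w * exp (y x)"
          using kr(2)[OF False] new
          by (simp add: cpot_def q hs w_def r_def p_def y_def exp_add[symmetric] add_divide_distrib
              diff_divide_distrib algebra_simps power_one_over)
        also have "\<dots> \<le> cpot z * w * (1 + 2 * y x)"
          using exp_le_linear[OF y] by (intro mult_left_mono) (auto simp: cpot_def q w_def)
        finally show ?thesis by simp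
      qed
    qed
    have int: "integrable (measure_pmf ?D) f" for f :: "nat list \<Rightarrow> real"
      by (rule integrable_measure_pmf_finite[OF finite_draw])
    have "measure_pmf.expectation ?D (\<lambda>x. cpot (reported z u x))
        \<le> measure_pmf.expectation ?D (\<lambda>x. cpot z * w * (1 + 2 * y x) + 1)"
      by (intro expectation_mono_finite finite_draw rep)
    also have "\<dots> = cpot z * w * (1 + 2 * measure_pmf.expectation ?D y) + 1"
      using int by simp
    also have "measure_pmf.expectation ?D y = measure_pmf.expectation ?D (\<lambda>x. 1 + real (length (answers z u x))) / (3 * k)"
      unfolding y_def by simp
    also have "\<dots> \<le> (5 * k * r) / (3 * k)"
      using expectation_cost[OF uk new] by (intro divide_right_mono) (auto simp: r_def)
    also have "\<dots> = 5 / 3 * r" using k by simp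
    finally have e: "measure_pmf.expectation ?D (\<lambda>x. cpot (reported z u x)) \<le> cpot z * w * (1 + 2 * (5 / 3 * r)) + 1"
      by (simp add: cpot_def q w_def)
    have "measure_pmf.expectation (astep z u) cpot
        \<le> p * (cpot z * w * (1 + 2 * (5 / 3 * r)) + 1) + (1 - p) * (cpot z * w)"
      unfolding ex si using p e by (intro add_right_mono mult_left_mono) auto
    also have "\<dots> = cpot z * (w * (1 + 10 / 3 * r * p)) + p"
      by (simp add: algebra_simps)
    finally have e2: "measure_pmf.expectation (astep z u) cpot \<le> cpot z * (w * (1 + 10 / 3 * r * p)) + p" .
    \<comment> \<open>The factor 4 in \<open>cpot\<close> exceeds \<open>2 * 5 / 3\<close>, where 2
      stems from \<open>exp y \<le> 1 + 2 * y\<close> and \<open>5 / 3\<close> from the expected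
      cost divided by \<open>3 * k\<close>.\<close>
    have "w * (1 + 10 / 3 * r * p) \<le> 1"
    proof -
      have "0 \<le> r * p" using p by (simp add: r_def)
      then have "1 + 10 / 3 * r * p \<le> exp (4 * r * p)"
        using exp_ge_add_one_self[of "4 * r * p"] by linarith
      then have "w * (1 + 10 / 3 * r * p) \<le> w * exp (4 * r * p)" by (intro mult_left_mono) (auto simp: w_def)
      then show ?thesis by (simp add: w_def exp_add[symmetric])
    qed
    then have "cpot z * (w * (1 + 10 / 3 * r * p)) \<le> cpot z"
      by (intro mult_left_le) (simp_all add: cpot_def q)
    then show ?thesis using e2 p by linarith
  qed
qed

text \<open>The error bound involves \<open>E\<close> itself. Since \<open>\<epsilon> < 1\<close>,
  it first implies \<open>E \<le> 2 * N\<close>; inserting this gives error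
  \<open>3 / 4 * \<epsilon> * N\<close>.\<close>

lemma accuracy:
  assumes s: "s = 0 \<Longrightarrow> E = N" "s > 0 \<Longrightarrow> A * 2 ^ s \<le> E"
    and dev: "lam s * \<bar>real E - real N\<bar> \<le> L + (lam s)\<^sup>2 * 2 ^ s * N"
  shows "\<bar>real E - N\<bar> \<le> \<epsilon> * N" "real N \<le> 4 * E" "E \<le> 2 * N"
proof -
  have "\<bar>real E - N\<bar> \<le> 3 / 4 * (\<epsilon> * N) \<and> real E \<le> 2 * N"
  proof (cases "s = 0")
    case True
    then show ?thesis using s eps by simp
  next
    case False
    have l: "0 < lam s" using eps by (simp add: lam_def)
    have "\<bar>real E - real N\<bar> \<le> (L + (lam s)\<^sup>2 * 2 ^ s * N) / lam s"
      using dev l by (simp add: field_simps)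
    also have "\<dots> = 2 * L / \<epsilon> * 2 ^ s + \<epsilon> * N / 2"
      using eps by (simp add: lam_def field_simps power2_eq_square)
    also have "2 * L / \<epsilon> * 2 ^ s \<le> \<epsilon> * E / 8"
    proof -
      have "16 * L / \<epsilon>\<^sup>2 * 2 ^ s \<le> real A * 2 ^ s" using A by (intro mult_right_mono) auto
      also have "\<dots> = real (A * 2 ^ s)" by simp
      also have "\<dots> \<le> E" using s(2) False by (simp only: of_nat_le_iff)
      finally have "\<epsilon> / 8 * (16 * L / \<epsilon>\<^sup>2 * 2 ^ s) \<le> \<epsilon> / 8 * E" using eps by (intro mult_left_mono) auto
      then show ?thesis using eps by (simp add: power2_eq_square field_simps)
    qed
    finally have d: "\<bar>real E - N\<bar> \<le> \<epsilon> * E / 8 + \<epsilon> * N / 2" by simp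
    have "\<epsilon> * E \<le> E" "\<epsilon> * N \<le> N" using eps by (auto simp: mult_left_le_one_le)
    then have "real E \<le> 2 * N" using d by linarith
    moreover from this have "\<epsilon> * E \<le> \<epsilon> * (2 * N)" using eps by (intro mult_left_mono) auto
    ultimately show ?thesis using d by linarith
  qed
  moreover have "\<epsilon> * N \<le> N" "0 \<le> \<epsilon> * N" using eps by (auto simp: mult_left_le_one_le)
  ultimately show "\<bar>real E - N\<bar> \<le> \<epsilon> * N" "real N \<le> 4 * E" "E \<le> 2 * N" by linarith+
qed

lemma good_preserved:
  assumes g: "good z" and v: "valid_history k n (hist z)" "length (hist z) < m" and u: "u \<in> {..<k} \<times> {..<n}"
    and z': "z' \<in> set_pmf (astep z u)" and csmall: "cpot z' < exp L"
    and small: "\<And>s0 b. s0 \<le> smax \<Longrightarrow> b = 1 \<or> b = -1 \<Longrightarrow> pot s0 b z' < exp L"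
  shows "good z'"
proof -
  obtain E s c0 where q: "knowledge z = (E, s, c0)" by (metis surj_pair)
  have uk: "fst u < k" using u by auto
  let ?R = "holders k (hist z) (snd u)"
  define N where "N = F0 n (freq (hist z))"
  define N' where "N' = F0 n (freq (hist z'))"
  note rp = report_prob_good[OF g uk q]
  have gs: "s < smax" "s = 0 \<Longrightarrow> E = N" "s > 0 \<Longrightarrow> A * 2 ^ s \<le> E" "E < A * 2 ^ (s + 1)"
    "events z \<le> c0 + phase_budget" "c0 \<le> s * (phase_budget + 4 * k)"
    using g by (auto simp: good_def q Let_def N_def)
  have hz': "hist z' = hist z @ [(u, real (fst (knowledge z')))]" by (rule hist_astep[OF z'])
  have v': "valid_history k n (hist z')" "length (hist z') \<le> m"
    using v u by (auto simp: hz' valid_history_snoc)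
  have N': "N' = N + of_bool (?R = {})"
    unfolding N'_def N_def hz' using F0_snoc[OF v(1) u] by simp
  obtain E' s' c0' where q': "knowledge z' = (E', s', c0')" by (metis surj_pair)
  have A1: "1 \<le> A"
  proof -
    have "0 < 16 * L / \<epsilon>\<^sup>2" using L eps by simp
    then show ?thesis using A by linarith
  qed
  have rpb: "0 \<le> report_prob z u" "report_prob z u \<le> 1" by (auto simp: rp power_le_one)
  have st: "s' \<le> smax \<and> (s' = 0 \<longrightarrow> E' = N') \<and> (s' > 0 \<longrightarrow> A * 2 ^ s' \<le> E') \<and>
      (s' < smax \<longrightarrow> E' < A * 2 ^ (s' + 1)) \<and> c0' \<le> s' * (phase_budget + 4 * k)"
    using z' rpb
  proof (cases rule: astep_cases)
    case silent
    then have "s = 0 \<Longrightarrow> fst u \<in> ?R" using rp by (auto split: if_splits)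
    then have "s = 0 \<Longrightarrow> N' = N" using N' by auto
    then show ?thesis using silent q q' gs by auto
  next
    case (reported x)
    then have new: "fst u \<notin> ?R" using rp by auto
    define F where "F = (if ?R = {} then E + 2 ^ s else E)"
    have F0: "s = 0 \<Longrightarrow> F = N'" and FE: "E \<le> F" "F \<le> E + 2 ^ s"
      using gs(2) N' by (auto simp: F_def)
    note kr = knowledge_reported[OF q uk new F_def, of x]
    show ?thesis
    proof (cases "s < smax \<and> A * 2 ^ (s + 1) \<le> F")
      case True
      have e: "E' = F" "s' = s + 1" "c0' = events z + 1 + length (answers z u x) + k"
        using kr(1)[OF True] reported(1) q' by auto
      have "(2 :: nat) ^ s \<le> A * 2 ^ s" using A1 by simp
      moreover have "A * 2 ^ (s' + 1) = 4 * (A * 2 ^ s)" "A * 2 ^ (s + 1) = 2 * (A * 2 ^ s)"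
        using e(2) by simp_all
      \<comment> \<open>A report adds at most \<open>2 ^ s \<le> A * 2 ^ s\<close>, so no phase is
        skipped.\<close>
      ultimately have "F < A * 2 ^ (s' + 1)" using FE(2) gs(4) by linarith
      moreover have "c0' \<le> s' * (phase_budget + 4 * k)"
        using gs(5,6) length_answers_le[of z u x] k unfolding e by simp
      ultimately show ?thesis using True e by simp
    next
      case False
      have e: "E' = F" "s' = s" "c0' = c0"
        using kr(2)[OF False] reported(1) q' by auto
      have "s > 0 \<Longrightarrow> A * 2 ^ s \<le> F" using gs(3) FE(1) by (meson le_trans)
      then show ?thesis using False e gs F0 by auto
    qed
  qed
  have dev: "lam s' * \<bar>real E' - real N'\<bar> \<le> L + (lam s')\<^sup>2 * 2 ^ s' * N'"
  proof -
    have "b * lam s' * (real E' - N') - (lam s')\<^sup>2 * 2 ^ s' * N' < L" if "b = 1 \<or> b = -1" for b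
      using small[of s' b] that st by (simp add: pot_def q' N'_def Let_def)
    from this[of 1] this[of "-1"] show ?thesis by (auto simp: abs_if algebra_simps)
  qed
  note acc = accuracy[OF _ _ dev]
  have acc: "\<bar>real E' - N'\<bar> \<le> \<epsilon> * N'" "real N' \<le> 4 * E'" "E' \<le> 2 * N'"
    using st acc by auto
  \<comment> \<open>Reaching the last phase would take an estimate of at least
    \<open>2 ^ smax > 2 * n\<close>, although \<open>E' \<le> 2 * N'\<close>.\<close>
  have s': "s' < smax"
  proof (rule ccontr)
    assume "\<not> s' < smax"
    then have s': "s' = smax" using st by simp
    have "smax > 0" using gs(1) by simp
    then have "A * 2 ^ smax \<le> E'" using st s' by simp
    also have "\<dots> \<le> 2 * N'" by (rule acc)
    also have "N' \<le> n"
      unfolding N'_def F0_def using card_mono[of "{..<n}" "{i. i < n \<and> freq (hist z') i \<noteq> 0}"] by auto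
    also have "2 * n < 2 ^ smax" by (rule smax)
    also have "\<dots> \<le> A * 2 ^ smax" using A1 by simp
    finally show False by simp
  qed
  have "events z' \<le> c0' + phase_budget"
  proof -
    let ?W = "harm_sum k n (hist z')"
    have "(real (events z') - c0') / (3 * k) - 4 * ?W / 2 ^ s' < L"
      using csmall by (simp add: cpot_def q')
    moreover have "?W \<le> harm m * (8 * A * 2 ^ s')"
    proof -
      have "?W \<le> harm m * N'" unfolding N'_def by (rule harm_sum_le[OF v'])
      also have "real N' \<le> 8 * A * 2 ^ s'"
      proof -
        have "real E' \<le> real (A * 2 ^ (s' + 1))" using st s' by (simp only: of_nat_le_iff) simp
        then show ?thesis using acc(2) by simp
      qed
      finally show ?thesis by (simp add: mult_left_mono harm_nonneg)
    qed
    then have "4 * ?W / 2 ^ s' \<le> 32 * A * harm m" by (simp add: field_simps)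
    ultimately have "(real (events z') - c0') / (3 * k) \<le> L + 32 * A * harm m" by linarith
    then have "real (events z') - c0' \<le> 3 * k * (L + 32 * A * harm m)"
      using k by (simp add: divide_le_eq mult.commute)
    then show ?thesis unfolding phase_budget_def by linarith
  qed
  then show ?thesis
    using st s' acc unfolding good_def q' by (simp add: N'_def)
qed

theorem f0_robust:
  assumes "real m * (real (2 * smax + 3) * ((real m + 2) * exp (-L))) \<le> \<delta>"
    and "real ((LEN + 1) * (2 * (budget + 1 + 2 * k + k) + k)) \<le> B"
  shows "robustly_monitors prot k n m (approximates \<epsilon> (F0 n)) \<delta> B"
proof -
  \<comment> \<open>Sign 0 selects the cost potential, the signs 1 and -1 the two tails.\<close>
  define \<Phi> where "\<Phi> = (\<lambda>(s0, b). if b = 0 then cpot else pot s0 b)"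
  define I where "I = insert (0, 0 :: real) ({..smax} \<times> {1, -1})"
  have card: "card I \<le> 2 * smax + 3"
  proof -
    have "card I \<le> Suc (card ({..smax} \<times> {1, -1 :: real}))" unfolding I_def by (rule card_insert_le_m1) auto
    also have "\<dots> = 2 * smax + 3" by (simp add: card_cartesian_product)
    finally show ?thesis .
  qed
  show ?thesis
  proof (rule robustly_monitors_prot[where G = good and \<Phi> = \<Phi> and I = I and L = L])
    show "finite I" by (simp add: I_def)
    have F00: "F0 n (freq ([] :: real history)) = 0" by (simp add: F0_def freq_def)
    have A1: "0 < A"
    proof -
      have "0 < 16 * L / \<epsilon>\<^sup>2" using L eps by simp
      then show ?thesis using A by linarith
    qed
    have "0 < smax" using smax n_pos by (cases smax) auto
    then show "good ainit" using F00 A1 by (simp add: good_def ainit_def Let_def)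
    have "harm_sum k n ([] :: real history) = 0" by (simp add: harm_sum_def holders_def harm_expand(1))
    then show "\<Phi> i ainit \<le> 1" for i
      using F00 by (cases i) (simp add: \<Phi>_def pot_def cpot_def ainit_def)
    show "0 \<le> \<Phi> i z" for i z
      by (cases i) (auto simp: \<Phi>_def pot_def cpot_def Let_def split: prod.splits)
    show "measure_pmf.expectation (astep z u) (\<Phi> i) \<le> \<Phi> i z + 1"
      if "i \<in> I" "good z" "valid_history k n (hist z)" "u \<in> {..<k} \<times> {..<n}" for i z u
    proof -
      obtain s0 b where i: "i = (s0, b)" by fastforce
      show ?thesis
      proof (cases "b = 0")
        case True
        then show ?thesis using cpot_drift that by (simp add: \<Phi>_def i)
      next
        case False
        then have "b = 1 \<or> b = -1" using that(1) by (auto simp: I_def i)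
        from pot_drift[OF that(2-4) this, of s0] False show ?thesis by (simp add: \<Phi>_def i)
      qed
    qed
    show "good z'"
      if "good z" "valid_history k n (hist z)" "length (hist z) < m" "u \<in> {..<k} \<times> {..<n}"
        "z' \<in> set_pmf (astep z u)" "\<And>i. i \<in> I \<Longrightarrow> \<Phi> i z' < exp L" for z z' u
    proof (rule good_preserved[OF that(1-5)])
      show "cpot z' < exp L" using that(6)[of "(0, 0)"] by (simp add: I_def \<Phi>_def)
      show "pot s0 b z' < exp L" if "s0 \<le> smax" "b = 1 \<or> b = -1" for s0 b
        using \<open>\<And>i. i \<in> I \<Longrightarrow> \<Phi> i z' < exp L\<close>[of "(s0, b)"] that by (auto simp: I_def \<Phi>_def)
    qed
    show "approximates \<epsilon> (F0 n) (freq (hist z)) (real (fst (knowledge z)))" if "good z" for z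
      using that by (auto simp: good_def approximates_def Let_def abs_le_iff algebra_simps split: prod.splits)
    have "real m * (real (card I) * ((real m + 2) * exp (-L))) \<le> real m * (real (2 * smax + 3) * ((real m + 2) * exp (-L)))"
      using card by (intro mult_left_mono mult_right_mono) (auto simp only: of_nat_le_iff, auto)
    then show "real m * (real (card I) * ((real m + 2) * exp (-L))) \<le> \<delta>" using assms(1) by linarith
    show "real ((LEN + 1) * (2 * (budget + 1 + 2 * k + k) + k)) \<le> B" by (rule assms(2))
  qed
qed

end

section \<open>Heavy hitters\<close>

text \<open>Generating function of a binomial variable: \<open>c = 0\<close> gives the probability
  of no success, an exponential \<open>c\<close> the moment generating function.\<close>

lemma expectation_power_successes:
  fixes c :: real
  assumes fin: "finite (set_pmf p)"
  shows "measure_pmf.expectation (replicate_pmf T p) (\<lambda>xs. c ^ length (filter P xs))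
    = (1 - measure (measure_pmf p) {x. P x} + measure (measure_pmf p) {x. P x} * c) ^ T"
proof (induction T)
  case 0
  then show ?case by simp
next
  case (Suc T)
  let ?\<pi> = "measure (measure_pmf p) {x. P x}"
  define e where "e = measure_pmf.expectation (replicate_pmf T p) (\<lambda>xs. c ^ length (filter P xs))"
  have int: "integrable (measure_pmf p) f" for f :: "'a \<Rightarrow> real"
    by (rule integrable_measure_pmf_finite[OF fin])
  have "measure_pmf.expectation (replicate_pmf (Suc T) p) (\<lambda>xs. c ^ length (filter P xs))
      = measure_pmf.expectation p (\<lambda>x. e + (c - 1) * e * indicator {x. P x} x)"
    unfolding expectation_replicate_Suc[OF fin]
  proof (intro arg_cong2[of _ _ _ _ lebesgue_integral] ext refl)
    fix x
    show "measure_pmf.expectation (replicate_pmf T p) (\<lambda>xs. c ^ length (filter P (x # xs)))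
        = e + (c - 1) * e * indicator {x. P x} x"
      by (cases "P x") (simp_all add: e_def algebra_simps)
  qed
  also have "\<dots> = e + (c - 1) * e * ?\<pi>"
    using int by simp
  also have "\<dots> = (1 - ?\<pi> + ?\<pi> * c) * e" by (simp add: algebra_simps)
  finally show ?case by (simp add: Suc e_def)
qed

text \<open>Here \<open>q\<close> is the report probability and \<open>T\<close> the number of
  trials. As one of the two is 1, the mixture with the case of no report is still bounded by an
  exponential in the mean number \<open>q * T * \<pi>\<close> of successes.\<close>

lemma trial_mgf:
  fixes q \<pi> a :: real
  assumes "0 \<le> q" "q \<le> 1" "0 \<le> \<pi>" "\<pi> \<le> 1" "q = 1 \<or> T = 1" "\<bar>a\<bar> \<le> 1"
  shows "q * (1 - \<pi> + \<pi> * exp a) ^ T + (1 - q) \<le> exp (q * T * \<pi> * (a + a\<^sup>2))"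
proof -
  let ?d = "\<pi> * (exp a - 1)"
  have e: "q * T * \<pi> * (exp a - 1) \<le> q * T * \<pi> * (a + a\<^sup>2)"
    using exp_le_quadratic[OF assms(6)] assms by (intro mult_left_mono) auto
  have pos: "0 \<le> 1 + ?d"
  proof -
    have "1 + ?d = (1 - \<pi>) + \<pi> * exp a" by (simp add: algebra_simps)
    moreover have "0 \<le> \<pi> * exp a" using assms(3) by simp
    ultimately show ?thesis using assms(4) by linarith
  qed
  have r: "1 - \<pi> + \<pi> * exp a = 1 + ?d" by (simp add: algebra_simps)
  have "q * (1 + ?d) ^ T + (1 - q) \<le> exp (q * T * ?d)"
    using assms(5)
  proof
    assume "q = 1"
    have "(1 + ?d) ^ T \<le> exp ?d ^ T" using pos exp_ge_add_one_self[of ?d] by (intro power_mono) auto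
    then show ?thesis using \<open>q = 1\<close> by (simp add: exp_of_nat_mult)
  next
    assume "T = 1"
    then show ?thesis using exp_ge_add_one_self[of "q * ?d"] by (simp add: algebra_simps)
  qed
  also have "\<dots> \<le> exp (q * T * \<pi> * (a + a\<^sup>2))" using e by (simp add: mult.assoc)
  finally show ?thesis unfolding r .
qed

text \<open>
  In what follows, \<open>y l\<close> is the frequency of a fixed item at server \<open>l\<close>.  A reported update that
  raises it to \<open>x\<close> triggers a collection of all counts with probability proportional to the overlap.
\<close>

definition overlap :: "nat \<Rightarrow> nat \<Rightarrow> (nat \<Rightarrow> nat) \<Rightarrow> nat" where
  "overlap k x y = (\<Sum>l<k. min x (y l))"

definition level :: "nat \<Rightarrow> (nat \<Rightarrow> nat) \<Rightarrow> nat \<Rightarrow> nat set" where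
  "level k y x = {l. l < k \<and> x \<le> y l}"

text \<open>
  An update that raises a local count to \<open>x\<close> increases the spread by at least the inverse of the
  overlap.  The spread is polylogarithmic, so updates whose overlap is far below the frequency of
  their item are rare.
\<close>

definition spread :: "nat \<Rightarrow> nat \<Rightarrow> (nat \<Rightarrow> nat) \<Rightarrow> real" where
  "spread m k y = (\<Sum>x=1..m. harm (card (level k y x)) / real x)"

lemma finite_level [simp]: "finite (level k y x)"
  by (simp add: level_def)

text \<open>A random server together with a random threshold below \<open>x\<close> realizes
  acceptance with probability \<open>min 1 (y / x)\<close> by one uniform draw, made before any
  answer is known.\<close>

lemma success_prob:
  assumes "k > 0" "x > 0"
  shows "measure (measure_pmf (pmf_of_set ({..<k} \<times> {..<x}))) {(l, v). v < a l}
    = overlap k x a / (k * x)"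
proof -
  have ne: "{..<k} \<times> {..<x} \<noteq> {}" using assms by (auto simp: lessThan_empty_iff)
  have "({..<k} \<times> {..<x}) \<inter> {(l, v). v < a l} = Sigma {..<k} (\<lambda>l. {..<min x (a l)})" by auto
  then have "card (({..<k} \<times> {..<x}) \<inter> {(l, v). v < a l}) = overlap k x a"
    by (simp add: overlap_def)
  then show ?thesis
    using ne by (subst measure_pmf_of_set) (auto simp: card_cartesian_product)
qed

lemma overlap_le_sum: "overlap k x y \<le> (\<Sum>l<k. y l)"
  unfolding overlap_def by (intro sum_mono) simp

lemma overlap_le_mult: "overlap k x y \<le> k * x"
  using sum_mono[of "{..<k}" "\<lambda>l. min x (y l)" "\<lambda>_. x"] by (simp add: overlap_def)

lemma level_mult_le_overlap: "card (level k y x) * x \<le> overlap k x y"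
proof -
  have "card (level k y x) * x = (\<Sum>l\<in>level k y x. min x (y l))"
    by (simp add: level_def)
  also have "\<dots> \<le> overlap k x y"
    unfolding overlap_def by (intro sum_mono2) (auto simp: level_def)
  finally show ?thesis .
qed

text \<open>Only the level set at the new height changes, and it gains exactly the server
  \<open>j\<close>.\<close>

lemma spread_Suc:
  assumes "j < k" "Suc (y j) \<le> m"
  shows "spread m k (y(j := Suc (y j))) = spread m k y +
    1 / (real (card (level k (y(j := Suc (y j))) (Suc (y j)))) * real (Suc (y j)))"
proof -
  let ?y = "y(j := Suc (y j))" and ?x = "Suc (y j)"
  have other: "level k ?y x = level k y x" if "x \<noteq> ?x" for x
    using that by (auto simp: level_def)
  have "level k ?y ?x = insert j (level k y ?x)" "j \<notin> level k y ?x"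
    using assms by (auto simp: level_def)
  then have c: "card (level k ?y ?x) = Suc (card (level k y ?x))" by simp
  have mem: "?x \<in> {1..m}" using assms by auto
  have "spread m k ?y = harm (card (level k ?y ?x)) / ?x + (\<Sum>x\<in>{1..m} - {?x}. harm (card (level k ?y x)) / x)"
    unfolding spread_def by (rule sum.remove[OF _ mem]) simp
  also have "(\<Sum>x\<in>{1..m} - {?x}. harm (card (level k ?y x)) / real x) = (\<Sum>x\<in>{1..m} - {?x}. harm (card (level k y x)) / x)"
    by (intro sum.cong) (auto simp: other)
  also have "harm (card (level k ?y ?x)) / real ?x = harm (card (level k y ?x)) / ?x + 1 / (real (card (level k ?y ?x)) * ?x)"
    unfolding c harm_Suc by (simp add: add_divide_distrib inverse_eq_divide)
  also have "\<dots> + (\<Sum>x\<in>{1..m} - {?x}. harm (card (level k y x)) / x)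
      = spread m k y + 1 / (real (card (level k ?y ?x)) * ?x)"
    unfolding spread_def using sum.remove[OF _ mem, of "\<lambda>x. harm (card (level k y x)) / real x"] by simp
  finally show ?thesis .
qed

lemma spread_nonneg: "0 \<le> spread m k y"
  unfolding spread_def by (intro sum_nonneg) (simp add: harm_nonneg)

lemma spread_le:
  assumes "(\<Sum>l<k. y l) \<le> m"
  shows "spread m k y \<le> (harm m)\<^sup>2"
proof -
  have "card (level k y x) \<le> m" if "x \<ge> 1" for x
  proof -
    have "card (level k y x) \<le> card (level k y x) * x" using that by simp
    also have "\<dots> \<le> m" using level_mult_le_overlap overlap_le_sum assms by (meson le_trans)
    finally show ?thesis .
  qed
  then have "spread m k y \<le> (\<Sum>x=1..m. harm m / real x)"
    unfolding spread_def by (intro sum_mono divide_right_mono harm_mono) auto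
  also have "\<dots> = (harm m)\<^sup>2"
    by (simp add: harm_def power2_eq_square sum_distrib_left divide_inverse)
  finally show ?thesis .
qed

section \<open>The second moment and its lower bound\<close>

definition counts :: "'o history \<Rightarrow> nat \<Rightarrow> nat \<Rightarrow> nat" where
  "counts h i l = count_list (items l h) i"

lemma counts_snoc:
  "counts (h @ [(u, x)]) i = (if i = snd u then (counts h i)(fst u := Suc (counts h i (fst u))) else counts h i)"
  by (cases u) (auto simp: counts_def arrival_snoc count_list_arrival)

lemma freq_counts: "valid_history k n h \<Longrightarrow> freq h i = (\<Sum>l<k. counts h i l)"
  by (simp add: counts_def freq_eq_sum)

lemma freq_le_length: "freq h i \<le> length h"
  by (simp add: freq_def)

definition F2 :: "nat \<Rightarrow> (nat \<Rightarrow> nat) \<Rightarrow> real" where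
  "F2 n f = (\<Sum>i<n. (real (f i))\<^sup>2)"

lemma norm2_eq: "norm2 n f = sqrt (F2 n f)"
  by (simp add: norm2_def L2_set_def F2_def)

lemma sum_update:
  fixes g g' :: "nat \<Rightarrow> real"
  assumes "i < n" "\<And>l. l \<noteq> i \<Longrightarrow> g' l = g l"
  shows "(\<Sum>l<n. g' l) = (\<Sum>l<n. g l) + (g' i - g i)"
proof -
  have "(\<Sum>l<n. g' l) = g' i + (\<Sum>l\<in>{..<n} - {i}. g' l)"
    using assms(1) by (intro sum.remove) auto
  also have "(\<Sum>l\<in>{..<n} - {i}. g' l) = (\<Sum>l\<in>{..<n} - {i}. g l)"
    by (intro sum.cong) (auto simp: assms(2))
  also have "g' i + \<dots> = (\<Sum>l<n. g l) + (g' i - g i)"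
    using assms(1) sum.remove[of "{..<n}" i g] by simp
  finally show ?thesis .
qed

lemma F2_snoc:
  assumes "snd u < n"
  shows "F2 n (freq (h @ [(u, x)])) = F2 n (freq h) + real (2 * freq (h @ [(u, x)]) (snd u) - 1)"
  unfolding F2_def
  by (subst sum_update[OF assms, where g = "\<lambda>i. (real (freq h i))\<^sup>2"])
    (auto simp: freq_snoc power2_eq_square algebra_simps)

lemma F2_le: "valid_history k n h \<Longrightarrow> F2 n (freq h) \<le> (real (length h))\<^sup>2"
proof -
  assume v: "valid_history k n h"
  have "F2 n (freq h) \<le> (\<Sum>i<n. real (freq h i) * real (length h))"
    unfolding F2_def power2_eq_square
    by (intro sum_mono mult_left_mono) (auto simp: freq_le_length)
  also have "\<dots> = real (F1 n (freq h)) * length h"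
    by (simp add: F1_def sum_distrib_right)
  finally show ?thesis by (simp add: F1_freq[OF v] power2_eq_square)
qed

lemma freq_le_F2: "i < n \<Longrightarrow> real (freq h i) \<le> F2 n (freq h)"
proof -
  assume "i < n"
  have "real (freq h i) \<le> (real (freq h i))\<^sup>2"
    by (cases "freq h i") (auto simp: power2_eq_square)
  also have "\<dots> \<le> F2 n (freq h)"
    unfolding F2_def using \<open>i < n\<close> by (intro member_le_sum) auto
  finally show ?thesis .
qed

text \<open>
  A lower bound for \<open>F\<^sub>2\<close> that does not increase at updates whose overlap is far below the
  frequency of the item.  Ignoring these updates keeps the increments of the estimate small.
\<close>

definition F2_low :: "real \<Rightarrow> nat \<Rightarrow> nat \<Rightarrow> nat \<Rightarrow> 'o history \<Rightarrow> real" where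
  "F2_low B m k n h = (\<Sum>i<n. (real (freq h i))\<^sup>2 * (1 - 2 * spread m k (counts h i) / B))"

lemma F2_low_ge:
  assumes "valid_history k n h" "length h \<le> m" "B > 0" "64 * (harm m)\<^sup>2 \<le> B"
  shows "31 / 32 * F2 n (freq h) \<le> F2_low B m k n h"
  unfolding F2_low_def F2_def sum_distrib_left
proof (intro sum_mono)
  fix i
  have "(\<Sum>l<k. counts h i l) \<le> m"
    using freq_le_length[of h i] assms by (simp add: freq_counts[symmetric])
  then have "2 * spread m k (counts h i) / B \<le> 1 / 32"
    using spread_le[where k = k and y = "counts h i" and m = m] assms by (simp add: divide_le_eq)
  then have "31 / 32 \<le> 1 - 2 * spread m k (counts h i) / B" by simp
  then have "(real (freq h i))\<^sup>2 * (31 / 32) \<le> (real (freq h i))\<^sup>2 * (1 - 2 * spread m k (counts h i) / B)"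
    by (intro mult_left_mono) auto
  then show "31 / 32 * (real (freq h i))\<^sup>2 \<le> (real (freq h i))\<^sup>2 * (1 - 2 * spread m k (counts h i) / B)"
    by simp
qed

text \<open>If \<open>f > B * overlap\<close>, the spread grows by some
  \<open>D \<ge> 1 / overlap > B / f\<close>. The penalty \<open>2 * f\<^sup>2 * D / B\<close> is
  then at least \<open>2 * f\<close> and outweighs the increase \<open>2 * f - 1\<close> of
  \<open>f\<^sup>2\<close>.\<close>

lemma F2_low_snoc:
  fixes h :: "'o history" and x :: 'o
  assumes v: "valid_history k n h" "length h < m" and u: "u \<in> {..<k} \<times> {..<n}" and B: "B > 0"
  defines "h' \<equiv> h @ [(u, x)]"
  defines "y \<equiv> counts h' (snd u)"
  shows "F2_low B m k n h' - F2_low B m k n h \<le>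
    (if real (freq h' (snd u)) \<le> B * overlap k (y (fst u)) y then real (2 * freq h' (snd u) - 1) else 0)"
proof -
  let ?i = "snd u" and ?j = "fst u"
  have v': "valid_history k n h'" using v u by (simp add: h'_def valid_history_snoc)
  define f where "f = freq h' ?i"
  define a where "a = counts h ?i"
  have f: "f = Suc (freq h ?i)" by (simp add: f_def h'_def freq_snoc)
  have y: "y = a(?j := Suc (a ?j))" by (simp add: y_def h'_def counts_snoc a_def)
  have "a ?j \<le> (\<Sum>l<k. a l)" using u by (intro member_le_sum) auto
  then have "Suc (a ?j) \<le> m"
    using freq_counts[OF v(1), of ?i] freq_le_length[of h ?i] v(2) by (simp add: a_def)
  from spread_Suc[of ?j k a m, OF _ this] have sp: "spread m k y = spread m k a + 1 / (real (card (level k y (y ?j))) * real (y ?j))"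
    using u unfolding y by auto
  define D where "D = 1 / (real (card (level k y (y ?j))) * real (y ?j))"
  have D0: "0 \<le> D" by (simp add: D_def)
  have "F2_low B m k n h' = F2_low B m k n h +
      ((real f)\<^sup>2 * (1 - 2 * (spread m k a + D) / B) - (real (freq h ?i))\<^sup>2 * (1 - 2 * spread m k a / B))"
    unfolding F2_low_def
    by (subst sum_update[of ?i n _ "\<lambda>i. (real (freq h i))\<^sup>2 * (1 - 2 * spread m k (counts h i) / B)"])
      (use u in \<open>auto simp: h'_def freq_snoc counts_snoc a_def[symmetric] y[symmetric] sp f D_def\<close>)
  also have "\<dots> = F2_low B m k n h + (2 * real f - 1) * (1 - 2 * spread m k a / B) - (real f)\<^sup>2 * (2 * D / B)"
    by (simp add: f power2_eq_square algebra_simps add_divide_distrib)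
  finally have eq: "F2_low B m k n h' - F2_low B m k n h =
      (2 * real f - 1) * (1 - 2 * spread m k a / B) - (real f)\<^sup>2 * (2 * D / B)" by simp
  have "(2 * real f - 1) * (1 - 2 * spread m k a / B) \<le> (2 * real f - 1) * 1"
    using spread_nonneg[of m k a] B f by (intro mult_left_mono) auto
  then have le: "F2_low B m k n h' - F2_low B m k n h \<le> (2 * real f - 1) - (real f)\<^sup>2 * (2 * D / B)"
    using eq by simp
  have r: "real (2 * f - 1) = 2 * real f - 1" using f by simp
  show ?thesis
  proof (cases "real f \<le> B * overlap k (y ?j) y")
    case True
    moreover have "0 \<le> (real f)\<^sup>2 * (2 * D / B)" using D0 B by simp
    ultimately show ?thesis using le unfolding f_def[symmetric] r by simp
  next
    case False
    have pos: "0 < card (level k y (y ?j)) * y ?j"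
    proof -
      have "?j \<in> level k y (y ?j)" using u by (auto simp: level_def)
      then have "0 < card (level k y (y ?j))" by (auto simp: card_gt_0_iff)
      then show ?thesis by (simp add: y)
    qed
    have "real (card (level k y (y ?j))) * y ?j \<le> overlap k (y ?j) y"
      using level_mult_le_overlap[of k y "y ?j"] by (metis of_nat_le_iff of_nat_mult)
    then have "B * (real (card (level k y (y ?j))) * y ?j) \<le> B * overlap k (y ?j) y"
      using B by (intro mult_left_mono) auto
    then have "B * (real (card (level k y (y ?j))) * y ?j) \<le> real f" using False by linarith
    moreover have "0 < real (card (level k y (y ?j))) * y ?j"
      using pos by (metis of_nat_0_less_iff of_nat_mult)
    ultimately have "1 \<le> real f * D / B"
      using B by (simp add: D_def field_simps)
    then have "2 * real f * 1 \<le> 2 * real f * (real f * D / B)" by (intro mult_left_mono) auto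
    then show ?thesis using le False unfolding f_def[symmetric]
      by (simp add: power2_eq_square mult_ac)
  qed
qed

text \<open>Sampling an update that raises a local count to \<open>x\<close> has variance
  proportional to at most \<open>1 / x\<close>; this is the sum of these terms over all updates of
  an item.\<close>

definition harms :: "nat \<Rightarrow> (nat \<Rightarrow> nat) \<Rightarrow> real" where
  "harms k y = (\<Sum>l<k. harm (y l))"

lemma harms_Suc: "j < k \<Longrightarrow> harms k (y(j := Suc (y j))) = harms k y + 1 / real (Suc (y j))"
  unfolding harms_def
  by (subst sum_update[of j k _ "\<lambda>l. harm (y l)"]) (auto simp: harm_Suc inverse_eq_divide)

lemma harms_le: "(\<And>l. l < k \<Longrightarrow> y l \<le> m) \<Longrightarrow> harms k y \<le> k * harm m"
  unfolding harms_def using sum_mono[of "{..<k}" "\<lambda>l. harm (y l)" "\<lambda>_. harm m :: real"]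
  by (simp add: harm_mono)

text \<open>
  Counts only the updates above the current cutoff.  Since cutoffs never decrease, all of them
  were eligible for sampling when they arrived.
\<close>

definition excess :: "real \<Rightarrow> nat \<Rightarrow> (nat \<Rightarrow> nat) \<Rightarrow> real" where
  "excess x0 k y = (\<Sum>l<k. max 0 (real (y l) - x0))"

lemma excess_Suc:
  assumes "j < k"
  shows "excess x0 k (y(j := Suc (y j))) - excess x0 k y \<le> (if x0 \<le> real (Suc (y j)) then 1 else 0)"
  unfolding excess_def
  by (subst sum_update[OF assms, of _ "\<lambda>l. max 0 (real (y l) - x0)"]) auto

lemma excess_ge: "real (\<Sum>l<k. y l) - k * x0 \<le> excess x0 k y"
  using sum_mono[of "{..<k}" "\<lambda>l. real (y l) - x0" "\<lambda>l. max 0 (real (y l) - x0)"]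
  by (simp add: excess_def sum_subtractf)

text \<open>The stopping condition can hold only at length \<open>T\<close>: all trials are
  answered, and the one decision is whether the full collection follows.\<close>

lemma ask_staged:
  assumes "\<And>as. length as \<noteq> T \<Longrightarrow> \<not> st as" "length as + length ls = T"
  shows "ask st f as (ls @ ls') = (let r = as @ map f ls in if st r then r else r @ map f ls')"
  using assms(2)
proof (induction ls arbitrary: as)
  case Nil
  have "T < length as \<Longrightarrow> ask st f as ls' = as @ map f ls'" for as ls'
    by (induction ls' arbitrary: as) (auto simp: assms(1))
  then show ?case using Nil by (cases ls') (auto simp: Let_def)
next
  case (Cons l ls)
  then show ?case using Cons.IH[of "as @ [f l]"] assms(1)[of as] by (simp add: Let_def)
qed

text \<open>
  A record \<open>(i, x, s, K, f, M)\<close> holds the item, its local count, the phase, the number of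
  successful trials, and the frequency and overlap if they were collected (otherwise \<open>0\<close>).  States
  must be countable, so the coordinator stores records and the real-valued estimates are computed
  from them.
\<close>

type_synonym hh_record = "nat \<times> nat \<times> nat \<times> nat \<times> nat \<times> nat"

definition successes :: "(nat \<times> nat) list \<Rightarrow> nat list \<Rightarrow> nat" where
  "successes aux as = length (filter (\<lambda>((l, v), a). v < a) (zip aux as))"

lemma successes_map: "successes aux (map f (map fst aux) @ bs) = length (filter (\<lambda>(l, v). v < f l) aux)"
  by (induction aux) (auto simp: successes_def)

section \<open>The heavy hitters protocol\<close>

locale hh_tracking =
  fixes k n m LEN smax C :: nat and \<epsilon> L H :: real
  assumes k: "k \<ge> 1" and eps: "0 < \<epsilon>" "\<epsilon> < 1" and L: "L \<ge> 1" and H: "harm m \<le> H" "1 \<le> H"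
    and C1: "131072 * L * H\<^sup>2 \<le> C" and C2: "1600 * L * H / \<epsilon>\<^sup>2 \<le> C"
    and smax: "2 * (real m)\<^sup>2 + 2 < 2 ^ smax"
    and report_small: "\<And>i x. i < n \<Longrightarrow> x \<le> m \<Longrightarrow> prod_encode (i, x) < 2 ^ LEN"
    and m: "m < 2 ^ LEN" and LEN: "smax + 1 < LEN"
begin

text \<open>Keeps the penalty \<open>2 * spread / B\<close> at most \<open>1 / 32\<close>, as the
  spread is at most \<open>(harm m)\<^sup>2\<close>.\<close>

definition B :: real where "B = 64 * H\<^sup>2"

text \<open>The intended mean number of trials. In good states \<open>2 ^ s\<close> agrees with
  \<open>F\<^sub>2\<close> up to constants once the stream is nonempty; \<open>C\<close> carries
  \<open>1 / \<epsilon>\<^sup>2\<close> and the logarithmic factors.\<close>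

definition load :: "nat \<Rightarrow> nat \<Rightarrow> real" where
  "load s x = C * k * x / 2 ^ s"

definition sampling :: "nat \<Rightarrow> nat \<Rightarrow> real" where
  "sampling s x = min 1 (load s x)"

text \<open>
  When \<open>load s x > 1\<close>, every update is reported and the excess probability is made up for by several
  independent trials, each of which asks one random server.
\<close>

definition trials :: "nat \<Rightarrow> nat \<Rightarrow> nat" where
  "trials s x = min (4 * C * k) (nat \<lceil>load s x\<rceil>)"

text \<open>Ignoring smaller local counts costs an item at most
  \<open>\<epsilon> * sqrt (2 ^ s) / 20\<close> over all \<open>k\<close> servers. The updates that
  are kept are sampled with probability 1 or at least \<open>lamH s\<close>, as the moment bound
  demands.\<close>

definition cutoff :: "nat \<Rightarrow> real" where
  "cutoff s = \<epsilon> * sqrt (2 ^ s) / (20 * k)"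

text \<open>The increase \<open>2 * f - 1\<close> of \<open>f\<^sup>2\<close>, divided by the
  expected number of successes \<open>sampling * trials * M / (k * x)\<close>. Discarding updates
  with small overlap keeps the quotient bounded.\<close>

definition weight :: "nat \<Rightarrow> nat \<Rightarrow> nat \<Rightarrow> nat \<Rightarrow> real" where
  "weight s x f M = (if real f \<le> B * M
     then real (2 * f - 1) * (k * x) / (sampling s x * trials s x * M) else 0)"

fun F2_gain :: "hh_record \<Rightarrow> real" where
  "F2_gain (i, x, s, K, f, M) = K * weight s x f M"

fun freq_gain :: "nat \<Rightarrow> hh_record \<Rightarrow> real" where
  "freq_gain i0 (i, x, s, K, f, M) = (if i = i0 \<and> cutoff s \<le> x then 1 / sampling s x else 0)"

definition F2_est :: "hh_record list \<Rightarrow> real" where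
  "F2_est tr = (\<Sum>r\<leftarrow>tr. F2_gain r)"

definition freq_est :: "nat \<Rightarrow> hh_record list \<Rightarrow> real" where
  "freq_est i tr = (\<Sum>r\<leftarrow>tr. freq_gain i r)"

definition phase :: "hh_record list \<Rightarrow> nat" where
  "phase tr = min smax (nat \<lfloor>log 2 (max 1 (F2_est tr))\<rfloor>)"

definition hh_rate :: "nat \<Rightarrow> nat list \<Rightarrow> real" where
  "hh_rate s xs = sampling s (count_list xs (hd xs))"

definition hh_rep :: "nat list \<Rightarrow> nat" where
  "hh_rep xs = prod_encode (hd xs, count_list xs (hd xs))"

definition hh_ans :: "nat \<Rightarrow> nat list \<Rightarrow> nat" where
  "hh_ans z xs = count_list xs z"

definition hh_qry :: "nat \<Rightarrow> nat" where
  "hh_qry v = fst (prod_decode v)"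

definition trial_pmf :: "nat \<Rightarrow> (nat \<times> nat) pmf" where
  "trial_pmf x = pmf_of_set ({..<k} \<times> {..<max 1 x})"

definition hh_draw :: "hh_record list \<times> nat \<Rightarrow> nat \<Rightarrow> nat \<Rightarrow> (nat \<times> nat) list pmf" where
  "hh_draw q j v = (let x = snd (prod_decode v) in replicate_pmf (trials (phase (fst q)) x) (trial_pmf x))"

definition hh_plan :: "hh_record list \<times> nat \<Rightarrow> nat \<Rightarrow> nat \<Rightarrow> (nat \<times> nat) list \<Rightarrow> nat list" where
  "hh_plan q j v aux = filter (\<lambda>l. l < k) (map fst (take (4 * C * k) aux)) @ [0..<k]"

definition hh_stop :: "hh_record list \<times> nat \<Rightarrow> nat \<Rightarrow> nat \<Rightarrow> (nat \<times> nat) list \<Rightarrow> nat list \<Rightarrow> bool" where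
  "hh_stop q j v aux as \<longleftrightarrow> length as = length aux \<and> successes aux as = 0"

definition hh_record :: "nat \<Rightarrow> nat \<Rightarrow> (nat \<times> nat) list \<Rightarrow> nat list \<Rightarrow> hh_record" where
  "hh_record s v aux as =
     (let (i, x) = prod_decode v; full = drop (length aux) as
      in (i, x, s, successes aux as, sum_list full, sum_list (map (min x) full)))"

definition hh_upd ::
  "hh_record list \<times> nat \<Rightarrow> nat \<Rightarrow> nat \<Rightarrow> nat \<Rightarrow> (nat \<times> nat) list \<Rightarrow> nat list \<Rightarrow> hh_record list \<times> nat" where
  "hh_upd q e j v aux as =
     (let tr = fst q; tr' = hh_record (phase tr) v aux as # tr
      in (tr', if phase tr' \<noteq> phase tr then e + 1 + length as + k else snd q))"

text \<open>The factor \<open>3 / 4\<close> is midway between the required levels 1 and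
  \<open>1 / 2\<close>.\<close>

definition hh_out :: "hh_record list \<times> nat \<Rightarrow> nat \<Rightarrow> real option" where
  "hh_out q i = (if i < n \<and> 3 / 4 * \<epsilon> * sqrt (F2_est (fst q)) \<le> freq_est i (fst q)
     then Some (freq_est i (fst q)) else None)"

definition hh_phase :: "hh_record list \<times> nat \<Rightarrow> nat" where
  "hh_phase q = phase (fst q)"

text \<open>What \<open>cpot < exp L\<close> yields, the 5 being a bound for
  \<open>2 * F\<^sub>2 / 2 ^ s\<close> within a phase.\<close>

definition phase_budget :: nat where
  "phase_budget = nat \<lceil>6 * C * k * (L + 5)\<rceil>"

definition budget :: nat where
  "budget = (smax + 1) * (phase_budget + 8 * C * k) + 1"

lemma C_ge: "2 \<le> C"
proof -
  have "1 * 1 \<le> L * H\<^sup>2" using L H(2) by (intro mult_mono) (auto simp: one_le_power)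
  then show ?thesis using C1 by linarith
qed

lemma B_pos: "0 < B"
  using H by (simp add: B_def)

lemma finite_trial: "finite (set_pmf (trial_pmf x))"
proof -
  have "{..<k} \<times> {..<max 1 x} \<noteq> {}" using k by (auto simp: lessThan_empty_iff)
  then show ?thesis by (simp add: trial_pmf_def)
qed

lemma finite_hh_draw: "finite (set_pmf (hh_draw q j v))"
  by (simp add: hh_draw_def Let_def finite_replicate_pmf finite_trial)

sublocale query_protocol k n m LEN budget "4 * C * k + k" hh_rate hh_rep hh_ans hh_qry hh_draw hh_plan hh_stop
  hh_upd hh_phase "([], 0)" hh_out
proof unfold_locales
  fix q :: "hh_record list \<times> nat" and j v :: nat and aux :: "(nat \<times> nat) list"
  show "set (hh_plan q j v aux) \<subseteq> {..<k}" by (auto simp: hh_plan_def)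
  show "length (hh_plan q j v aux) \<le> 4 * C * k + k"
    unfolding hh_plan_def length_append by (intro add_mono order.trans[OF length_filter_le]) auto
  have "Suc (hh_phase q) \<le> smax + 1" by (simp add: hh_phase_def phase_def)
  also have "\<dots> < LEN" by (rule LEN)
  also have "\<dots> < 2 ^ LEN" by (rule less_exp)
  finally show "Suc (hh_phase q) < 2 ^ LEN" .
  show "finite (set_pmf (hh_draw q j v))" by (rule finite_hh_draw)
  show "hh_qry v < 2 ^ LEN" if "v < 2 ^ LEN"
    using that le_prod_encode_1[of "fst (prod_decode v)" "snd (prod_decode v)"] by (simp add: hh_qry_def)
next
  fix xs :: "nat list" and z assume xs: "set xs \<subseteq> {..<n}" "length xs \<le> m"
  have c: "count_list xs z \<le> m" for z using count_le_length[of xs z] xs(2) by linarith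
  then show "hh_ans z xs < 2 ^ LEN" using le_less_trans[OF c m] by (simp add: hh_ans_def)
  show "hh_rep xs < 2 ^ LEN" if "xs \<noteq> []"
  proof -
    have "hd xs \<in> set xs" using that by simp
    then have "hd xs < n" using xs by blast
    then show ?thesis using c by (simp add: hh_rep_def report_small)
  qed
qed

lemma load_pos: "0 < x \<Longrightarrow> 0 < load s x"
  using k C_ge by (simp add: load_def)

lemma sampling: "0 < x \<Longrightarrow> 0 < sampling s x" "0 \<le> sampling s x" "sampling s x \<le> 1"
  using load_pos[of x s] by (auto simp: sampling_def load_def)

lemma F2_gain_nonneg: "0 \<le> F2_gain r"
  by (cases r) (simp add: weight_def sampling(2))

lemma phase_mono: "phase tr \<le> phase (r # tr)"
proof -
  have "F2_est tr \<le> F2_est (r # tr)" using F2_gain_nonneg[of r] by (simp add: F2_est_def)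
  then have "log 2 (max 1 (F2_est tr)) \<le> log 2 (max 1 (F2_est (r # tr)))" by (intro log_mono) auto
  then show ?thesis unfolding phase_def by (intro min.mono nat_mono floor_mono order.refl)
qed

lemma phase_le: "2 ^ phase tr \<le> max 1 (F2_est tr)"
proof -
  have "0 \<le> log 2 (max 1 (F2_est tr))" by simp
  then have "real (phase tr) \<le> log 2 (max 1 (F2_est tr))" unfolding phase_def by linarith
  then have "2 powr real (phase tr) \<le> 2 powr log 2 (max 1 (F2_est tr))" by (intro powr_mono) auto
  also have "\<dots> = max 1 (F2_est tr)" by (intro powr_log_cancel) auto
  finally show ?thesis by (simp add: powr_realpow)
qed

lemma less_phase: "phase tr < smax \<Longrightarrow> max 1 (F2_est tr) < 2 ^ (phase tr + 1)"
proof -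
  assume "phase tr < smax"
  then have "log 2 (max 1 (F2_est tr)) < real (phase tr + 1)" unfolding phase_def by linarith
  then have "2 powr log 2 (max 1 (F2_est tr)) < 2 powr real (phase tr + 1)" by (intro powr_less_mono) auto
  then show ?thesis by (simp add: powr_realpow powr_add)
qed

definition good :: "(hh_record list \<times> nat, nat \<Rightarrow> real option) abstract_state \<Rightarrow> bool" where
  "good z \<longleftrightarrow> (case knowledge z of (tr, c0) \<Rightarrow>
     let N = F2 n (freq (hist z)) in
     phase tr < smax \<and> 87 / 100 * N \<le> F2_est tr \<and> F2_est tr \<le> 11 / 10 * N \<and>
     (\<forall>i<n. \<bar>freq_est i tr - freq (hist z) i\<bar> \<le> \<epsilon> / 8 * sqrt N) \<and>
     events z \<le> c0 + phase_budget \<and> c0 \<le> phase tr * (phase_budget + 8 * C * k))"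

lemma good_alive: "good z \<Longrightarrow> events z < budget"
proof -
  assume "good z"
  obtain tr c0 where q: "knowledge z = (tr, c0)" by (metis surj_pair)
  have g: "phase tr < smax" "events z \<le> c0 + phase_budget" "c0 \<le> phase tr * (phase_budget + 8 * C * k)"
    using \<open>good z\<close> by (auto simp: good_def q Let_def)
  have "(phase tr + 1) * (phase_budget + 8 * C * k) \<le> (smax + 1) * (phase_budget + 8 * C * k)"
    using g(1) by (intro mult_le_mono1) simp
  then show ?thesis
    using g(2,3) unfolding budget_def distrib_right mult_1 by linarith
qed

lemma good_F2:
  assumes "good z" "knowledge z = (tr, c0)"
  shows "F2 n (freq (hist z)) \<le> 5 / 2 * 2 ^ phase tr"
proof -
  have "87 / 100 * F2 n (freq (hist z)) \<le> F2_est tr" "phase tr < smax"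
    using assms by (auto simp: good_def Let_def)
  then show ?thesis using less_phase[of tr] by simp
qed

text \<open>\<open>J\<close> bounds a single weight in phase \<open>s0\<close>, and
  \<open>lamE\<close> is scaled to it so that the variance term becomes
  \<open>F\<^sub>2 / 32\<close>. \<open>lamH\<close> makes \<open>L / lamH s0\<close> equal to
  \<open>\<epsilon> * sqrt (2 ^ s0) / 40\<close>, and \<open>V\<close> is the variance per unit of
  \<open>harms\<close>.\<close>

definition J :: "nat \<Rightarrow> real" where "J s0 = 2 * B * 2 ^ s0 / C"
definition lamE :: "nat \<Rightarrow> real" where "lamE s0 = 1 / (32 * J s0)"
definition lamH :: "nat \<Rightarrow> real" where "lamH s0 = 40 * L / (\<epsilon> * sqrt (2 ^ s0))"
definition V :: "nat \<Rightarrow> real" where "V s0 = 2 ^ s0 / (C * k)"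

text \<open>The upper tail is compared with the true value, the lower tail with a lower bound that
  does not increase at ignored updates. The mean increment of the estimate thus lies on the right
  side of both references.\<close>

definition refE :: "real \<Rightarrow> (nat \<Rightarrow> real option) history \<Rightarrow> real" where
  "refE b h = (if b = 1 then F2 n (freq h) else F2_low B m k n h)"

definition refH :: "nat \<Rightarrow> nat \<Rightarrow> real \<Rightarrow> (nat \<Rightarrow> real option) history \<Rightarrow> real" where
  "refH s0 i b h = (if b = 1 then freq h i else excess (cutoff s0) k (counts h i))"

definition potE :: "nat \<Rightarrow> real \<Rightarrow> (hh_record list \<times> nat, nat \<Rightarrow> real option) abstract_state \<Rightarrow> real" where
  "potE s0 b z = (let tr = fst (knowledge z) in if phase tr \<le> s0 then
     exp (b * lamE s0 * (F2_est tr - refE b (hist z)) - (lamE s0)\<^sup>2 * J s0 * F2 n (freq (hist z))) else 0)"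

definition potH :: "nat \<Rightarrow> nat \<Rightarrow> real \<Rightarrow> (hh_record list \<times> nat, nat \<Rightarrow> real option) abstract_state \<Rightarrow> real" where
  "potH s0 i b z = (let tr = fst (knowledge z) in if phase tr \<le> s0 then
     exp (b * lamH s0 * (freq_est i tr - refH s0 i b (hist z))
       - (lamH s0)\<^sup>2 * V s0 * harms k (counts (hist z) i)) else 0)"

text \<open>A report takes at most \<open>1 + 4 * C * k + k \<le> 6 * C * k\<close> events, so it
  adds at most 1 to the first term of the exponent. The growth of \<open>F\<^sub>2\<close> pays for
  the expected cost.\<close>

definition cpot :: "(hh_record list \<times> nat, nat \<Rightarrow> real option) abstract_state \<Rightarrow> real" where
  "cpot z = exp ((real (events z) - snd (knowledge z)) / (6 * C * k)
     - 2 * F2 n (freq (hist z)) / 2 ^ phase (fst (knowledge z)))"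

lemma J_pos: "0 < J s" and lamE_pos: "0 < lamE s" and lamH_pos: "0 < lamH s" and V_pos: "0 < V s"
  using B_pos C_ge L eps k by (auto simp: J_def lamE_def lamH_def V_def)

section \<open>One step of the heavy hitters protocol from a good state\<close>

context
  fixes z :: "(hh_record list \<times> nat, nat \<Rightarrow> real option) abstract_state"
    and u :: "nat \<times> nat" and tr :: "hh_record list" and c0 :: nat
  assumes good: "good z" and valid: "valid_history k n (hist z)" "length (hist z) < m"
    and u: "u \<in> {..<k} \<times> {..<n}" and q: "knowledge z = (tr, c0)"
begin

definition y :: "nat \<Rightarrow> nat" where "y l = count_list (arrival (hist z) u l) (snd u)"
definition x :: nat where "x = y (fst u)"
definition f :: nat where "f = (\<Sum>l<k. y l)"
definition M :: nat where "M = overlap k x y"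
definition g :: real where "g = weight (phase tr) x f M"
definition K :: "(nat \<times> nat) list \<Rightarrow> nat" where "K aux = length (filter (\<lambda>(l, v). v < y l) aux)"
definition D :: "(nat \<times> nat) list pmf" where "D = replicate_pmf (trials (phase tr) x) (trial_pmf x)"

abbreviation "s \<equiv> phase tr"
abbreviation "snoc_hist w \<equiv> hist z @ [(u, w)]"

lemma y_counts: "counts (snoc_hist w) (snd u) = y"
  by (rule ext) (simp add: counts_def y_def arrival_snoc)

lemma y_upd: "y = (counts (hist z) (snd u))(fst u := Suc (counts (hist z) (snd u) (fst u)))"
  using y_counts[of undefined] by (simp add: counts_snoc)

lemma x_eq: "x = Suc (counts (hist z) (snd u) (fst u))"
  by (simp add: x_def y_upd)

lemma f_freq: "freq (snoc_hist w) (snd u) = f"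
  using freq_counts[of k n "snoc_hist w" "snd u"] valid u
  by (simp add: valid_history_snoc y_counts f_def)

lemma x_le_f: "x \<le> f"
  using u unfolding x_def f_def by (intro member_le_sum) auto

lemma M_le_f: "M \<le> f"
  unfolding M_def f_def by (rule overlap_le_sum)

lemma x_le_M: "x \<le> M"
proof -
  have "min x (y (fst u)) \<le> (\<Sum>l<k. min x (y l))" using u by (intro member_le_sum) auto
  then show ?thesis by (simp add: M_def overlap_def x_def)
qed

lemma F2_step: "F2 n (freq (snoc_hist w)) = F2 n (freq (hist z)) + real (2 * f - 1)"
  using F2_snoc[of u n "hist z" w] u by (simp add: f_freq mem_Times_iff)

text \<open>Before the update \<open>x - 1 \<le> F\<^sub>2\<close>, and in a good state
  \<open>F\<^sub>2\<close> is at most \<open>5 / 2 * 2 ^ s\<close>. So the cap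
  \<open>4 * C * k\<close>, which bounds the plan in arbitrary states, leaves the number of trials
  unchanged here.\<close>

lemma load_le: "load s x \<le> 7 / 2 * C * k"
proof -
  have "real x - 1 \<le> F2 n (freq (hist z))"
  proof -
    have "counts (hist z) (snd u) (fst u) \<le> freq (hist z) (snd u)"
      unfolding freq_counts[OF valid(1)] using u by (intro member_le_sum) auto
    then show ?thesis using freq_le_F2[of "snd u" n "hist z"] u by (simp add: x_eq mem_Times_iff)
  qed
  also have "\<dots> \<le> 5 / 2 * 2 ^ s" by (rule good_F2[OF good q])
  finally have "real x - 1 \<le> 5 / 2 * 2 ^ s" .
  moreover have "(1 :: real) \<le> 2 ^ s" by simp
  ultimately have "real x \<le> 7 / 2 * 2 ^ s" by linarith
  then have "C * k * real x \<le> C * k * (7 / 2 * 2 ^ s)" by (intro mult_left_mono) auto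
  then show ?thesis by (simp add: load_def divide_le_eq mult_ac)
qed

lemma x_pos: "0 < x" by (simp add: x_eq)

lemma trials_eq: "trials s x = nat \<lceil>load s x\<rceil>"
proof -
  have "2 * 1 \<le> C * k" using C_ge k by (intro mult_le_mono) auto
  then have "2 \<le> real (C * k)" by (metis of_nat_le_iff of_nat_numeral mult_1_right)
  then have "load s x + 1 \<le> real (4 * C * k)" using load_le by simp
  then show ?thesis unfolding trials_def by linarith
qed

lemma trials_props:
  "sampling s x = 1 \<or> trials s x = 1" "load s x \<le> sampling s x * trials s x"
  "sampling s x * trials s x \<le> 2 * load s x" "sampling s x * (1 + trials s x) \<le> 3 * load s x"
  "trials s x \<le> 4 * C * k"
proof -
  have l: "0 < load s x" using load_pos[OF x_pos] .
  show "trials s x \<le> 4 * C * k" by (simp add: trials_def)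
  have "(sampling s x = 1 \<or> trials s x = 1) \<and> load s x \<le> sampling s x * trials s x \<and>
    sampling s x * trials s x \<le> 2 * load s x \<and> sampling s x * (1 + trials s x) \<le> 3 * load s x"
  proof (cases "1 \<le> load s x")
    case True
    have "real (trials s x) \<le> load s x + 1" "load s x \<le> trials s x" using l unfolding trials_eq by linarith+
    then show ?thesis using True by (simp add: sampling_def)
  next
    case False
    have "trials s x = 1" using False l unfolding trials_eq by linarith
    then show ?thesis using False l by (simp add: sampling_def)
  qed
  then show "sampling s x = 1 \<or> trials s x = 1" "load s x \<le> sampling s x * trials s x"
    "sampling s x * trials s x \<le> 2 * load s x" "sampling s x * (1 + trials s x) \<le> 3 * load s x" by auto
qed

lemma report_prob_eq: "report_prob z u = sampling s x"
  using good_alive[OF good]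
  by (simp add: report_prob_def q hh_phase_def hh_rate_def arrival_def x_def y_def)

lemma rep_eq: "hh_rep (arrival (hist z) u (fst u)) = prod_encode (snd u, x)"
  by (simp add: hh_rep_def arrival_def x_def y_def)

lemma draw_eq: "hh_draw (knowledge z) (fst u) (hh_rep (arrival (hist z) u (fst u))) = D"
  by (simp add: hh_draw_def rep_eq q D_def Let_def)

lemma finite_D: "finite (set_pmf D)"
  by (simp add: D_def finite_replicate_pmf finite_trial)

lemma aux_props: "aux \<in> set_pmf D \<Longrightarrow> length aux = trials s x \<and> fst ` set aux \<subseteq> {..<k}"
proof -
  assume "aux \<in> set_pmf D"
  then have a: "length aux = trials s x" "set aux \<subseteq> set_pmf (trial_pmf x)"
    by (auto simp: D_def set_replicate_pmf)
  have "{..<k} \<times> {..<max 1 x} \<noteq> {}" using k by (auto simp: lessThan_empty_iff)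
  then have "set_pmf (trial_pmf x) = {..<k} \<times> {..<max 1 x}" by (simp add: trial_pmf_def)
  then show ?thesis using a by auto
qed

lemma answers_eq:
  assumes "aux \<in> set_pmf D"
  shows "answers z u aux = map y (map fst aux) @ (if K aux = 0 then [] else map y [0..<k])"
proof -
  have a: "length aux \<le> 4 * C * k" "\<And>l. l \<in> set (map fst aux) \<Longrightarrow> l < k"
    using aux_props[OF assms] trials_props(5) by auto
  have p: "hh_plan (knowledge z) (fst u) v aux = map fst aux @ [0..<k]" for v
    using a by (simp add: hh_plan_def filter_id_conv del: set_map)
  have fn: "(\<lambda>l. hh_ans (hh_qry (prod_encode (snd u, x))) (arrival (hist z) u l)) = y"
    by (simp add: hh_ans_def hh_qry_def y_def[abs_def])
  show ?thesis
    unfolding answers_def Let_def rep_eq p fn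
    by (subst ask_staged[where T = "length aux"])
      (use successes_map[of aux y "[]"] in \<open>auto simp: hh_stop_def Let_def K_def\<close>)
qed

lemma successes_K: "successes aux (map (\<lambda>x. y (fst x)) aux @ bs) = K aux"
  using successes_map[of aux y bs] by (simp add: K_def o_def)

lemma record_eq:
  assumes "aux \<in> set_pmf D"
  shows "hh_record s (prod_encode (snd u, x)) aux (answers z u aux)
    = (snd u, x, s, K aux, if K aux = 0 then 0 else f, if K aux = 0 then 0 else M)"
  unfolding answers_eq[OF assms] hh_record_def
  using successes_K[of aux "[]"] successes_K[of aux "map y [0..<k]"]
  by (auto simp: f_def M_def overlap_def interv_sum_list_conv_sum_set_nat
      lessThan_atLeast0 o_def)

definition new_trace :: "(nat \<times> nat) list \<Rightarrow> hh_record list" where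
  "new_trace aux = (snd u, x, s, K aux, if K aux = 0 then 0 else f, if K aux = 0 then 0 else M) # tr"

lemma reported_props:
  assumes "aux \<in> set_pmf D"
  shows "fst (knowledge (reported z u aux)) = new_trace aux"
    and "phase (new_trace aux) = s \<Longrightarrow> snd (knowledge (reported z u aux)) = c0 \<and>
      events (reported z u aux) = events z + 1 + length (answers z u aux)"
    and "phase (new_trace aux) \<noteq> s \<Longrightarrow>
      snd (knowledge (reported z u aux)) = events z + 1 + length (answers z u aux) + k \<and>
      events (reported z u aux) = events z + 1 + length (answers z u aux) + k"
proof -
  define as where "as = answers z u aux"
  have r: "hh_record s (prod_encode (snd u, x)) aux as # tr = new_trace aux"
    unfolding as_def record_eq[OF assms] by (simp add: new_trace_def)
  note * = reported_def Let_def rep_eq as_def[symmetric] after_def q hh_upd_def fst_conv snd_conv r hh_phase_def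
  show "fst (knowledge (reported z u aux)) = new_trace aux"
    "phase (new_trace aux) = s \<Longrightarrow> snd (knowledge (reported z u aux)) = c0 \<and>
      events (reported z u aux) = events z + 1 + length (answers z u aux)"
    "phase (new_trace aux) \<noteq> s \<Longrightarrow>
      snd (knowledge (reported z u aux)) = events z + 1 + length (answers z u aux) + k \<and>
      events (reported z u aux) = events z + 1 + length (answers z u aux) + k"
    unfolding * by simp_all
qed

lemma length_answers: "aux \<in> set_pmf D \<Longrightarrow> length (answers z u aux) = trials s x + (if K aux = 0 then 0 else k)"
  using aux_props by (simp add: answers_eq)

lemma F2_est_new: "F2_est (new_trace aux) = F2_est tr + K aux * g"
  by (simp add: F2_est_def new_trace_def g_def)

lemma freq_est_new: "freq_est i (new_trace aux) = freq_est i tr +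
    (if i = snd u \<and> cutoff s \<le> x then 1 / sampling s x else 0)"
  by (auto simp: freq_est_def new_trace_def)

lemma phase_new: "s \<le> phase (new_trace aux)"
  unfolding new_trace_def by (rule phase_mono)

definition prb :: real where "prb = M / (k * x)"

lemma prb: "0 \<le> prb" "prb \<le> 1"
proof -
  have "real M \<le> real (k * x)" unfolding M_def using overlap_le_mult by (simp only: of_nat_le_iff)
  then show "0 \<le> prb" "prb \<le> 1" using k x_pos by (auto simp: prb_def divide_le_eq)
qed

lemma expectation_K: "measure_pmf.expectation D (\<lambda>aux. c ^ K aux) = (1 - prb + prb * c) ^ trials s x"
proof -
  have "max 1 x = x" using x_pos by simp
  then have "measure (measure_pmf (trial_pmf x)) {(l, v). v < y l} = prb"
    using success_prob[of k x y] k x_pos by (simp add: trial_pmf_def prb_def M_def)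
  then show ?thesis
    unfolding D_def K_def using expectation_power_successes[OF finite_trial, of "trials s x" x c "\<lambda>(l, v). v < y l"]
    by simp
qed

text \<open>Unbiasedness: the mean gain is exactly the increase of \<open>f\<^sup>2\<close> unless
  the overlap is too small. In the upper bound the overlap cancels, because
  \<open>2 * f - 1 \<le> 2 * B * M\<close> for updates that are not ignored.\<close>

lemma g_bounds: "0 \<le> g" "g \<le> J s"
  and g_mean: "sampling s x * trials s x * prb * g = (if real f \<le> B * M then real (2 * f - 1) else 0)"
proof -
  have w: "0 < sampling s x * trials s x" using trials_props(2) load_pos[OF x_pos, of s] by linarith
  have M: "0 < M" using x_le_M x_pos by linarith
  show "0 \<le> g" by (simp add: g_def weight_def sampling(2))
  show "sampling s x * trials s x * prb * g = (if real f \<le> B * M then real (2 * f - 1) else 0)"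
  proof -
    have "sampling s x \<noteq> 0" "trials s x \<noteq> 0" using w by (force simp: zero_less_mult_iff)+
    then show ?thesis using M k x_pos by (simp add: g_def weight_def prb_def)
  qed
  show "g \<le> J s"
  proof (cases "real f \<le> B * M")
    case False
    then show ?thesis using J_pos[of s] by (simp add: g_def weight_def)
  next
    case True
    have "g = real (2 * f - 1) * (k * x) / (sampling s x * trials s x * M)"
      using True by (simp add: g_def weight_def)
    also have "\<dots> \<le> (2 * (B * M)) * (k * x) / (load s x * M)"
    proof (intro frac_le mult_right_mono)
      show "real (2 * f - 1) \<le> 2 * (B * M)" using True by linarith
      show "load s x \<le> sampling s x * real (trials s x)" by (rule trials_props)
    qed (use B_pos M load_pos[OF x_pos, of s] in auto)
    also have "\<dots> = J s"
      using M k x_pos C_ge by (simp add: J_def load_def field_simps)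
    finally show ?thesis .
  qed
qed

text \<open>Freedman's argument: the gain has mean \<open>\<Delta>\<close>, and the second-order
  term \<open>g * \<Delta>\<close> is at most \<open>J s0\<close> times the increase of
  \<open>F\<^sub>2\<close>, which the compensator absorbs.\<close>

lemma potE_drift:
  assumes b: "b = 1 \<or> b = -1"
  shows "measure_pmf.expectation (astep z u) (potE s0 b) \<le> potE s0 b z"
proof -
  let ?q = "sampling s x"
  note sb = sampling(2,3)[of s x]
  have ex: "measure_pmf.expectation (astep z u) (potE s0 b) =
      ?q * measure_pmf.expectation D (\<lambda>aux. potE s0 b (reported z u aux)) + (1 - ?q) * potE s0 b (silent z u)"
    by (subst expectation_astep) (use sb in \<open>simp_all add: report_prob_eq draw_eq\<close>)
  show ?thesis
  proof (cases "s \<le> s0")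
    case False
    have "measure_pmf.expectation D (\<lambda>aux. potE s0 b (reported z u aux)) \<le> measure_pmf.expectation D (\<lambda>aux. 0)"
    proof (intro expectation_mono_finite finite_D)
      fix aux assume a: "aux \<in> set_pmf D"
      then show "potE s0 b (reported z u aux) \<le> 0"
        using False phase_new[of aux] by (simp add: potE_def reported_props Let_def)
    qed
    then have "?q * measure_pmf.expectation D (\<lambda>aux. potE s0 b (reported z u aux)) \<le> 0"
      using sb by (simp add: mult_nonneg_nonpos)
    moreover have "potE s0 b (silent z u) = 0" "potE s0 b z = 0" using False by (auto simp: potE_def q)
    ultimately show ?thesis unfolding ex by simp
  next
    case s0: True
    define l where "l = lamE s0"
    define R where "R w = refE b (snoc_hist w) - refE b (hist z)" for w
    define \<Delta> where "\<Delta> = (if real f \<le> B * M then real (2 * f - 1) else 0)"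
    \<comment> \<open>The references depend on the updates only, so any output, such as
      \<open>undefined\<close>, can stand in for the one that is appended.\<close>
    have R: "R w = R undefined" for w
      by (simp add: R_def refE_def F2_def F2_low_def freq_snoc counts_snoc)
    define \<omega> where "\<omega> = exp (- (b * l * R undefined) - l\<^sup>2 * J s0 * real (2 * f - 1))"
    have l: "0 < l" by (simp add: l_def lamE_pos)
    have bR: "b * \<Delta> \<le> b * R undefined"
    proof -
      have "R undefined \<le> \<Delta>" if "b = -1"
        using F2_low_snoc[OF valid u B_pos, of undefined, unfolded y_counts f_freq] that
        by (simp add: R_def refE_def \<Delta>_def M_def x_def)
      moreover have "\<Delta> \<le> R undefined" if "b = 1"
        using that by (simp add: R_def refE_def \<Delta>_def F2_step)
      ultimately show ?thesis using b by auto
    qed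
    have z0: "potE s0 b z = exp (b * l * (F2_est tr - refE b (hist z)) - l\<^sup>2 * J s0 * F2 n (freq (hist z)))"
      using s0 by (simp add: potE_def q l_def)
    have z1: "potE s0 b (silent z u) = potE s0 b z * \<omega>"
    proof -
      have "potE s0 b (silent z u) = exp (b * l * (F2_est tr - (refE b (hist z) + R (hh_out (tr, c0))))
          - l\<^sup>2 * J s0 * (F2 n (freq (hist z)) + real (2 * f - 1)))"
        using s0 by (simp add: potE_def q l_def R_def F2_step)
      also have "\<dots> = potE s0 b z * \<omega>"
        unfolding z0 \<omega>_def R[of "hh_out (tr, c0)"] exp_add[symmetric] by (simp add: algebra_simps)
      finally show ?thesis .
    qed
    have z2: "potE s0 b (reported z u aux) \<le> potE s0 b z * \<omega> * exp (b * l * g) ^ K aux" if a: "aux \<in> set_pmf D" for aux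
    proof (cases "phase (new_trace aux) \<le> s0")
      case False
      then show ?thesis using a by (simp add: potE_def reported_props Let_def \<omega>_def)
    next
      case True
      let ?w = "hh_out (knowledge (reported z u aux))"
      have "potE s0 b (reported z u aux) = exp (b * l * (F2_est tr + K aux * g - (refE b (hist z) + R ?w))
          - l\<^sup>2 * J s0 * (F2 n (freq (hist z)) + real (2 * f - 1)))"
        using True a by (simp add: potE_def reported_props Let_def l_def R_def F2_step F2_est_new)
      also have "\<dots> = potE s0 b z * \<omega> * exp (b * l * g) ^ K aux"
        unfolding z0 \<omega>_def R[of ?w] exp_of_nat_mult[symmetric] exp_add[symmetric] by (simp add: algebra_simps)
      finally show ?thesis by simp
    qed
    have "measure_pmf.expectation D (\<lambda>aux. potE s0 b (reported z u aux))
        \<le> measure_pmf.expectation D (\<lambda>aux. potE s0 b z * \<omega> * exp (b * l * g) ^ K aux)"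
      by (intro expectation_mono_finite finite_D z2)
    also have "\<dots> = potE s0 b z * \<omega> * (1 - prb + prb * exp (b * l * g)) ^ trials s x"
      by (simp add: expectation_K)
    finally have "measure_pmf.expectation (astep z u) (potE s0 b)
        \<le> ?q * (potE s0 b z * \<omega> * (1 - prb + prb * exp (b * l * g)) ^ trials s x) + (1 - ?q) * (potE s0 b z * \<omega>)"
      unfolding ex z1 using sb by (intro add_right_mono mult_left_mono) auto
    also have "\<dots> = potE s0 b z * \<omega> * (?q * (1 - prb + prb * exp (b * l * g)) ^ trials s x + (1 - ?q))"
      by (simp add: algebra_simps)
    also have "\<dots> \<le> potE s0 b z * \<omega> * exp (?q * trials s x * prb * (b * l * g + (b * l * g)\<^sup>2))"
    proof (intro mult_left_mono trial_mgf)
      have "J s \<le> J s0" using s0 B_pos unfolding J_def by (intro divide_right_mono mult_left_mono power_increasing) auto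
      then have gJ: "g \<le> J s0" using g_bounds by linarith
      then have "l * g \<le> l * J s0" using l by (intro mult_left_mono) auto
      also have "\<dots> \<le> 1" using J_pos[of s0] by (simp add: l_def lamE_def)
      finally show "\<bar>b * l * g\<bar> \<le> 1" using b l g_bounds(1) by (auto simp: abs_mult)
    qed (use sb prb trials_props(1) in \<open>auto simp: z0 \<omega>_def\<close>)
    also have "?q * trials s x * prb * (b * l * g + (b * l * g)\<^sup>2) = b * l * \<Delta> + l\<^sup>2 * (g * \<Delta>)"
    proof -
      have "?q * trials s x * prb * (b * l * g + (b * l * g)\<^sup>2)
          = (b * l + b\<^sup>2 * l\<^sup>2 * g) * (?q * trials s x * prb * g)"
        by (simp add: algebra_simps power2_eq_square)
      also have "\<dots> = (b * l + b\<^sup>2 * l\<^sup>2 * g) * \<Delta>" unfolding g_mean \<Delta>_def ..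
      finally show ?thesis using b by (auto simp: algebra_simps)
    qed
    also have "potE s0 b z * \<omega> * exp (b * l * \<Delta> + l\<^sup>2 * (g * \<Delta>)) \<le> potE s0 b z"
    proof -
      have "J s \<le> J s0" using s0 B_pos unfolding J_def by (intro divide_right_mono mult_left_mono power_increasing) auto
      then have "g * \<Delta> \<le> J s0 * real (2 * f - 1)"
        using g_bounds J_pos[of s0] by (intro mult_mono) (auto simp: \<Delta>_def)
      then have "l\<^sup>2 * (g * \<Delta>) \<le> l\<^sup>2 * (J s0 * real (2 * f - 1))" by (intro mult_left_mono) auto
      moreover have "l * (b * \<Delta>) \<le> l * (b * R undefined)" using mult_left_mono[OF bR, of l] l by simp
      ultimately have "- (b * l * R undefined) - l\<^sup>2 * J s0 * real (2 * f - 1) + (b * l * \<Delta> + l\<^sup>2 * (g * \<Delta>)) \<le> 0"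
        by (simp only: mult_ac)
      then have "\<omega> * exp (b * l * \<Delta> + l\<^sup>2 * (g * \<Delta>)) \<le> 1"
        unfolding \<omega>_def by (simp only: exp_add[symmetric] exp_le_one_iff)
      then show ?thesis by (simp add: z0 mult.assoc)
    qed
    finally show ?thesis .
  qed
qed

text \<open>An ignored update moves the references only in favourable directions, and one reported
  with certainty is counted exactly. Otherwise the cutoff makes \<open>lamH s0\<close> at most the
  sampling probability.\<close>

lemma potH_drift:
  assumes b: "b = 1 \<or> b = -1"
  shows "measure_pmf.expectation (astep z u) (potH s0 i b) \<le> potH s0 i b z"
proof -
  let ?q = "sampling s x"
  note sb = sampling(2,3)[of s x]
  have q0: "0 < ?q" by (rule sampling(1)[OF x_pos])
  have ex: "measure_pmf.expectation (astep z u) (potH s0 i b) =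
      ?q * measure_pmf.expectation D (\<lambda>aux. potH s0 i b (reported z u aux)) + (1 - ?q) * potH s0 i b (silent z u)"
    by (subst expectation_astep) (use sb in \<open>simp_all add: report_prob_eq draw_eq\<close>)
  define l where "l = lamH s0"
  have l: "0 < l" by (simp add: l_def lamH_pos)
  define r where "r = (if i = snd u \<and> cutoff s \<le> x then 1 / ?q else 0)"
  define R where "R w = refH s0 i b (snoc_hist w) - refH s0 i b (hist z)" for w
  have R: "R w = R undefined" for w
    by (simp add: R_def refH_def freq_snoc counts_snoc)
  define h where "h = (if i = snd u then 1 / real x else 0)"
  have hs: "harms k (counts (snoc_hist w) i) = harms k (counts (hist z) i) + h" for w
    using harms_Suc[of "fst u" k "counts (hist z) i"] u by (auto simp: counts_snoc h_def x_eq)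
  define \<omega> where "\<omega> = exp (- (b * l * R undefined) - l\<^sup>2 * V s0 * h)"
  define P where "P = potH s0 i b z"
  show ?thesis
  proof (cases "s \<le> s0")
    case False
    have "measure_pmf.expectation D (\<lambda>aux. potH s0 i b (reported z u aux)) \<le> measure_pmf.expectation D (\<lambda>aux. 0)"
    proof (intro expectation_mono_finite finite_D)
      fix aux assume a: "aux \<in> set_pmf D"
      then show "potH s0 i b (reported z u aux) \<le> 0"
        using False phase_new[of aux] by (simp add: potH_def reported_props Let_def)
    qed
    then have "?q * measure_pmf.expectation D (\<lambda>aux. potH s0 i b (reported z u aux)) \<le> 0"
      using sb by (simp add: mult_nonneg_nonpos)
    moreover have "potH s0 i b (silent z u) = 0" "potH s0 i b z = 0" using False by (auto simp: potH_def q)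
    ultimately show ?thesis unfolding ex by simp
  next
    case s0: True
    have P: "P = exp (b * l * (freq_est i tr - refH s0 i b (hist z)) - l\<^sup>2 * V s0 * harms k (counts (hist z) i))"
      using s0 by (simp add: P_def potH_def q l_def)
    have z1: "potH s0 i b (silent z u) = P * \<omega>"
    proof -
      have "potH s0 i b (silent z u) = exp (b * l * (freq_est i tr - (refH s0 i b (hist z) + R (hh_out (tr, c0))))
          - l\<^sup>2 * V s0 * (harms k (counts (hist z) i) + h))"
        using s0 by (simp add: potH_def q l_def R_def hs)
      also have "\<dots> = P * \<omega>"
        unfolding P \<omega>_def R[of "hh_out (tr, c0)"] exp_add[symmetric] by (simp add: algebra_simps)
      finally show ?thesis .
    qed
    have z2: "potH s0 i b (reported z u aux) \<le> P * \<omega> * exp (b * l * r)" if a: "aux \<in> set_pmf D" for aux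
    proof (cases "phase (new_trace aux) \<le> s0")
      case False
      then show ?thesis using a by (simp add: potH_def reported_props Let_def \<omega>_def P)
    next
      case True
      let ?w = "hh_out (knowledge (reported z u aux))"
      have "potH s0 i b (reported z u aux) = exp (b * l * (freq_est i tr + r - (refH s0 i b (hist z) + R ?w))
          - l\<^sup>2 * V s0 * (harms k (counts (hist z) i) + h))"
        using True a by (simp add: potH_def reported_props Let_def l_def R_def hs freq_est_new r_def)
      also have "\<dots> = P * \<omega> * exp (b * l * r)"
        unfolding P \<omega>_def R[of ?w] exp_add[symmetric] by (simp add: algebra_simps)
      finally show ?thesis by simp
    qed
    have "measure_pmf.expectation D (\<lambda>aux. potH s0 i b (reported z u aux))
        \<le> measure_pmf.expectation D (\<lambda>aux. P * \<omega> * exp (b * l * r))"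
      by (intro expectation_mono_finite finite_D z2)
    also have "\<dots> = P * \<omega> * exp (b * l * r)" by simp
    finally have "measure_pmf.expectation (astep z u) (potH s0 i b)
        \<le> ?q * (P * \<omega> * exp (b * l * r)) + (1 - ?q) * (P * \<omega>)"
      unfolding ex z1 using sb by (intro add_right_mono mult_left_mono) auto
    also have "\<dots> = P * (\<omega> * (?q * exp (b * l * r) + (1 - ?q)))"
      by (simp add: algebra_simps)
    also have "\<omega> * (?q * exp (b * l * r) + (1 - ?q)) \<le> 1"
    proof (cases "i = snd u \<and> cutoff s \<le> x")
      case False
      then have r0: "r = 0" by (auto simp: r_def)
      have "0 \<le> b * R undefined"
      proof (cases "i = snd u")
        case True
        then have "real x < cutoff s" using False by auto
        also have "\<dots> \<le> cutoff s0"
          using s0 eps k unfolding cutoff_def by (intro divide_right_mono mult_left_mono real_sqrt_le_mono power_increasing) auto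
        finally have "real x < cutoff s0" .
        then show ?thesis
          using b u True excess_Suc[of "fst u" k "cutoff s0" "counts (hist z) i"]
          by (auto simp: R_def refH_def freq_snoc counts_snoc x_eq)
      qed (simp add: R_def refH_def freq_snoc counts_snoc)
      then have "0 \<le> l * (b * R undefined)" using l by simp
      moreover have "0 \<le> l\<^sup>2 * V s0 * h" using V_pos[of s0] by (simp add: h_def)
      ultimately have "\<omega> \<le> 1" unfolding \<omega>_def by (simp add: mult_ac)
      then show ?thesis by (simp add: r0)
    next
      case True
      then have i: "i = snd u" and co: "cutoff s \<le> x" by auto
      have r: "r = 1 / ?q" using True by (simp add: r_def)
      have bR: "b \<le> b * R undefined"
        using b u excess_Suc[of "fst u" k "cutoff s0" "counts (hist z) i"]
        by (auto simp: R_def refH_def freq_snoc counts_snoc i split: if_splits)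
      have "?q * exp (b * l * r) + (1 - ?q) \<le> exp (b * l + l\<^sup>2 * V s0 * h)"
      proof (cases "?q = 1")
        case True
        have "0 \<le> l\<^sup>2 * V s0 * h" using V_pos[of s0] by (simp add: h_def)
        then show ?thesis using True by (simp add: r)
      next
        case False
        then have ql: "?q = load s x" unfolding sampling_def by linarith
        have sq: "sqrt (2 ^ s) \<le> sqrt (2 ^ s0)" using s0 by (intro real_sqrt_le_mono power_increasing) auto
        \<comment> \<open>At the cutoff the load is proportional to
          \<open>C * \<epsilon> / sqrt (2 ^ s)\<close>, and \<open>lamH s\<close> to
          \<open>L / (\<epsilon> * sqrt (2 ^ s))\<close>, so a bound on \<open>C\<close> of order
          \<open>L / \<epsilon>\<^sup>2\<close> suffices in every phase.\<close>
        have lq: "l \<le> ?q"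
        proof -
          have "l \<le> 40 * L / (\<epsilon> * sqrt (2 ^ s))"
            unfolding l_def lamH_def using sq eps L by (intro divide_left_mono mult_left_mono) auto
          also have "\<dots> = (800 * L / \<epsilon>\<^sup>2) * (\<epsilon> / (20 * sqrt (2 ^ s)))"
            using eps by (simp add: power2_eq_square)
          also have "\<dots> \<le> C * (\<epsilon> / (20 * sqrt (2 ^ s)))"
          proof (intro mult_right_mono)
            have "800 * L / \<epsilon>\<^sup>2 \<le> 1600 * L * H / \<epsilon>\<^sup>2"
              using L H by (intro divide_right_mono) (auto intro: mult_mono)
            then show "800 * L / \<epsilon>\<^sup>2 \<le> C" using C2 by linarith
          qed (use eps in auto)
          also have "\<dots> = C * k * cutoff s / 2 ^ s"
          proof -
            have "sqrt (2 ^ s) / 2 ^ s = 1 / sqrt (2 ^ s)"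
              by (simp add: real_sqrt_divide[symmetric] field_simps)
            then show ?thesis using k by (simp add: cutoff_def field_simps)
          qed
          also have "\<dots> \<le> load s x"
            unfolding load_def using mult_left_mono[OF co, of "real C * real k"] by (simp add: divide_right_mono)
          finally show ?thesis unfolding ql .
        qed
        have "?q * exp (b * l * r) + (1 - ?q)
            = exp (b * l) * (?q * exp (b * l * (1 / ?q - 1)) + (1 - ?q) * exp (- (b * l)))"
          by (simp add: r exp_diff exp_minus algebra_simps)
        also have "\<dots> \<le> exp (b * l) * exp ((b * l)\<^sup>2 * (1 / ?q - 1))"
          using q0 sb lq l b by (intro mult_left_mono bernoulli_mgf) (auto simp: abs_mult)
        also have "\<dots> \<le> exp (b * l + l\<^sup>2 * V s0 * h)"
        proof -
          have "1 / ?q - 1 \<le> 2 ^ s / (C * k * x)" unfolding ql load_def by simp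
          also have "\<dots> \<le> 2 ^ s0 / (C * k * x)" using s0 by (intro divide_right_mono power_increasing) auto
          also have "\<dots> = V s0 * h" by (simp add: V_def h_def i)
          finally have "l\<^sup>2 * (1 / ?q - 1) \<le> l\<^sup>2 * (V s0 * h)" by (intro mult_left_mono) auto
          moreover have "(b * l)\<^sup>2 = l\<^sup>2" using b by auto
          ultimately show ?thesis by (simp add: exp_add[symmetric] mult.assoc)
        qed
        finally show ?thesis .
      qed
      then have "\<omega> * (?q * exp (b * l * r) + (1 - ?q)) \<le> \<omega> * exp (b * l + l\<^sup>2 * V s0 * h)"
        by (intro mult_left_mono) (auto simp: \<omega>_def)
      also have "\<dots> \<le> 1"
      proof -
        have "l * b \<le> l * (b * R undefined)" using bR l by (intro mult_left_mono) auto
        then have "- (b * l * R undefined) - l\<^sup>2 * V s0 * h + (b * l + l\<^sup>2 * V s0 * h) \<le> 0"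
          by (simp only: mult_ac)
        then show ?thesis unfolding \<omega>_def by (simp only: exp_add[symmetric] exp_le_one_iff)
      qed
      finally show ?thesis .
    qed
    then have "P * (\<omega> * (?q * exp (b * l * r) + (1 - ?q))) \<le> P" by (intro mult_left_le) (simp_all add: P)
    finally show ?thesis unfolding P_def .
  qed
qed

text \<open>Within a phase, the expected number of events is at most
  \<open>5 * C * k * f / 2 ^ s\<close>: 3 for reports and trials, 2 for full collections. Against it
  stands the increase of \<open>F\<^sub>2\<close> by \<open>2 * f - 1 \<ge> f\<close>.\<close>

lemma cpot_drift: "measure_pmf.expectation (astep z u) cpot \<le> cpot z + 1"
proof -
  let ?q = "sampling s x"
  note sb = sampling(2,3)[of s x]
  have ex: "measure_pmf.expectation (astep z u) cpot =
      ?q * measure_pmf.expectation D (\<lambda>aux. cpot (reported z u aux)) + (1 - ?q) * cpot (silent z u)"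
    by (subst expectation_astep) (use sb in \<open>simp_all add: report_prob_eq draw_eq\<close>)
  define P where "P = cpot z"
  have P: "0 < P" by (simp add: P_def cpot_def)
  define \<omega> where "\<omega> = exp (- (2 * real (2 * f - 1) / 2 ^ s))"
  define Y where "Y aux = (1 + real (length (answers z u aux))) / (6 * C * k)" for aux
  have Ck: "2 \<le> real (C * k)"
  proof -
    have "2 * 1 \<le> C * k" using C_ge k by (intro mult_le_mono) auto
    then show ?thesis by (metis of_nat_le_iff of_nat_numeral mult_1_right)
  qed
  have kC: "real k \<le> real (C * k)" using C_ge by (simp only: of_nat_le_iff) simp
  have lenreal: "real (length (answers z u aux)) = trials s x + (if K aux = 0 then 0 else real k)"
    if "aux \<in> set_pmf D" for aux
    using length_answers[OF that] by simp
  have Y: "0 \<le> Y aux" "Y aux \<le> 1" if "aux \<in> set_pmf D" for aux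
  proof -
    have "real (trials s x) \<le> real (4 * C * k)" using trials_props(5) by (simp only: of_nat_le_iff)
    then have "1 + real (length (answers z u aux)) \<le> 6 * real (C * k)"
      using lenreal[OF that] Ck kC by simp
    then show "Y aux \<le> 1" using Ck by (simp add: Y_def divide_le_eq)
  qed (simp add: Y_def)
  have z1: "cpot (silent z u) = P * \<omega>"
    unfolding P_def \<omega>_def cpot_def exp_add[symmetric]
    by (simp add: q F2_step add_divide_distrib algebra_simps)
  have z2: "cpot (reported z u aux) \<le> P * \<omega> * (1 + 2 * Y aux) + 1" if a: "aux \<in> set_pmf D" for aux
  proof (cases "phase (new_trace aux) = s")
    case True
    have "cpot (reported z u aux) = P * \<omega> * exp (Y aux)"
      unfolding P_def \<omega>_def Y_def cpot_def exp_add[symmetric] using reported_props(1,2)[OF a] True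
      by (simp add: q F2_step add_divide_distrib diff_divide_distrib algebra_simps)
    also have "\<dots> \<le> P * \<omega> * (1 + 2 * Y aux)"
      using exp_le_linear[OF Y[OF a]] P by (intro mult_left_mono) (auto simp: \<omega>_def)
    finally show ?thesis by simp
  next
    case False
    have "0 \<le> F2 n (freq (hist (reported z u aux)))" unfolding F2_def by (intro sum_nonneg) auto
    then have "0 \<le> 2 * F2 n (freq (hist (reported z u aux))) / 2 ^ phase (fst (knowledge (reported z u aux)))"
      by simp
    then have "cpot (reported z u aux) \<le> 1"
      unfolding cpot_def using reported_props(3)[OF a False] by (simp del: hist_reported)
    moreover have "0 \<le> P * \<omega> * (1 + 2 * Y aux)" using P Y[OF a] by (simp add: \<omega>_def)
    ultimately show ?thesis by linarith
  qed
  have int: "integrable (measure_pmf D) F" for F :: "(nat \<times> nat) list \<Rightarrow> real"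
    by (rule integrable_measure_pmf_finite[OF finite_D])
  define e where "e = measure_pmf.expectation D Y"
  have "measure_pmf.expectation D (\<lambda>aux. cpot (reported z u aux))
      \<le> measure_pmf.expectation D (\<lambda>aux. P * \<omega> * (1 + 2 * Y aux) + 1)"
    by (intro expectation_mono_finite finite_D z2)
  also have "\<dots> = P * \<omega> * (1 + 2 * e) + 1"
    using int by (simp add: e_def)
  finally have "measure_pmf.expectation (astep z u) cpot \<le> ?q * (P * \<omega> * (1 + 2 * e) + 1) + (1 - ?q) * (P * \<omega>)"
    unfolding ex z1 using sb by (intro add_right_mono mult_left_mono) auto
  also have "\<dots> = P * (\<omega> * (1 + 2 * (?q * e))) + ?q"
    by (simp add: algebra_simps)
  finally have main: "measure_pmf.expectation (astep z u) cpot \<le> P * (\<omega> * (1 + 2 * (?q * e))) + ?q" .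
  have e: "e \<le> (1 + trials s x + k * (trials s x * prb)) / (6 * C * k)"
  proof -
    \<comment> \<open>\<open>0 ^ K aux\<close> is the indicator of no success, so its expectation is
      the generating function at 0.\<close>
    have "e = measure_pmf.expectation D (\<lambda>aux. (1 + trials s x + real k * (1 - (0 :: real) ^ K aux)) / (6 * C * k))"
      unfolding e_def Y_def using lenreal
      by (intro integral_cong_AE) (auto simp: AE_measure_pmf_iff power_0_left)
    also have "\<dots> = (1 + trials s x + k * (1 - (1 - prb) ^ trials s x)) / (6 * C * k)"
      using int expectation_K[of 0] by (simp add: power_0_left)
    also have "\<dots> \<le> (1 + trials s x + k * (trials s x * prb)) / (6 * C * k)"
    proof (intro divide_right_mono add_left_mono mult_left_mono)
      show "1 - (1 - prb) ^ trials s x \<le> trials s x * prb"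
        using Bernoulli_inequality[of "- prb" "trials s x"] prb by simp
    qed auto
    finally show ?thesis .
  qed
  have qe: "?q * e \<le> real f / 2 ^ s"
  proof -
    have "?q * e \<le> ?q * ((1 + trials s x + k * (trials s x * prb)) / (6 * C * k))"
      using e sb by (intro mult_left_mono) auto
    also have "\<dots> = (?q * (1 + trials s x) + k * prb * (?q * trials s x)) / (6 * C * k)"
      by (simp add: algebra_simps)
    also have "\<dots> \<le> (3 * load s x + k * prb * (2 * load s x)) / (6 * C * k)"
      using trials_props(3,4) prb by (intro divide_right_mono add_mono mult_left_mono) auto
    also have "k * prb * (2 * load s x) = 2 * (C * k * M / 2 ^ s)"
      using k x_pos by (simp add: prb_def load_def)
    also have "\<dots> \<le> 2 * (C * k * f / 2 ^ s)"
      using M_le_f by (simp add: divide_right_mono mult_left_mono)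
    also have "3 * load s x \<le> 3 * (C * k * f / 2 ^ s)"
      unfolding load_def using x_le_f by (simp add: divide_right_mono mult_left_mono)
    finally have "?q * e \<le> (3 * (C * k * f / 2 ^ s) + 2 * (C * k * f / 2 ^ s)) / (6 * C * k)"
      by (simp add: divide_right_mono)
    also have "\<dots> = 5 / 6 * (real f / 2 ^ s)"
      using k C_ge by (simp add: field_simps)
    also have "\<dots> \<le> real f / 2 ^ s" by (simp add: field_simps)
    finally show ?thesis .
  qed
  have "1 + 2 * (?q * e) \<le> exp (2 * real (2 * f - 1) / 2 ^ s)"
  proof -
    have "real f \<le> real (2 * f - 1)" using x_le_f x_pos by simp
    then have "real f / 2 ^ s \<le> real (2 * f - 1) / 2 ^ s" by (intro divide_right_mono) auto
    then have "1 + 2 * (?q * e) \<le> 1 + 2 * real (2 * f - 1) / 2 ^ s" using qe by simp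
    then show ?thesis using exp_ge_add_one_self[of "2 * real (2 * f - 1) / 2 ^ s"] by linarith
  qed
  then have "\<omega> * (1 + 2 * (?q * e)) \<le> \<omega> * exp (2 * real (2 * f - 1) / 2 ^ s)"
    by (intro mult_left_mono) (auto simp: \<omega>_def)
  also have "\<dots> = 1" by (simp add: \<omega>_def exp_add[symmetric])
  finally have "P * (\<omega> * (1 + 2 * (?q * e))) \<le> P" using P by (intro mult_left_le) auto
  then show ?thesis using main sb unfolding P_def by linarith
qed

end

section \<open>Small potentials imply a good state\<close>

context
  fixes z :: "(hh_record list \<times> nat, nat \<Rightarrow> real option) abstract_state"
    and tr :: "hh_record list" and c0 :: nat and N :: real
  assumes v: "valid_history k n (hist z)" "length (hist z) \<le> m" "hist z \<noteq> []" and q: "knowledge z = (tr, c0)"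
    and csmall: "cpot z < exp L"
    and Esmall: "\<And>s0 b. s0 \<le> smax \<Longrightarrow> b = 1 \<or> b = -1 \<Longrightarrow> potE s0 b z < exp L"
    and Hsmall: "\<And>s0 i b. s0 \<le> smax \<Longrightarrow> i < n \<Longrightarrow> b = 1 \<or> b = -1 \<Longrightarrow> potH s0 i b z < exp L"
  defines "N \<equiv> F2 n (freq (hist z))"
begin

lemma N_ge_1: "1 \<le> N"
proof -
  obtain h e where he: "hist z = h @ [e]" using v(3) by (cases "hist z" rule: rev_cases) auto
  obtain u w where e: "e = (u, w)" by fastforce
  have "snd u < n" using v(1) by (auto simp: he e valid_history_def)
  moreover have "1 \<le> freq (hist z) (snd u)" by (simp add: he e freq_snoc)
  ultimately show ?thesis using freq_le_F2[of "snd u" n "hist z"] unfolding N_def by linarith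
qed

lemma phase_smax: "phase tr \<le> smax"
  by (simp add: phase_def)

text \<open>The tail error is relative to \<open>2 ^ phase tr\<close>, which is bounded by the
  estimate itself. Hence no relation between the phase and \<open>F\<^sub>2\<close> has to be known
  beforehand.\<close>

lemma F2_est_bounds: "87 / 100 * N \<le> F2_est tr" "F2_est tr \<le> 11 / 10 * N"
proof -
  let ?s = "phase tr" and ?E = "F2_est tr"
  let ?l = "lamE (phase tr)" and ?J = "J (phase tr)"
  have l: "0 < ?l" and J: "0 < ?J" using lamE_pos J_pos by auto
  have dev: "b * (?E - refE b (hist z)) \<le> max 1 ?E / 32 + N / 32" if b: "b = 1 \<or> b = -1" for b
  proof -
    have "b * ?l * (?E - refE b (hist z)) - ?l\<^sup>2 * ?J * N < L"
      using Esmall[OF phase_smax b] by (simp add: potE_def q N_def)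
    then have "?l * (b * (?E - refE b (hist z))) \<le> L + ?l\<^sup>2 * ?J * N" by (simp add: mult_ac)
    then have "?l * (b * (?E - refE b (hist z))) / ?l \<le> (L + ?l\<^sup>2 * ?J * N) / ?l"
      using l by (intro divide_right_mono) auto
    then have "b * (?E - refE b (hist z)) \<le> L / ?l + ?l * ?J * N"
      using l by (simp add: add_divide_distrib power2_eq_square)
    also have "?l * ?J * N = N / 32" using J by (simp add: lamE_def)
    also have "L / ?l = 64 * L * B / C * 2 ^ ?s" by (simp add: lamE_def J_def)
    also have "\<dots> \<le> 1 / 32 * 2 ^ ?s"
    proof (intro mult_right_mono)
      have "32 * (64 * L * B) \<le> C" using C1 by (simp add: B_def mult_ac)
      then show "64 * L * B / C \<le> 1 / 32" using C_ge by (simp add: divide_le_eq)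
    qed auto
    also have "\<dots> \<le> 1 / 32 * max 1 ?E" using phase_le[of tr] by simp
    finally show ?thesis by simp
  qed
  have up: "?E - N \<le> max 1 ?E / 32 + N / 32" using dev[of 1] by (simp add: refE_def N_def)
  have "refE (-1) (hist z) - ?E \<le> max 1 ?E / 32 + N / 32" using dev[of "-1"] by simp
  moreover have "31 / 32 * N \<le> refE (-1) (hist z)"
  proof -
    have "(harm m)\<^sup>2 \<le> H\<^sup>2" using H harm_nonneg[of m, where 'a = real] by (intro power_mono) auto
    then show ?thesis
      using F2_low_ge[OF v(1,2) B_pos, of ] by (simp add: refE_def N_def B_def)
  qed
  ultimately have low: "31 / 32 * N - ?E \<le> max 1 ?E / 32 + N / 32" by linarith
  show hi: "?E \<le> 11 / 10 * N" using up N_ge_1 by (cases "1 \<le> ?E") (simp_all add: max_def)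
  have "max 1 ?E \<le> 11 / 10 * N" using hi N_ge_1 by auto
  then show "87 / 100 * N \<le> ?E" using low N_ge_1 by linarith
qed

lemma phase_N: "2 ^ phase tr \<le> 11 / 10 * N"
  using phase_le[of tr] F2_est_bounds(2) N_ge_1 by linarith

lemma phase_less_smax: "phase tr < smax"
proof (rule ccontr)
  assume "\<not> phase tr < smax"
  then have "(2 :: real) ^ smax \<le> 11 / 10 * N" using phase_N phase_smax by simp
  also have "N \<le> (real (length (hist z)))\<^sup>2" unfolding N_def by (rule F2_le[OF v(1)])
  also have "\<dots> \<le> (real m)\<^sup>2" using v(2) by (intro power_mono) auto
  finally have "(2 :: real) ^ smax \<le> 11 / 10 * (real m)\<^sup>2" by simp
  then show False using smax zero_le_power2[of "real m"] by linarith
qed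

text \<open>Sampling and cutoff contribute at most \<open>\<epsilon> * sqrt (2 ^ s) / 20\<close>
  each; \<open>2 ^ s \<le> 11 / 10 * N\<close> turns the sum into
  \<open>\<epsilon> / 8 * sqrt N\<close>.\<close>

lemma freq_est_bounds:
  assumes i: "i < n"
  shows "\<bar>freq_est i tr - freq (hist z) i\<bar> \<le> \<epsilon> / 8 * sqrt N"
proof -
  let ?s = "phase tr" and ?l = "lamH (phase tr)" and ?h = "harms k (counts (hist z) i)"
  let ?r = "sqrt (2 ^ phase tr) :: real"
  have l: "0 < ?l" by (rule lamH_pos)
  have r: "0 < ?r" by simp
  have h: "?h \<le> k * H"
  proof -
    have "counts (hist z) i l \<le> m" if "l < k" for l
    proof -
      have "counts (hist z) i l \<le> (\<Sum>l<k. counts (hist z) i l)" using that by (intro member_le_sum) auto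
      then show ?thesis using freq_counts[OF v(1), of i] freq_le_length[of "hist z" i] v(2) by linarith
    qed
    then have "?h \<le> k * harm m" by (rule harms_le)
    also have "\<dots> \<le> k * H" using H by (intro mult_left_mono) auto
    finally show ?thesis .
  qed
  have dev: "b * (freq_est i tr - refH ?s i b (hist z)) \<le> \<epsilon> * ?r / 20" if b: "b = 1 \<or> b = -1" for b
  proof -
    have "b * ?l * (freq_est i tr - refH ?s i b (hist z)) - ?l\<^sup>2 * V ?s * ?h < L"
      using Hsmall[OF phase_smax i b] by (simp add: potH_def q)
    moreover have "?l\<^sup>2 * V ?s * ?h \<le> ?l\<^sup>2 * V ?s * (k * H)"
      using h V_pos[of ?s] by (intro mult_left_mono) auto
    ultimately have "?l * (b * (freq_est i tr - refH ?s i b (hist z))) \<le> L + ?l\<^sup>2 * V ?s * (k * H)"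
      by (simp add: mult_ac)
    then have "?l * (b * (freq_est i tr - refH ?s i b (hist z))) / ?l \<le> (L + ?l\<^sup>2 * V ?s * (k * H)) / ?l"
      using l by (intro divide_right_mono) auto
    then have "b * (freq_est i tr - refH ?s i b (hist z)) \<le> L / ?l + ?l * V ?s * (k * H)"
      using l by (simp add: add_divide_distrib power2_eq_square)
    also have "L / ?l = \<epsilon> * ?r / 40" using L by (simp add: lamH_def)
    also have "?l * V ?s * (k * H) = (1600 * L * H / \<epsilon>\<^sup>2) / C * (\<epsilon> * ?r / 40)"
    proof -
      define w where "w = ?r"
      have w: "0 < w" "?l = 40 * L / (\<epsilon> * w)" "V ?s = w * w / (C * k)"
        by (auto simp: w_def lamH_def V_def)
      show ?thesis unfolding w_def[symmetric] w(2,3)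
        using w(1) k eps C_ge by (simp add: power2_eq_square)
    qed
    also have "\<dots> \<le> 1 * (\<epsilon> * ?r / 40)"
      using C2 C_ge eps r by (intro mult_right_mono) (auto simp: divide_le_eq mult.commute)
    finally show ?thesis by simp
  qed
  have up: "freq_est i tr - freq (hist z) i \<le> \<epsilon> * ?r / 20" using dev[of 1] by (simp add: refH_def)
  have "refH ?s i (-1) (hist z) - freq_est i tr \<le> \<epsilon> * ?r / 20" using dev[of "-1"] by simp
  moreover have "real (freq (hist z) i) - \<epsilon> * ?r / 20 \<le> refH ?s i (-1) (hist z)"
    using excess_ge[of "counts (hist z) i" k "cutoff ?s"] freq_counts[OF v(1), of i] k
    by (simp add: refH_def cutoff_def)
  ultimately have "\<bar>freq_est i tr - freq (hist z) i\<bar> \<le> \<epsilon> * ?r / 10"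
    using up mult_pos_pos[OF eps(1) r] unfolding abs_le_iff by linarith
  also have "\<dots> \<le> \<epsilon> * (5 / 4 * sqrt N) / 10"
  proof (intro divide_right_mono mult_left_mono)
    have "?r \<le> sqrt ((5 / 4)\<^sup>2 * N)"
      using phase_N N_ge_1 by (intro real_sqrt_le_mono) (simp add: power2_eq_square)
    then show "?r \<le> 5 / 4 * sqrt N" by (simp add: real_sqrt_mult)
  qed (use eps in auto)
  finally show ?thesis by simp
qed

lemma events_bound: "events z \<le> c0 + phase_budget"
proof -
  have "(real (events z) - c0) / (6 * C * k) - 2 * N / 2 ^ phase tr < L"
    using csmall by (simp add: cpot_def q N_def)
  moreover have "N \<le> 5 / 2 * 2 ^ phase tr"
    using less_phase[OF phase_less_smax] F2_est_bounds(1) by simp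
  then have "2 * N / 2 ^ phase tr \<le> 5" by (simp add: divide_le_eq)
  ultimately have "(real (events z) - c0) / (6 * C * k) \<le> L + 5" by linarith
  then have "real (events z) - c0 \<le> 6 * C * k * (L + 5)"
    using k C_ge by (simp add: divide_le_eq mult_ac)
  then show ?thesis unfolding phase_budget_def by linarith
qed

lemma good_if_small: "c0 \<le> phase tr * (phase_budget + 8 * C * k) \<Longrightarrow> good z"
  using phase_less_smax F2_est_bounds freq_est_bounds events_bound
  by (simp add: good_def q Let_def N_def)

end

lemma good_preserved:
  assumes g: "good z" and v: "valid_history k n (hist z)" "length (hist z) < m" and u: "u \<in> {..<k} \<times> {..<n}"
    and z': "z' \<in> set_pmf (astep z u)" and csmall: "cpot z' < exp L"
    and Esmall: "\<And>s0 b. s0 \<le> smax \<Longrightarrow> b = 1 \<or> b = -1 \<Longrightarrow> potE s0 b z' < exp L"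
    and Hsmall: "\<And>s0 i b. s0 \<le> smax \<Longrightarrow> i < n \<Longrightarrow> b = 1 \<or> b = -1 \<Longrightarrow> potH s0 i b z' < exp L"
  shows "good z'"
proof -
  obtain tr c0 where q: "knowledge z = (tr, c0)" by (metis surj_pair)
  obtain tr' c0' where q': "knowledge z' = (tr', c0')" by (metis surj_pair)
  have hz': "hist z' = hist z @ [(u, hh_out (knowledge z'))]" by (rule hist_astep[OF z'])
  have v': "valid_history k n (hist z')" "length (hist z') \<le> m" "hist z' \<noteq> []"
    using v u by (auto simp: hz' valid_history_snoc)
  have gs: "events z \<le> c0 + phase_budget" "c0 \<le> phase tr * (phase_budget + 8 * C * k)"
    using g by (auto simp: good_def q Let_def)
  note ctx = g v u q
  have rpb: "0 \<le> report_prob z u" "report_prob z u \<le> 1"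
    using sampling(2,3) by (auto simp: report_prob_eq[OF ctx])
  have "c0' \<le> phase tr' * (phase_budget + 8 * C * k)"
    using z' rpb
  proof (cases rule: astep_cases)
    case silent
    then show ?thesis using q q' gs by simp
  next
    case (reported aux)
    then have a: "aux \<in> set_pmf (D z u tr)" using draw_eq[OF ctx] by simp
    note kp = reported_props[OF ctx a]
    have tr': "tr' = new_trace z u tr aux" using kp(1) reported q' by simp
    show ?thesis
    proof (cases "phase tr' = phase tr")
      case True
      then show ?thesis using kp(2) tr' reported q' gs by simp
    next
      case False
      have "phase tr + 1 \<le> phase tr'" using phase_new[OF ctx, of aux] False tr' by simp
      then have le: "(phase tr + 1) * (phase_budget + 8 * C * k) \<le> phase tr' * (phase_budget + 8 * C * k)"
        by (rule mult_le_mono1)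
      have "c0' = events z + 1 + length (answers z u aux) + k"
        using kp(3) False tr' reported q' by simp
      moreover have "length (answers z u aux) \<le> 4 * (C * k) + k"
        using length_answers[OF ctx a] trials_props(5)[OF ctx] by simp
      moreover have "1 \<le> C * k" "k \<le> C * k" using C_ge k by (auto simp: Suc_le_eq)
      ultimately have "c0' \<le> c0 + phase_budget + 8 * (C * k)" using gs(1) by linarith
      then show ?thesis using gs(2) le by (simp add: algebra_simps)
    qed
  qed
  with v' q' csmall Esmall Hsmall show ?thesis by (intro good_if_small)
qed

text \<open>With \<open>r\<close> the norm, a heavy item has estimate at least
  \<open>7 / 8 * \<epsilon> * r\<close> and a light one at most
  \<open>5 / 8 * \<epsilon> * r\<close>. The root of the estimated \<open>F\<^sub>2\<close> is
  within 7 percent of \<open>r\<close>, so the threshold stays strictly between.\<close>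

lemma good_correct:
  assumes "good z" "valid_history k n (hist z)" "hist z \<noteq> []"
  shows "heavy_hitters \<epsilon> n (freq (hist z)) (hh_out (knowledge z))"
proof -
  obtain tr c0 where q: "knowledge z = (tr, c0)" by (metis surj_pair)
  define N where "N = F2 n (freq (hist z))"
  define r where "r = sqrt N"
  have g: "87 / 100 * N \<le> F2_est tr" "F2_est tr \<le> 11 / 10 * N"
    and fr: "\<And>i. i < n \<Longrightarrow> \<bar>freq_est i tr - freq (hist z) i\<bar> \<le> \<epsilon> / 8 * r"
    using assms(1) by (auto simp: good_def q Let_def N_def r_def)
  obtain h e where he: "hist z = h @ [e]" using assms(3) by (cases "hist z" rule: rev_cases) auto
  obtain u w where e: "e = (u, w)" by fastforce
  have "snd u < n" using assms(2) by (auto simp: he e valid_history_def)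
  moreover have "1 \<le> freq (hist z) (snd u)" by (simp add: he e freq_snoc)
  ultimately have N1: "1 \<le> N" using freq_le_F2[of "snd u" n "hist z"] unfolding N_def by linarith
  have r: "0 < r" using N1 by (simp add: r_def)
  have er: "0 < \<epsilon> * r" using r eps by simp
  have hi: "sqrt (F2_est tr) \<le> 21 / 20 * r"
  proof -
    have "sqrt (F2_est tr) \<le> sqrt ((21 / 20)\<^sup>2 * N)"
      using g N1 by (intro real_sqrt_le_mono) (simp add: power2_eq_square)
    then show ?thesis by (simp add: real_sqrt_mult r_def)
  qed
  have lo: "93 / 100 * r \<le> sqrt (F2_est tr)"
  proof -
    have "sqrt ((93 / 100)\<^sup>2 * N) \<le> sqrt (F2_est tr)"
      using g N1 by (intro real_sqrt_le_mono) (simp add: power2_eq_square)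
    then show ?thesis by (simp add: real_sqrt_mult r_def)
  qed
  have hi': "\<epsilon> * sqrt (F2_est tr) \<le> 21 / 20 * (\<epsilon> * r)" and lo': "93 / 100 * (\<epsilon> * r) \<le> \<epsilon> * sqrt (F2_est tr)"
    using mult_left_mono[OF hi, of \<epsilon>] mult_left_mono[OF lo, of \<epsilon>] eps by (auto simp: mult_ac)
  have nr: "norm2 n (freq (hist z)) = r" by (simp add: norm2_eq r_def N_def)
  show ?thesis
    unfolding heavy_hitters_def nr
  proof (intro conjI allI impI)
    show "dom (hh_out (knowledge z)) \<subseteq> {..<n}" by (auto simp: hh_out_def split: if_splits)
    show "i \<in> dom (hh_out (knowledge z))" if "i < n" "\<epsilon> * r \<le> real (freq (hist z) i)" for i
    proof -
      have "3 / 4 * \<epsilon> * sqrt (F2_est tr) \<le> freq_est i tr"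
        using fr[OF that(1)] that(2) hi' er unfolding abs_le_iff by linarith
      then show ?thesis using that(1) by (simp add: hh_out_def q dom_def)
    qed
    show "i \<notin> dom (hh_out (knowledge z))" if "i < n" "real (freq (hist z) i) \<le> \<epsilon> / 2 * r" for i
    proof -
      have "freq_est i tr < 3 / 4 * \<epsilon> * sqrt (F2_est tr)"
        using fr[OF that(1)] that(2) lo' er unfolding abs_le_iff by linarith
      then show ?thesis by (simp add: hh_out_def q dom_def)
    qed
    show "\<bar>w - real (freq (hist z) i)\<bar> \<le> \<epsilon> / 4 * r" if "hh_out (knowledge z) i = Some w" for i w
    proof -
      have "i < n" "w = freq_est i tr" using that by (auto simp: hh_out_def q split: if_splits)
      then show ?thesis using fr[of i] er by auto
    qed
  qed
qed

theorem hh_robust: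
  assumes "real m * (real (2 * (n + 1) * (smax + 1) + 1) * ((real m + 2) * exp (-L))) \<le> \<delta>"
    and "real ((LEN + 1) * (2 * (budget + 1 + (4 * C * k + k) + k) + k)) \<le> bound"
  shows "robustly_monitors prot k n m (heavy_hitters \<epsilon> n) \<delta> bound"
proof -
  \<comment> \<open>Sign 0 selects the cost potential. The item index runs up to \<open>n\<close>
    inclusive, and the extra value \<open>n\<close> selects the potential of
    \<open>F\<^sub>2\<close>.\<close>
  define \<Phi> where "\<Phi> = (\<lambda>(i, s0, b). if b = 0 then cpot else if i < n then potH s0 i b else potE s0 b)"
  define I where "I = insert (0, 0, 0 :: real) ({..n} \<times> {..smax} \<times> {1, -1})"
  have card: "card I \<le> 2 * (n + 1) * (smax + 1) + 1"
  proof -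
    have "card I \<le> Suc (card ({..n} \<times> {..smax} \<times> {1, -1 :: real}))" unfolding I_def by (rule card_insert_le_m1) auto
    also have "\<dots> = 2 * (n + 1) * (smax + 1) + 1" by (simp add: card_cartesian_product)
    finally show ?thesis .
  qed
  have cases: "(b = 0 \<and> \<Phi> (i, s0, b) = cpot) \<or> ((b = 1 \<or> b = -1) \<and> \<Phi> (i, s0, b) = potH s0 i b)
      \<or> ((b = 1 \<or> b = -1) \<and> \<Phi> (i, s0, b) = potE s0 b)" if "(i, s0, b) \<in> I" for i s0 b
    using that by (auto simp: I_def \<Phi>_def)
  show ?thesis
  proof (rule robustly_monitors_prot[where G = good and \<Phi> = \<Phi> and I = I and L = L])
    show "finite I" by (simp add: I_def)
    have ai: "hist ainit = []" "knowledge ainit = ([], 0)" "events ainit = 0" by (simp_all add: ainit_def)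
    have f0: "freq ([] :: (nat \<Rightarrow> real option) history) i = 0" for i by (simp add: freq_def)
    have c0: "counts ([] :: (nat \<Rightarrow> real option) history) i = (\<lambda>l. 0)" for i by (auto simp: counts_def)
    have F0: "F2 n (freq (hist ainit)) = 0" by (simp add: ai F2_def f0)
    have ph: "phase [] = 0" by (simp add: phase_def F2_est_def)
    have "smax \<noteq> 0"
    proof
      assume "smax = 0"
      then have "2 * (real m)\<^sup>2 + 2 < 1" using smax by simp
      then show False using zero_le_power2[of "real m"] by linarith
    qed
    then show "good ainit" using F0 by (simp add: good_def ai ph F2_est_def freq_est_def f0)
    show "\<Phi> i ainit \<le> 1" if "i \<in> I" for i
    proof -
      obtain j s0 b where i: "i = (j, s0, b)" by (metis prod_cases3)
      have "cpot ainit = 1" using F0 by (simp add: cpot_def ai)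
      moreover have "potE s0 b ainit \<le> 1" if "b = 1 \<or> b = -1"
        using F0 that by (auto simp: potE_def ai ph F2_est_def refE_def F2_low_def f0 Let_def)
      moreover have "potH s0 j b ainit \<le> 1" if b: "b = 1 \<or> b = -1"
      proof -
        have "0 \<le> cutoff s0" using eps by (simp add: cutoff_def)
        then have "refH s0 j b (hist ainit) = 0" by (simp add: refH_def ai f0 c0 excess_def)
        moreover have "harms k (counts (hist ainit) j) = 0" by (simp add: ai c0 harms_def harm_expand(1))
        ultimately show ?thesis by (simp add: potH_def ai ph freq_est_def)
      qed
      ultimately show ?thesis using cases[of j s0 b] that i by auto
    qed
    show "0 \<le> \<Phi> i z" for i z
      by (cases i) (auto simp: \<Phi>_def potE_def potH_def cpot_def Let_def)
    show "measure_pmf.expectation (astep z u) (\<Phi> i) \<le> \<Phi> i z + 1"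
      if a: "i \<in> I" "good z" "valid_history k n (hist z)" "length (hist z) < m" "u \<in> {..<k} \<times> {..<n}" for i z u
    proof -
      obtain j s0 b where i: "i = (j, s0, b)" by (metis prod_cases3)
      obtain tr c0 where q: "knowledge z = (tr, c0)" by (metis surj_pair)
      note ctx = a(2-5) q
      show ?thesis
        using cases[of j s0 b] a(1) cpot_drift[OF ctx] potE_drift[OF ctx, of b s0] potH_drift[OF ctx, of b s0 j]
        by (auto simp: i)
    qed
    show "good z'"
      if "good z" "valid_history k n (hist z)" "length (hist z) < m" "u \<in> {..<k} \<times> {..<n}"
        "z' \<in> set_pmf (astep z u)" "\<And>i. i \<in> I \<Longrightarrow> \<Phi> i z' < exp L" for z z' u
    proof (rule good_preserved[OF that(1-5)])
      show "cpot z' < exp L" using that(6)[of "(0, 0, 0)"] by (simp add: I_def \<Phi>_def)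
      show "potE s0 b z' < exp L" if "s0 \<le> smax" "b = 1 \<or> b = -1" for s0 b
        using \<open>\<And>i. i \<in> I \<Longrightarrow> \<Phi> i z' < exp L\<close>[of "(n, s0, b)"] that by (auto simp: I_def \<Phi>_def)
      show "potH s0 i b z' < exp L" if "s0 \<le> smax" "i < n" "b = 1 \<or> b = -1" for s0 i b
        using \<open>\<And>i. i \<in> I \<Longrightarrow> \<Phi> i z' < exp L\<close>[of "(i, s0, b)"] that by (auto simp: I_def \<Phi>_def)
    qed
    show "heavy_hitters \<epsilon> n (freq (hist z)) (hh_out (knowledge z))"
      if "good z" "valid_history k n (hist z)" "hist z \<noteq> []" for z
      using good_correct that by simp
    have "real m * (real (card I) * ((real m + 2) * exp (-L)))
        \<le> real m * (real (2 * (n + 1) * (smax + 1) + 1) * ((real m + 2) * exp (-L)))"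
      using card by (intro mult_left_mono mult_right_mono) (auto simp only: of_nat_le_iff, auto)
    then show "real m * (real (card I) * ((real m + 2) * exp (-L))) \<le> \<delta>" using assms(1) by linarith
    show "real ((LEN + 1) * (2 * (budget + 1 + (4 * C * k + k) + k) + k)) \<le> bound" by (rule assms(2))
  qed
qed

end

section \<open>Choice of parameters\<close>

lemma harm_le_ln: "m \<ge> 1 \<Longrightarrow> harm m \<le> 1 + ln (real m)"
proof -
  assume "m \<ge> 1"
  then obtain j where j: "m = Suc j" by (cases m) auto
  have "harm (Suc j) - ln (real (Suc j)) \<le> harm (Suc 0) - ln (real (Suc 0))"
    using decseqD[OF decseq_harm_diff_ln, of 0 j] by simp
  then show ?thesis by (simp add: j harm_expand)
qed

lemma two_power_le_exp: "(2 :: real) ^ j \<le> exp (real j)"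
proof -
  have "(2 :: real) ^ j \<le> exp 1 ^ j"
    using exp_ge_add_one_self[of 1] by (intro power_mono) auto
  then show ?thesis by (simp flip: exp_of_nat_mult)
qed

locale monitoring_parameters =
  fixes d a k n m :: nat and \<epsilon> :: real
  assumes eps: "0 < \<epsilon>" "\<epsilon> < 1" and k: "k \<ge> 1" and n: "n \<ge> 2" and m: "m \<le> n ^ d"
begin

definition ell :: nat where "ell = nat \<lceil>log 2 (real n)\<rceil>"
text \<open>The sum \<open>d + (4 * d + 9) + (d + 2) + a\<close> of the exponents of
  \<open>2 ^ ell\<close> that bound \<open>m\<close>, the number of potentials, \<open>m + 2\<close>
  and \<open>n ^ a\<close> in the union bound.\<close>

definition p :: nat where "p = 6 * d + 11 + a"
definition L :: real where "L = p * ell"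
definition smax :: nat where "smax = (2 * d + 3) * ell"
text \<open>Leaves room for the code of an item and a count, which is at most
  \<open>(n + m + 2)\<^sup>2\<close>.\<close>

definition LEN :: nat where "LEN = (2 * d + 8) * ell"
definition H :: real where "H = (d + 1) * ell"

lemma log_n: "1 \<le> log 2 (real n)"
  using n by (simp add: le_log_iff)

lemma l_ge: "1 \<le> ell"
  using log_n unfolding ell_def by linarith

lemma l_le: "real ell \<le> 2 * log 2 (real n)"
  using log_n unfolding ell_def by linarith

lemma n_le: "n \<le> 2 ^ ell"
proof -
  have "real n = 2 powr log 2 (real n)" using n by simp
  also have "\<dots> \<le> 2 powr real ell" unfolding ell_def by (intro powr_mono) (auto intro: real_nat_ceiling_ge)
  also have "\<dots> = real (2 ^ ell)" by (simp add: powr_realpow)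
  finally show ?thesis by (simp only: of_nat_le_iff)
qed

lemma m_le: "m \<le> 2 ^ (d * ell)"
proof -
  have "n ^ d \<le> (2 ^ ell) ^ d" using n_le by (intro power_mono) auto
  then show ?thesis using m by (simp add: power_mult[symmetric] mult.commute)
qed

lemma pow_le: "i \<le> j \<Longrightarrow> (2 :: nat) ^ i \<le> 2 ^ j"
  by (intro power_increasing) auto

lemma sum_n_m: "n + m + 2 \<le> 2 ^ ((d + 3) * ell)"
proof -
  have "(2 :: nat) ^ 1 \<le> 2 ^ ell" "(2 :: nat) ^ ell \<le> 2 ^ ((d + 1) * ell)" "(2 :: nat) ^ (d * ell) \<le> 2 ^ ((d + 1) * ell)"
    using l_ge by (intro pow_le; simp)+
  then have "n + m + 2 \<le> 4 * 2 ^ ((d + 1) * ell)" using n_le m_le unfolding power_one_right by linarith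
  also have "\<dots> = 2 ^ 2 * 2 ^ ((d + 1) * ell)" by simp
  also have "\<dots> = 2 ^ (2 + (d + 1) * ell)" by (rule power_add[symmetric])
  also have "\<dots> \<le> 2 ^ ((d + 3) * ell)" using l_ge by (intro pow_le) (simp add: algebra_simps)
  finally show ?thesis .
qed

lemma LEN_pow: "2 ^ ((2 * d + 6) * ell) < (2 :: nat) ^ LEN"
  using l_ge by (intro power_strict_increasing) (auto simp: LEN_def)

lemma small: "n < 2 ^ LEN" "Suc m < 2 ^ LEN" "m < 2 ^ LEN"
  "i < n \<Longrightarrow> x \<le> m \<Longrightarrow> prod_encode (i, x) < 2 ^ LEN"
proof -
  have "(n + m + 2)\<^sup>2 \<le> (2 ^ ((d + 3) * ell))\<^sup>2" using sum_n_m by (intro power_mono) auto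
  also have "\<dots> = 2 ^ ((2 * d + 6) * ell)" by (simp add: power_mult[symmetric] algebra_simps)
  finally have sq: "(n + m + 2)\<^sup>2 < 2 ^ LEN" using LEN_pow by linarith
  have "n + m + 2 \<le> (n + m + 2)\<^sup>2" by (simp add: power2_eq_square)
  then show "n < 2 ^ LEN" "Suc m < 2 ^ LEN" "m < 2 ^ LEN" using sq by linarith+
  assume i: "i < n" "x \<le> m"
  have "triangle j \<le> j * Suc j" for j by (simp add: triangle_def)
  then have "prod_encode (i, x) \<le> (i + x) * Suc (i + x) + i" by (simp add: prod_encode_def)
  also have "\<dots> \<le> (i + x + 2)\<^sup>2" by (simp add: power2_eq_square algebra_simps)
  also have "\<dots> \<le> (n + m + 2)\<^sup>2" using i by (intro power_mono) auto
  finally show "prod_encode (i, x) < 2 ^ LEN" using sq by linarith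
qed

lemma LEN: "smax + 1 < LEN"
  using l_ge by (simp add: smax_def LEN_def algebra_simps)

lemma L_ge: "1 \<le> L"
proof -
  have "1 * 1 \<le> p * ell" using l_ge by (intro mult_le_mono) (auto simp: p_def)
  then have "1 \<le> real (p * ell)" by linarith
  then show ?thesis by (simp add: L_def)
qed

lemma H_ge: "1 \<le> H" "harm m \<le> H"
proof -
  have "1 * 1 \<le> (d + 1) * ell" using l_ge by (intro mult_le_mono) auto
  then have "1 \<le> real ((d + 1) * ell)" by linarith
  then show H1: "1 \<le> H" by (simp add: H_def)
  show "harm m \<le> H"
  proof (cases "m = 0")
    case True
    then show ?thesis using H1 by (simp add: harm_expand)
  next
    case False
    have "real m \<le> 2 ^ (d * ell)" using m_le by (metis of_nat_le_iff of_nat_numeral of_nat_power)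
    also have "\<dots> \<le> exp (real (d * ell))" by (rule two_power_le_exp)
    finally have "ln (real m) \<le> ln (exp (real (d * ell)))" using False by (intro ln_mono) auto
    then have "harm m \<le> 1 + real (d * ell)" using harm_le_ln[of m] False by simp
    also have "\<dots> \<le> H" using l_ge by (simp add: H_def algebra_simps)
    finally show ?thesis .
  qed
qed

lemma H_eq: "H = (real d + 1) * real ell"
  by (simp add: H_def algebra_simps)

lemma smax: "2 * n < 2 ^ smax" "2 * (real m)\<^sup>2 + 2 < 2 ^ smax"
proof -
  have "(2 :: nat) * n \<le> 2 ^ Suc ell" using n_le by simp
  also have "\<dots> < 2 ^ smax" using l_ge by (intro power_strict_increasing) (auto simp: smax_def algebra_simps)
  finally show "2 * n < 2 ^ smax" .
  have "m\<^sup>2 \<le> (2 ^ (d * ell))\<^sup>2" using m_le by (intro power_mono) auto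
  also have "\<dots> = 2 ^ (2 * d * ell)" by (simp add: power_mult[symmetric] mult_ac)
  finally have "2 * m\<^sup>2 + 2 \<le> 4 * 2 ^ (2 * d * ell)"
    using one_le_power[of "2 :: nat" "2 * d * ell"] by linarith
  also have "\<dots> < 2 ^ 3 * 2 ^ (2 * d * ell)" by simp
  also have "\<dots> = 2 ^ (3 + 2 * d * ell)" by (rule power_add[symmetric])
  also have "\<dots> \<le> 2 ^ smax" using l_ge by (intro pow_le) (simp add: smax_def algebra_simps)
  finally have "real (2 * m\<^sup>2 + 2) < real (2 ^ smax)" by (simp only: of_nat_less_iff)
  then show "2 * (real m)\<^sup>2 + 2 < 2 ^ smax" by simp
qed

lemma failure:
  assumes "X \<le> 2 ^ ((4 * d + 9) * ell)"
  shows "real m * (real X * ((real m + 2) * exp (-L))) \<le> 1 / real n ^ a"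
proof -
  let ?t = "\<lambda>j. (2 :: nat) ^ (j * ell)"
  have m2: "m + 2 \<le> ?t (d + 2)"
  proof -
    have "m + 2 \<le> 4 * 2 ^ (d * ell)" using m_le one_le_power[of "2 :: nat" "d * ell"] by linarith
    also have "\<dots> = 2 ^ 2 * 2 ^ (d * ell)" by simp
    also have "\<dots> = 2 ^ (2 + d * ell)" by (rule power_add[symmetric])
    also have "\<dots> \<le> ?t (d + 2)" using l_ge by (intro pow_le) (simp add: algebra_simps)
    finally show ?thesis .
  qed
  have "m * (X * (m + 2)) * n ^ a \<le> ?t d * (?t (4 * d + 9) * ?t (d + 2)) * (2 ^ ell) ^ a"
    using m_le assms m2 n_le by (intro mult_le_mono power_mono) auto
  also have "\<dots> = 2 ^ (d * ell + ((4 * d + 9) * ell + (d + 2) * ell) + ell * a)"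
    by (simp only: power_add power_mult)
  also have "\<dots> = 2 ^ (p * ell)" by (simp add: p_def algebra_simps)
  finally have "real (m * (X * (m + 2)) * n ^ a) \<le> real (2 ^ (p * ell))" by (simp only: of_nat_le_iff)
  also have "\<dots> \<le> exp L" using two_power_le_exp[of "p * ell"] by (simp add: L_def)
  finally have "real m * (real X * (real m + 2)) * real n ^ a \<le> exp L"
    by (simp only: of_nat_mult of_nat_add of_nat_power of_nat_numeral)
  moreover have "0 < real n ^ a" using n by simp
  ultimately have "real m * (real X * (real m + 2)) \<le> exp L / real n ^ a" by (simp add: le_divide_eq)
  then have "real m * (real X * (real m + 2)) * exp (-L) \<le> exp L / real n ^ a * exp (-L)"
    by (intro mult_right_mono) auto
  also have "\<dots> = 1 / real n ^ a" by (simp add: exp_minus)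
  finally show ?thesis by (simp add: mult_ac)
qed

section \<open>Total communication\<close>

definition U :: real where "U = k / \<epsilon>\<^sup>2"

lemma eps_sq: "1 \<le> 1 / \<epsilon>\<^sup>2" "1 \<le> U" "real k \<le> U"
proof -
  have "\<epsilon>\<^sup>2 \<le> 1" using eps by (simp add: power_le_one)
  then show e: "1 \<le> 1 / \<epsilon>\<^sup>2" using eps by simp
  have "real k * 1 \<le> real k * (1 / \<epsilon>\<^sup>2)" using e by (intro mult_left_mono) auto
  then show "real k \<le> U" by (simp add: U_def)
  then show "1 \<le> U" using k by linarith
qed

lemma grow: "0 \<le> b \<Longrightarrow> i \<le> j \<Longrightarrow> b * real ell ^ i \<le> b * real ell ^ j"
  using l_ge by (intro mult_left_mono power_increasing) auto

lemma one_le_grow: "1 \<le> b \<Longrightarrow> 1 \<le> b * real ell ^ j"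
  using grow[of b 0 j] unfolding power_0 mult_1_right by linarith

text \<open>A budget of order \<open>ell ^ 5\<close> and messages of order \<open>ell\<close> bits
  give the sixth power of the logarithm. Smaller budgets are rounded up so that all protocols share
  this estimate.\<close>

lemma final_cost:
  fixes c b :: real
  assumes "real bud \<le> c * (b * real ell ^ 5)" "real PL \<le> c * (b * real ell ^ 5)" "1 \<le> b" "real k \<le> b" "1 \<le> c"
  shows "real ((LEN + 1) * (2 * (bud + 1 + PL + k) + k)) \<le> 10 * (2 * d + 9) * c * (b * real ell ^ 6)"
proof -
  let ?W = "b * real ell ^ 5"
  have W: "1 \<le> ?W" "real k \<le> ?W" 
    using assms grow[of b 0 5] one_le_grow[of b 5] unfolding power_0 mult_1_right by linarith+
  have cW: "?W \<le> c * ?W" using W assms mult_right_mono[of 1 c ?W] by simp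
  have "real (2 * (bud + 1 + PL + k) + k) \<le> 10 * (c * ?W)"
    using assms(1,2) W cW by simp
  moreover have "real (LEN + 1) \<le> (2 * d + 9) * ell"
    using l_ge by (simp add: LEN_def algebra_simps)
  ultimately have "real (LEN + 1) * real (2 * (bud + 1 + PL + k) + k) \<le> ((2 * d + 9) * ell) * (10 * (c * ?W))"
    by (intro mult_mono) auto
  also have "\<dots> = 10 * (2 * d + 9) * c * (b * real ell ^ 6)"
    by (simp add: power_Suc[of _ 5, simplified] mult_ac)
  finally show ?thesis by (simp only: of_nat_mult)
qed

lemma phased_budget:
  fixes c b :: real
  assumes "real w \<le> c * (b * real ell ^ 4)" "1 \<le> b" "1 \<le> c"
  shows "real ((smax + 1) * w + 1) \<le> (2 * d + 5) * c * (b * real ell ^ 5)"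
proof -
  have "real (smax + 1) \<le> (2 * d + 4) * ell" using l_ge by (simp add: smax_def algebra_simps)
  then have "real (smax + 1) * real w \<le> ((2 * d + 4) * ell) * (c * (b * real ell ^ 4))"
    using assms by (intro mult_mono) auto
  also have "\<dots> = (2 * d + 4) * (c * (b * real ell ^ 5))"
    by (simp add: power_Suc[of _ 4, simplified] mult_ac)
  finally have 1: "real (smax + 1) * real w \<le> (2 * d + 4) * (c * (b * real ell ^ 5))" .
  have "1 * 1 \<le> c * (b * real ell ^ 5)"
    using assms one_le_grow[of b 5] by (intro mult_mono) auto
  then have "real (smax + 1) * real w + 1 \<le> (2 * d + 4) * (c * (b * real ell ^ 5)) + c * (b * real ell ^ 5)"
    using 1 by linarith
  also have "\<dots> = (2 * d + 5) * c * (b * real ell ^ 5)" by (simp add: algebra_simps)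
  finally show ?thesis by (simp only: of_nat_add of_nat_mult of_nat_1)
qed

lemma L_pow: "0 \<le> b \<Longrightarrow> b * L \<le> p * (b * real ell ^ 4)"
  using grow[of b 1 4] mult_left_mono[of "b * real ell ^ 1" "b * real ell ^ 4" p] by (simp add: L_def mult_ac)

lemma f0_protocol:
  "\<exists>P :: real nat_protocol. robustly_monitors P k n m (approximates \<epsilon> (F0 n)) (1 / real n ^ a)
    (10 * (2 * d + 9) * ((2 * d + 5) * (3 * p + 1632 * p * (d + 1) + 5)) * (U * real ell ^ 6))"
proof -
  define A where "A = nat \<lceil>16 * L / \<epsilon>\<^sup>2\<rceil>"
  interpret f0: f0_tracking k n m LEN smax A \<epsilon> L
    by unfold_locales (use k eps L_ge smax n small LEN in \<open>auto simp: A_def real_nat_ceiling_ge\<close>)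
  let ?W = "U * real ell ^ 4"
  let ?c = "3 * real p + 1632 * real p * (real d + 1) + 5"
  have W: "1 \<le> ?W" "U \<le> ?W" using one_le_grow[of U 4] grow[of U 0 4] eps_sq by auto
  have kA: "real k * A \<le> 17 * L * U"
  proof -
    have "1 * 1 \<le> L * (1 / \<epsilon>\<^sup>2)" using L_ge eps_sq by (intro mult_mono) auto
    moreover have "0 \<le> 16 * L / \<epsilon>\<^sup>2" using L_ge by simp
    ultimately have "real A \<le> 17 * L / \<epsilon>\<^sup>2" unfolding A_def by simp linarith
    then have "real k * A \<le> real k * (17 * L / \<epsilon>\<^sup>2)" by (intro mult_left_mono) auto
    then show ?thesis by (simp add: U_def mult_ac)
  qed
  have "real f0.phase_budget \<le> 3 * k * (L + 32 * A * harm m) + 1"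
  proof -
    have "0 \<le> 3 * k * (L + 32 * A * harm m)" using L_ge harm_nonneg[of m, where 'a = real] by simp
    then show ?thesis unfolding f0.phase_budget_def by linarith
  qed
  also have "3 * k * (L + 32 * A * harm m) = 3 * (k * L) + 96 * ((k * A) * harm m)" by (simp add: algebra_simps)
  also have "(k * A) * harm m \<le> (17 * L * U) * H"
    using kA H_ge harm_nonneg[of m, where 'a = real] L_ge eps_sq by (intro mult_mono) auto
  also have "(17 * L * U) * H = 17 * (real p * (real d + 1) * (U * real ell ^ 2))"
    by (simp add: L_def H_eq power2_eq_square mult_ac)
  also have "real p * (real d + 1) * (U * real ell ^ 2) \<le> real p * (real d + 1) * ?W"
    using grow[of U 2 4] eps_sq by (intro mult_left_mono) auto
  also have "k * L \<le> p * ?W"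
    using L_pow[of U] eps_sq L_ge mult_right_mono[of k U L] by linarith
  finally have "real f0.phase_budget \<le> 3 * (p * ?W) + 96 * (17 * (real p * (real d + 1) * ?W)) + 1" by simp
  moreover have "real k \<le> ?W" using eps_sq W by linarith
  ultimately have "real (f0.phase_budget + 4 * k) \<le> 3 * (p * ?W) + 96 * (17 * (real p * (real d + 1) * ?W)) + 5 * ?W"
    using W by simp
  also have "\<dots> = ?c * ?W" by (simp add: algebra_simps)
  finally have w: "real (f0.phase_budget + 4 * k) \<le> ?c * ?W" .
  have c: "1 \<le> ?c" by simp
  have bud: "real f0.budget \<le> ((2 * d + 5) * ?c) * (U * real ell ^ 5)"
    unfolding f0.budget_def using phased_budget[OF w eps_sq(2) c] by simp
  have c5: "5 \<le> (2 * d + 5) * ?c"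
  proof -
    have "5 * 1 \<le> (2 * real d + 5) * ?c" using c by (intro mult_mono) auto
    then show ?thesis by simp
  qed
  have PL: "real (2 * k) \<le> ((2 * d + 5) * ?c) * (U * real ell ^ 5)"
  proof -
    have "real k \<le> U * real ell ^ 5"
      using eps_sq grow[of U 0 5] unfolding power_0 mult_1_right by linarith
    then have "5 * real k \<le> ((2 * d + 5) * ?c) * (U * real ell ^ 5)"
      using c5 by (intro mult_mono) auto
    then show ?thesis by simp
  qed
  have B: "real ((LEN + 1) * (2 * (f0.budget + 1 + 2 * k + k) + k))
      \<le> 10 * (2 * d + 9) * ((2 * d + 5) * ?c) * (U * real ell ^ 6)"
    using c5 by (intro final_cost bud PL eps_sq) auto
  have X: "2 * smax + 3 \<le> 2 ^ ((4 * d + 9) * ell)"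
  proof -
    have "2 * smax + 3 \<le> (4 * d + 9) * ell" using l_ge by (simp add: smax_def algebra_simps)
    also have "\<dots> \<le> 2 ^ ((4 * d + 9) * ell)" by (rule less_imp_le[OF less_exp])
    finally show ?thesis .
  qed
  have "10 * (2 * d + 9) * ((2 * d + 5) * ?c) * (U * real ell ^ 6)
      = 10 * (2 * d + 9) * ((2 * d + 5) * (3 * p + 1632 * p * (d + 1) + 5)) * (U * real ell ^ 6)"
    by (simp add: algebra_simps)
  then show ?thesis using f0.f0_robust[OF failure[OF X] B] by metis
qed

lemma f1_protocol:
  "\<exists>P :: real nat_protocol. robustly_monitors P k n m (approximates \<epsilon> (F1 n)) (1 / real n ^ a)
    (10 * (2 * d + 9) * ((32 * d + 3) * (16 * p + 3) + 1) * ((real k + sqrt k / \<epsilon>) * real ell ^ 6))"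
proof -
  interpret f1: f1_tracking k n m LEN \<epsilon> L "real (d * ell)"
  proof unfold_locales
    have "real m \<le> 2 ^ (d * ell)" using m_le by (metis of_nat_le_iff of_nat_numeral of_nat_power)
    also have "\<dots> \<le> exp (real (d * ell))" by (rule two_power_le_exp)
    finally show "real m \<le> exp (real (d * ell))" .
  qed (use k eps L_ge small in auto)
  let ?b = "real k + sqrt k / \<epsilon>"
  let ?\<beta> = f1.\<beta>
  have "0 \<le> sqrt k / \<epsilon>" "1 \<le> real k" using k eps by auto
  then have b: "1 \<le> ?b" "real k \<le> ?b" "sqrt k / \<epsilon> \<le> ?b" by linarith+
  \<comment> \<open>The two regimes of \<open>\<beta>\<close>: the quotient is \<open>k\<close> when
    the minimum is 1 and \<open>sqrt k / \<epsilon>\<close> otherwise. This is where both summands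
    of the bound originate.\<close>
  have kb: "k / ?\<beta> \<le> ?b"
  proof (cases "1 \<le> sqrt k * \<epsilon>")
    case True
    then show ?thesis using b by (simp add: f1.\<beta>_def)
  next
    case False
    then have "k / ?\<beta> = sqrt k / \<epsilon>" using k eps by (simp add: f1.\<beta>_def real_div_sqrt flip: divide_divide_eq_left)
    then show ?thesis using b by simp
  qed
  have Sb: "16 * L * ?\<beta> / \<epsilon>\<^sup>2 \<le> 16 * L * ?b"
  proof -
    have "?\<beta> / \<epsilon>\<^sup>2 \<le> (sqrt k * \<epsilon>) / \<epsilon>\<^sup>2" by (intro divide_right_mono) (auto simp: f1.\<beta>_def)
    also have "\<dots> = sqrt k / \<epsilon>" using eps by (simp add: power2_eq_square)
    finally have "?\<beta> / \<epsilon>\<^sup>2 \<le> ?b" using b by linarith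
    then have "16 * L * (?\<beta> / \<epsilon>\<^sup>2) \<le> 16 * L * ?b" using L_ge by (intro mult_left_mono) auto
    then show ?thesis by simp
  qed
  have S: "real (f1.S + 2 * k) / ?\<beta> \<le> (16 * p + 3) * (?b * ell)"
  proof -
    have "real (f1.S + 2 * k) \<le> 16 * L * ?\<beta>\<^sup>2 / \<epsilon>\<^sup>2 + 3 * k"
      using f1.S_bounds(2) k by simp
    then have "real (f1.S + 2 * k) / ?\<beta> \<le> (16 * L * ?\<beta>\<^sup>2 / \<epsilon>\<^sup>2 + 3 * k) / ?\<beta>"
      using f1.beta by (intro divide_right_mono) auto
    also have "\<dots> = 16 * L * ?\<beta> / \<epsilon>\<^sup>2 + 3 * (k / ?\<beta>)"
      using f1.beta by (simp add: power2_eq_square add_divide_distrib)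
    also have "\<dots> \<le> 16 * L * ?b + 3 * ?b" using Sb kb by simp
    also have "\<dots> \<le> 16 * L * ?b + 3 * (?b * ell)"
      using mult_left_mono[of 1 "real ell" ?b] b l_ge by (intro add_left_mono mult_left_mono) auto
    also have "\<dots> = (16 * p + 3) * (?b * ell)" by (simp add: L_def algebra_simps)
    finally show ?thesis .
  qed
  define r where "r = nat \<lceil>2 + 32 * real (d * ell) / ?\<beta>\<rceil>"
  have r: "real r \<le> ((32 * d + 3) * ell) / ?\<beta>"
  proof -
    have "0 \<le> 32 * real (d * ell) / ?\<beta>" using f1.beta by simp
    then have "real r \<le> 3 + 32 * real (d * ell) / ?\<beta>" unfolding r_def by linarith
    also have "3 \<le> 3 * ell / ?\<beta>"
    proof -
      have "3 * ?\<beta> \<le> 3 * real ell" using f1.beta l_ge by simp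
      then show ?thesis using f1.beta by (simp add: le_divide_eq)
    qed
    finally show ?thesis by (simp add: add_divide_distrib[symmetric] algebra_simps)
  qed
  have bud: "real f1.budget \<le> ((32 * d + 3) * (16 * p + 3) + 1) * (?b * real ell ^ 5)"
  proof -
    have "real r * real (f1.S + 2 * k) \<le> ((32 * d + 3) * ell) / ?\<beta> * real (f1.S + 2 * k)"
      using r by (intro mult_right_mono) auto
    also have "\<dots> = ((32 * d + 3) * ell) * (real (f1.S + 2 * k) / ?\<beta>)" by simp
    also have "\<dots> \<le> ((32 * d + 3) * ell) * ((16 * p + 3) * (?b * ell))"
      using S by (intro mult_left_mono) auto
    also have "\<dots> = ((32 * d + 3) * (16 * p + 3)) * (?b * real ell ^ 2)"
      by (simp add: power2_eq_square mult_ac)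
    also have "\<dots> \<le> ((32 * d + 3) * (16 * p + 3)) * (?b * real ell ^ 5)"
      using grow[of ?b 2 5] b by (intro mult_left_mono) auto
    finally have "real r * real (f1.S + 2 * k) + 1 \<le>
        ((32 * d + 3) * (16 * p + 3)) * (?b * real ell ^ 5) + ?b * real ell ^ 5"
      using one_le_grow[OF b(1), of 5] by linarith
    moreover have "real f1.budget = real r * real (f1.S + 2 * k) + 1"
      unfolding f1.budget_def r_def by (simp only: of_nat_add of_nat_mult of_nat_1)
    ultimately show ?thesis by (simp add: algebra_simps)
  qed
  have PL: "real k \<le> ((32 * d + 3) * (16 * p + 3) + 1) * (?b * real ell ^ 5)"
  proof -
    have "real k \<le> ?b * real ell ^ 5" using b grow[of ?b 0 5] unfolding power_0 mult_1_right by linarith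
    then have "1 * real k \<le> ((32 * d + 3) * (16 * p + 3) + 1) * (?b * real ell ^ 5)"
      by (intro mult_mono) auto
    then show ?thesis by simp
  qed
  have B: "real ((LEN + 1) * (2 * (f1.budget + 1 + k + k) + k))
      \<le> 10 * (2 * d + 9) * ((32 * d + 3) * (16 * p + 3) + 1) * (?b * real ell ^ 6)"
    using final_cost[OF bud PL b(1,2)] by (simp only: of_nat_mult of_nat_add of_nat_numeral of_nat_1) simp
  have "2 \<le> (2 :: nat) ^ ((4 * d + 9) * ell)"
    using pow_le[of 1 "(4 * d + 9) * ell"] l_ge by simp
  from failure[OF this] show ?thesis using f1.f1_robust[OF _ B] by auto
qed

lemma hh_protocol:
  "\<exists>P :: (nat \<rightharpoonup> real) nat_protocol. robustly_monitors P k n m (heavy_hitters \<epsilon> n) (1 / real n ^ a)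
    (10 * (2 * d + 9) * ((2 * d + 5) * ((36 * p + 8) * (132673 * p * (d + 1)\<^sup>2) + 1)) * (U * real ell ^ 6))"
proof -
  define C where "C = nat \<lceil>131072 * L * H\<^sup>2 + 1600 * L * H / \<epsilon>\<^sup>2\<rceil>"
  have LH: "1 \<le> L * H" "L * H \<le> L * H\<^sup>2"
  proof -
    show 1: "1 \<le> L * H" using mult_mono[of 1 L 1 H] L_ge H_ge by simp
    have "L * H * 1 \<le> L * H * H" using 1 H_ge by (intro mult_left_mono) auto
    then show "L * H \<le> L * H\<^sup>2" by (simp add: power2_eq_square mult_ac)
  qed
  have C: "131072 * L * H\<^sup>2 \<le> C" "1600 * L * H / \<epsilon>\<^sup>2 \<le> C" "real C \<le> 132673 * (L * H\<^sup>2 * (1 / \<epsilon>\<^sup>2))"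
  proof -
    have nn: "0 \<le> 131072 * L * H\<^sup>2" "0 \<le> 1600 * L * H / \<epsilon>\<^sup>2" using L_ge H_ge by auto
    then show "131072 * L * H\<^sup>2 \<le> C" "1600 * L * H / \<epsilon>\<^sup>2 \<le> C" unfolding C_def by linarith+
    have "real C \<le> 131072 * L * H\<^sup>2 + 1600 * L * H / \<epsilon>\<^sup>2 + 1" using nn unfolding C_def by linarith
    moreover have "L * H\<^sup>2 * 1 \<le> L * H\<^sup>2 * (1 / \<epsilon>\<^sup>2)"
      using LH eps_sq by (intro mult_left_mono) auto
    moreover have "L * H * (1 / \<epsilon>\<^sup>2) \<le> L * H\<^sup>2 * (1 / \<epsilon>\<^sup>2)"
      using LH by (intro mult_right_mono) auto
    moreover have "1600 * L * H / \<epsilon>\<^sup>2 = 1600 * (L * H * (1 / \<epsilon>\<^sup>2))" by simp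
    ultimately show "real C \<le> 132673 * (L * H\<^sup>2 * (1 / \<epsilon>\<^sup>2))" using LH by linarith
  qed
  interpret hh: hh_tracking k n m LEN smax C \<epsilon> L H
    by unfold_locales (use k eps L_ge H_ge C smax small LEN in auto)
  let ?e = "132673 * real p * (real d + 1)\<^sup>2"
  let ?c = "(36 * real p + 8) * ?e + 1"
  let ?W = "U * real ell ^ 4"
  have W: "1 \<le> ?W" "U \<le> ?W" using one_le_grow[of U 4] grow[of U 0 4] eps_sq by auto
  have kC: "real C * k \<le> ?e * (U * real ell ^ 3)"
  proof -
    have "real C * k \<le> 132673 * (L * H\<^sup>2 * (1 / \<epsilon>\<^sup>2)) * k"
      using C(3) by (intro mult_right_mono) auto
    also have "H = (real d + 1) * real ell" by (rule H_eq)
    also have "132673 * (L * ((real d + 1) * real ell)\<^sup>2 * (1 / \<epsilon>\<^sup>2)) * k = ?e * (U * real ell ^ 3)"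
      by (simp add: L_def U_def power2_eq_square power3_eq_cube mult_ac)
    finally show ?thesis .
  qed
  have kC4: "real C * k \<le> ?e * ?W"
  proof -
    have "?e * (U * real ell ^ 3) \<le> ?e * ?W" using grow[of U 3 4] eps_sq by (intro mult_left_mono) auto
    then show ?thesis using kC by linarith
  qed
  have CkL: "real C * k * L \<le> real p * (?e * ?W)"
  proof -
    have "real C * k * L \<le> ?e * (U * real ell ^ 3) * L" using kC L_ge by (intro mult_right_mono) auto
    also have "\<dots> = real p * (?e * ?W)" by (simp add: L_def power_Suc[of _ 3, simplified] mult_ac)
    finally show ?thesis .
  qed
  have "real hh.phase_budget \<le> 6 * C * k * (L + 5) + 1"
  proof -
    have "0 \<le> 6 * C * k * (L + 5)" using L_ge by simp
    then show ?thesis unfolding hh.phase_budget_def by linarith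
  qed
  also have "6 * C * k * (L + 5) \<le> 36 * (C * k * L)"
  proof -
    have "real C * k * (L + 5) \<le> real C * k * (6 * L)" using L_ge by (intro mult_left_mono) auto
    then show ?thesis by simp
  qed
  finally have "real hh.phase_budget \<le> 36 * (real p * (?e * ?W)) + 1" using CkL by simp
  then have "real (hh.phase_budget + 8 * C * k) \<le> 36 * (real p * (?e * ?W)) + ?W + 8 * (?e * ?W)"
    using kC4 W by simp
  also have "\<dots> = ?c * ?W" by (simp add: algebra_simps)
  finally have w: "real (hh.phase_budget + 8 * C * k) \<le> ?c * ?W" .
  have e: "1 \<le> ?c" by simp
  have bud: "real hh.budget \<le> ((2 * d + 5) * ?c) * (U * real ell ^ 5)"
    unfolding hh.budget_def using phased_budget[OF w eps_sq(2) e] by simp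
  have c1: "1 \<le> (2 * d + 5) * ?c"
  proof -
    have "1 * 1 \<le> (2 * real d + 5) * ?c" using e by (intro mult_mono) auto
    then show ?thesis by simp
  qed
  have PL: "real (4 * C * k + k) \<le> ((2 * d + 5) * ?c) * (U * real ell ^ 5)"
  proof -
    have "0 \<le> ?e * ?W" using W eps_sq(2) by (intro mult_nonneg_nonneg) auto
    moreover have "real (4 * C * k + k) = 4 * (real C * k) + k" by simp
    ultimately have "real (4 * C * k + k) \<le> 8 * (?e * ?W) + ?W" using kC4 W(2) eps_sq(3) by linarith
    also have "\<dots> = (8 * ?e + 1) * ?W" by (simp add: algebra_simps)
    also have "\<dots> \<le> ((2 * d + 5) * ?c) * (U * real ell ^ 5)"
    proof -
      have "8 * ?e + 1 \<le> 1 * ?c" by (simp add: algebra_simps)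
      also have "\<dots> \<le> (2 * d + 5) * ?c" using e by (intro mult_right_mono) auto
      finally show ?thesis using grow[of U 4 5] eps_sq W c1 by (intro mult_mono) auto
    qed
    finally show ?thesis .
  qed
  have B: "real ((LEN + 1) * (2 * (hh.budget + 1 + (4 * C * k + k) + k) + k))
      \<le> 10 * (2 * d + 9) * ((2 * d + 5) * ?c) * (U * real ell ^ 6)"
    using c1 by (intro final_cost bud PL eps_sq) auto
  have X: "2 * (n + 1) * (smax + 1) + 1 \<le> 2 ^ ((4 * d + 9) * ell)"
  proof -
    have two: "(2 :: nat) \<le> 2 ^ ell" using pow_le[of 1 ell] l_ge by simp
    have "smax + 1 \<le> (2 * d + 4) * ell" using l_ge by (simp add: smax_def algebra_simps)
    also have "\<dots> \<le> 2 ^ ((2 * d + 4) * ell)" by (rule less_imp_le[OF less_exp])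
    finally have s: "smax + 1 \<le> 2 ^ ((2 * d + 4) * ell)" .
    have "2 * (n + 1) * (smax + 1) + 1 \<le> 2 * (2 * ((n + 1) * (smax + 1)))" by simp
    also have "\<dots> \<le> 2 ^ ell * (2 ^ ell * ((2 ^ ell * 2 ^ ell) * 2 ^ ((2 * d + 4) * ell)))"
    proof (intro mult_le_mono two s)
      have "n + 1 \<le> 2 * 2 ^ ell" using n_le two by linarith
      also have "\<dots> \<le> 2 ^ ell * 2 ^ ell" using two by (rule mult_le_mono1)
      finally show "n + 1 \<le> 2 ^ ell * 2 ^ ell" .
    qed
    also have "\<dots> = 2 ^ (ell + (ell + ((ell + ell) + (2 * d + 4) * ell)))" by (simp only: power_add)
    also have "\<dots> \<le> 2 ^ ((4 * d + 9) * ell)" by (intro pow_le) (simp add: algebra_simps)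
    finally show ?thesis .
  qed
  have "10 * (2 * d + 9) * ((2 * d + 5) * ?c) * (U * real ell ^ 6)
      = 10 * (2 * d + 9) * ((2 * d + 5) * ((36 * p + 8) * (132673 * p * (d + 1)\<^sup>2) + 1)) * (U * real ell ^ 6)"
    by (simp add: algebra_simps)
  then show ?thesis using hh.hh_robust[OF failure[OF X] B] by metis
qed

lemma ell_pow: "real ell ^ 6 \<le> 64 * log 2 (real n) ^ 6"
proof -
  have "real ell ^ 6 \<le> (2 * log 2 (real n)) ^ 6" using l_le by (intro power_mono) auto
  then show ?thesis by (simp add: power_mult_distrib)
qed

end

lemma robustly_monitors_mono:
  "robustly_monitors P k n m correct \<delta> B \<Longrightarrow> B \<le> B' \<Longrightarrow> robustly_monitors P k n m correct \<delta> B'"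
  unfolding robustly_monitors_def by (force intro: order.trans)

theorem mainTheorem4:
  fixes d a :: nat
  shows "\<exists>K::real. \<exists>c::nat. K > 0 \<and>
    (\<forall>(\<epsilon>::real) (k::nat) (n::nat) (m::nat).
       0 < \<epsilon> \<and> \<epsilon> < 1 \<and> k \<ge> 1 \<and> n \<ge> 2 \<and> m \<le> n ^ d \<longrightarrow>
         (\<exists>P :: real nat_protocol.
            robustly_monitors P k n m (approximates \<epsilon> (F0 n)) (1 / real n ^ a)
              (real k / \<epsilon>\<^sup>2 * (K * log 2 (real n) ^ c))) \<and>
         (\<exists>P :: real nat_protocol.
            robustly_monitors P k n m (approximates \<epsilon> (F1 n)) (1 / real n ^ a)
              ((real k + sqrt (real k) / \<epsilon>) * (K * log 2 (real n) ^ c))) \<and>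
         (\<exists>P :: (nat \<rightharpoonup> real) nat_protocol.
            robustly_monitors P k n m (heavy_hitters \<epsilon> n) (1 / real n ^ a)
              (real k / \<epsilon>\<^sup>2 * (K * log 2 (real n) ^ c))))"
proof -
  define q where "q = 6 * d + 11 + a"
  define K0 :: real where "K0 = 10 * (2 * d + 9) * ((2 * d + 5) * (3 * q + 1632 * q * (d + 1) + 5))"
  define K1 :: real where "K1 = 10 * (2 * d + 9) * ((32 * d + 3) * (16 * q + 3) + 1)"
  define K2 :: real where "K2 = 10 * (2 * d + 9) * ((2 * d + 5) * ((36 * q + 8) * (132673 * q * (d + 1)\<^sup>2) + 1))"
  \<comment> \<open>The factor \<open>64 = 2 ^ 6\<close> comes from
    \<open>ell \<le> 2 * log 2 n\<close>.\<close>
  define K where "K = 64 * (K0 + K1 + K2)"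
  have "0 < q" by (simp add: q_def)
  then have pos: "0 < K0" "0 < K1" "0 < K2"
    unfolding K0_def K1_def K2_def by (auto intro!: mult_pos_pos add_nonneg_pos)
  have "(\<exists>P :: real nat_protocol.
            robustly_monitors P k n m (approximates \<epsilon> (F0 n)) (1 / real n ^ a)
              (real k / \<epsilon>\<^sup>2 * (K * log 2 (real n) ^ 6))) \<and>
         (\<exists>P :: real nat_protocol.
            robustly_monitors P k n m (approximates \<epsilon> (F1 n)) (1 / real n ^ a)
              ((real k + sqrt (real k) / \<epsilon>) * (K * log 2 (real n) ^ 6))) \<and>
         (\<exists>P :: (nat \<rightharpoonup> real) nat_protocol.
            robustly_monitors P k n m (heavy_hitters \<epsilon> n) (1 / real n ^ a)
              (real k / \<epsilon>\<^sup>2 * (K * log 2 (real n) ^ 6)))"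
    if h: "0 < \<epsilon> \<and> \<epsilon> < 1 \<and> k \<ge> 1 \<and> n \<ge> 2 \<and> m \<le> n ^ d" for \<epsilon> k n m
  proof -
    interpret monitoring_parameters d a k n m \<epsilon> by unfold_locales (use h in auto)
    have le: "Ki * (b * real ell ^ 6) \<le> b * (K * log 2 (real n) ^ 6)"
      if "0 < Ki" "Ki \<le> K0 + K1 + K2" "0 \<le> b" for Ki b
    proof -
      have "Ki * (b * real ell ^ 6) \<le> (K0 + K1 + K2) * (b * (64 * log 2 (real n) ^ 6))"
        using that ell_pow by (intro mult_mono) auto
      also have "\<dots> = b * (K * log 2 (real n) ^ 6)" by (simp add: K_def algebra_simps)
      finally show ?thesis .
    qed
    have U: "U = real k / \<epsilon>\<^sup>2" by (simp add: U_def)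
    have b: "0 \<le> real k / \<epsilon>\<^sup>2" "0 \<le> real k + sqrt (real k) / \<epsilon>" using h by auto
    have pq: "p = q" by (simp add: p_def q_def)
    show ?thesis
      using f0_protocol f1_protocol hh_protocol
        le[OF pos(1) _ b(1)] le[OF pos(2) _ b(2)] le[OF pos(3) _ b(1)] pos
      unfolding pq K0_def[symmetric] K1_def[symmetric] K2_def[symmetric] U
      by (smt (verit, best) robustly_monitors_mono)
  qed
  moreover have "0 < K" using pos by (simp add: K_def)
  ultimately show ?thesis by blast
qed

end
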